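(* Let $M$ be a $4$-dimensional compact oriented Riemannian manifold with boundary $\partial M$, with metric $g^M$ which near $\partial M$ has the form $g^M=\frac{1}{h(x_n)}g^{\partial M}+dx_n^2$ ($n=4$), where $h$ is smooth and positive with $h(0)=1$. Let $D=d+\delta$ be the signature operator on the extension $\widehat M$ of $M$ by a small open collar. Assume that $\partial M$ (with $g^{\partial M}$) is flat. Then $$\int_{\partial M}\mathrm{res}_{1,1}(D^{-1},D^{-1})=\frac{\pi}{2}\,\Omega_3\,I_{\mathrm{Gr},b},\qquad \int_{\partial M}\mathrm{res}_{2,1}(D^{-1},D^{-1})=-\frac{3\pi}{2}\,\Omega_3\,I_{\mathrm{Gr},b},$$ where $\Omega_3=\frac{2\pi^{3/2}}{\Gamma(3/2)}$ and $I_{\mathrm{Gr},b}$ is the boundary term of the gravitational (Einstein–Hilbert) action.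
   Context: Setting: a collar $U\cong\partial M\times[0,1)$ of $\partial M$ in $M$ is fixed, $x_n\in[0,1)$ is the normal coordinate ($x_n=0$ on $\partial M$), $g^{\partial M}$ is a metric on $\partial M$, and $h$ is the restriction to $[0,1)$ of a smooth function $\widetilde h>0$ on $(-\varepsilon,1)$, $\varepsilon>0$ small. $\widehat M=M\cup_{\partial M}\partial M\times(-\varepsilon,0]$ carries a metric $\widehat g$ with $\widehat g|_M=g^M$ and $\widehat g=\frac{1}{\widetilde h(x_n)}g^{\partial M}+dx_n^2$ on the collar. $D=d+\delta$ acts on $\wedge^*(T^*\widehat M)$ (rank $16$). The symbol of $D^{-1}$ is $\sum_{j\ge1}\sigma_{-j}(D^{-1})$, obtained by inverting the symbol of $D$ with the composition formula for pseudodifferential operators. Gravitational action: $I_{\mathrm{Gr}}=\frac{1}{16\pi}\int_Ms\,\mathrm{dvol}_M+2\int_{\partial M}K\,\mathrm{dvol}_{\partial M}=:I_{\mathrm{Gr},i}+I_{\mathrm{Gr},b}$, where $s$ is the scalar curvature; so $I_{\mathrm{Gr},b}=2\int_{\partial M}K\,\mathrm{dvol}_{\partial M}$, where $K=\sum_{1\le i,j\le n-1}K_{i,j}g_{\partial M}^{i,j}$, $K_{i,j}=-\Gamma^n_{i,j}$, and $\Gamma^k_{i,j}$ are the Christoffel symbols of the Levi-Civita connection of $g^M$ in coordinates $(x_1,\dots,x_{n-1},x_n)$ with $x_1,\dots,x_{n-1}$ coordinates on $\partial M$. Definition of $\mathrm{res}_{1,1},\mathrm{res}_{2,1}$: for pseudodifferential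 operators $P,P'$ on $\widehat M$ with the transmission property, locally on $\partial M$ (at $x_n=0$), $$\mathrm{res}_{1,1}(P,P')=-\frac12\int_{|\xi'|=1}\int_{-\infty}^{+\infty}\mathrm{trace}\big[\partial_{x_n}\pi^+_{\xi_n}\sigma_{-1}(P)\cdot\partial^2_{\xi_n}\sigma_{-1}(P')\big]d\xi_n\,\sigma(\xi')dx',$$ $$\mathrm{res}_{2,1}(P,P')=-i\int_{|\xi'|=1}\int_{-\infty}^{+\infty}\mathrm{trace}\big[\pi^+_{\xi_n}\sigma_{-2}(P)\cdot\partial_{\xi_n}\sigma_{-1}(P')\big]d\xi_n\,\sigma(\xi')dx'.$$ Here $\sigma_l(A)$ is the order-$l$ symbol of $A$, $\xi=\xi'+\xi_ndx_n$, $\sigma(\xi')$ is the canonical volume form of the unit sphere $|\xi'|=1$ in $T^*\partial M$, and for a rational function $f$ of $\xi_n$ vanishing at infinity, without real poles, $\pi^+_{\xi_n}f$ is the part of its partial fraction decomposition with poles in the upper half-plane. Conventions for $D=d+\delta$: since $\partial M$ is flat, one uses oriented local coordinates $x'=(x_1,x_2,x_3)$ of $\partial M$ with $g^{\partial M}_{ij}=\delta_{ij}$ (so $\{dx_i\}$ is an oriented orthonormal basis), together with $x_n$; in this way $\mathrm{res}_{1,1}(D^{-1},D^{-1})$ and $\mathrm{res}_{2,1}(D^{-1},D^{-1})$ are two global forms on $\partial M$. The orthonormal frame of $g^M$ is $\widetilde e_i=\sqrt{h(x_n)}\,\partial_{x_i}$ ($i<n$), $\widetilde e_n=\partial_{x_n}$.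 The trace over $\wedge^*(T^*M)$ is computed in the frame $\{dx_{i_1}\wedge\cdots\wedge dx_{i_k}\mid 1\le i_1<\cdots<i_k\le4\}$. With $\epsilon,\iota$ exterior and interior multiplication, $c(\widetilde e_j)=\epsilon(\widetilde e_j^* )-\iota(\widetilde e_j^* )$, $\bar c(\widetilde e_j)=\epsilon(\widetilde e_j^* )+\iota(\widetilde e_j^* )$, and $\nabla^L(\widetilde e_1,\dots,\widetilde e_n)=(\widetilde e_1,\dots,\widetilde e_n)(\omega_{s,t})$ for the Levi-Civita connection $\nabla^L$ of $g^M$, one has $D=\sum_{i=1}^n c(\widetilde e_i)\big[\widetilde e_i+\frac14\sum_{s,t}\omega_{s,t}(\widetilde e_i)[\bar c(\widetilde e_s)\bar c(\widetilde e_t)-c(\widetilde e_s)c(\widetilde e_t)]\big]$, and its symbol is taken to be $p_1+p_0$ with $p_1=\sigma_1(D)=\sqrt{-1}\,c(\xi)$ and $p_0=\sigma_0(D)=\frac14\sum_{i,s,t}\omega_{s,t}(\widetilde e_i)c(\widetilde e_i)[\bar c(\widetilde e_s)\bar c(\widetilde e_t)-c(\widetilde e_s)c(\widetilde e_t)]$. Correspondingly $$\sigma_{-1}(D^{-1})=\frac{\sqrt{-1}\,c(\xi)}{|\xi|^2},\qquad \sigma_{-2}(D^{-1})=\frac{c(\xi)p_0c(\xi)}{|\xi|^4}+\frac{c(\xi)}{|\xi|^6}\sum_jc(dx_j)\big[\partial_{x_j}[c(\xi)]\,|\xi|^2-c(\xi)\,\partial_{x_j}(|\xi|^2)\big].$$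 *)

theory Defs
  imports "HOL-Analysis.Analysis" "HOL-Computational_Algebra.Polynomial"
begin

section \<open>Smooth maps\<close>

primrec Ck_on :: "nat \<Rightarrow> 'e::real_normed_vector set \<Rightarrow> ('e \<Rightarrow> 'f::real_normed_vector) \<Rightarrow> bool" where
  "Ck_on 0 W f \<longleftrightarrow> continuous_on W f"
| "Ck_on (Suc k) W f \<longleftrightarrow> (\<forall>x\<in>W. f differentiable at x) \<and>
     (\<forall>v. Ck_on k W (\<lambda>x. frechet_derivative f (at x) v))"

text \<open>On a set that is not open (a relatively open subset of a half-space), smooth means:
  locally the restriction of a smooth function on an open set.\<close>

definition smooth_on :: "'e::real_normed_vector set \<Rightarrow> ('e \<Rightarrow> 'f::real_normed_vector) \<Rightarrow> bool" where
  "smooth_on S f \<longleftrightarrow> (\<forall>x\<in>S. \<exists>W F. open W \<and> x \<in> W \<and> (\<forall>k. Ck_on k W F) \<and> (\<forall>y\<in>W \<inter> S. F y = f y))"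


section \<open>Oriented smooth manifolds with boundary\<close>

text \<open>A chart is a pair of its domain and its coordinate map; the values of the map outside the
  domain are irrelevant. The model set \<open>H\<close> is a half-space, or \<open>UNIV\<close> for manifolds without
  boundary.\<close>

type_synonym ('a, 'n) chart = "'a set \<times> ('a \<Rightarrow> real ^ 'n)"

definition is_chart :: "'a topology \<Rightarrow> (real ^ 'n::finite) set \<Rightarrow> ('a, 'n) chart \<Rightarrow> bool" where
  "is_chart X H c \<longleftrightarrow> openin X (fst c) \<and> openin (top_of_set H) (snd c ` fst c) \<and>
     homeomorphic_map (subtopology X (fst c)) (top_of_set (snd c ` fst c)) (snd c)"

definition chart_inv :: "('a, 'n::finite) chart \<Rightarrow> real ^ 'n \<Rightarrow> 'a" where
  "chart_inv c = inv_into (fst c) (snd c)"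

definition jacobian :: "('a, 'n::finite) chart \<Rightarrow> ('a, 'n) chart \<Rightarrow> 'a \<Rightarrow> real ^ 'n ^ 'n" where
  "jacobian c c' p = matrix (frechet_derivative (\<lambda>x. snd c' (chart_inv c x))
     (at (snd c p) within snd c ` (fst c \<inter> fst c')))"

definition oriented_compatible :: "('a, 'n::finite) chart \<Rightarrow> ('a, 'n) chart \<Rightarrow> bool" where
  "oriented_compatible c c' \<longleftrightarrow>
     smooth_on (snd c ` (fst c \<inter> fst c')) (\<lambda>x. snd c' (chart_inv c x)) \<and>
     smooth_on (snd c' ` (fst c \<inter> fst c')) (\<lambda>x. snd c (chart_inv c' x)) \<and>
     (\<forall>p\<in>fst c \<inter> fst c'. det (jacobian c c' p) > 0 \<and> det (jacobian c' c p) > 0)"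

definition oriented_atlas :: "'a topology \<Rightarrow> (real ^ 'n::finite) set \<Rightarrow> ('a, 'n) chart set \<Rightarrow> bool" where
  "oriented_atlas X H A \<longleftrightarrow> (\<forall>c\<in>A. is_chart X H c) \<and> (\<Union>c\<in>A. fst c) = topspace X \<and>
     (\<forall>c\<in>A. \<forall>c'\<in>A. oriented_compatible c c')"

text \<open>The maximal oriented atlas: all oriented local coordinates.\<close>

definition charts :: "'a topology \<Rightarrow> (real ^ 'n::finite) set \<Rightarrow> ('a, 'n) chart set \<Rightarrow> ('a, 'n) chart set" where
  "charts X H A = {c. is_chart X H c \<and> (\<forall>a\<in>A. oriented_compatible a c)}"

text \<open>A metric is given by its coefficient matrix in every oriented chart.\<close>

type_synonym ('a, 'n) metric_coeffs = "('a, 'n) chart \<Rightarrow> 'a \<Rightarrow> real ^ 'n ^ 'n"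

definition riemannian_metric ::
  "'a topology \<Rightarrow> (real ^ 'n::finite) set \<Rightarrow> ('a, 'n) chart set \<Rightarrow> ('a, 'n) metric_coeffs \<Rightarrow> bool" where
  "riemannian_metric X H A g \<longleftrightarrow> (\<forall>c\<in>charts X H A.
     smooth_on (snd c ` fst c) (\<lambda>x. g c (chart_inv c x)) \<and>
     (\<forall>p\<in>fst c. transpose (g c p) = g c p \<and> (\<forall>v. v \<noteq> 0 \<longrightarrow> v \<bullet> (g c p *v v) > 0)) \<and>
     (\<forall>c'\<in>charts X H A. \<forall>p\<in>fst c \<inter> fst c'.
        g c p = transpose (jacobian c c' p) ** g c' p ** jacobian c c' p))"

text \<open>Integral of a top-degree form over a compact oriented manifold. The form is given by its
  coefficient of \<open>dx\<^sub>1 \<and> \<dots> \<and> dx\<^sub>n\<close> in every oriented chart. The manifold is cut into disjoint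
  Borel pieces subordinate to a finite cover by chart domains; by the change of variables formula
  the value does not depend on the cover.\<close>

definition form_integral :: "'a topology \<Rightarrow> (real ^ 'n::finite) set \<Rightarrow> ('a, 'n) chart set \<Rightarrow>
    (('a, 'n) chart \<Rightarrow> 'a \<Rightarrow> 'b::{banach, second_countable_topology}) \<Rightarrow> 'b" where
  "form_integral X H A \<omega> =
     (let cs = (SOME cs. set cs \<subseteq> charts X H A \<and> (\<Union>c\<in>set cs. fst c) = topspace X)
      in \<Sum>k<length cs.
           (LINT x:(snd (cs ! k) ` (fst (cs ! k) - (\<Union>j<k. fst (cs ! j))))|lborel.
              \<omega> (cs ! k) (chart_inv (cs ! k) x)))"


section \<open>The boundary, its collar, and the extension of the manifold\<close>

definition half_space :: "(real ^ 4) set" where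
  "half_space = {x. 0 \<le> x $ 4}"

definition tang :: "real ^ 4 \<Rightarrow> real ^ 3" where
  "tang x = vector [x $ 1, x $ 2, x $ 3]"

definition join :: "real ^ 3 \<Rightarrow> real \<Rightarrow> real ^ 4" where
  "join x' s = (\<chi> i. if i = 1 then x' $ 1 else if i = 2 then x' $ 2 else if i = 3 then x' $ 3 else s)"

definition bdry :: "'a topology \<Rightarrow> ('a, 4) chart set \<Rightarrow> 'a set" where
  "bdry X A = {p \<in> topspace X. \<exists>c\<in>A. p \<in> fst c \<and> snd c p $ 4 = 0}"

definition bdry_top :: "'a topology \<Rightarrow> ('a, 4) chart set \<Rightarrow> 'a topology" where
  "bdry_top X A = subtopology X (bdry X A)"

text \<open>\<open>\<partial>M\<close> is oriented so that \<open>(x\<^sub>1, x\<^sub>2, x\<^sub>3)\<close> is oriented when \<open>(x\<^sub>1, x\<^sub>2, x\<^sub>3, x\<^sub>4)\<close> is; in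
  dimension 4 this is also the outward-normal-first orientation of Stokes' theorem.\<close>

definition bdry_atlas :: "'a topology \<Rightarrow> ('a, 4) chart set \<Rightarrow> ('a, 3) chart set" where
  "bdry_atlas X A = (\<lambda>c. (fst c \<inter> bdry X A, \<lambda>p. tang (snd c p))) ` A"

abbreviation bdry_charts :: "'a topology \<Rightarrow> ('a, 4) chart set \<Rightarrow> ('a, 3) chart set" where
  "bdry_charts X A \<equiv> charts (bdry_top X A) UNIV (bdry_atlas X A)"

text \<open>A collar is an open set \<open>Uc\<close> with a diffeomorphism \<open>p \<mapsto> (b p, xn p)\<close> onto
  \<open>\<partial>M \<times> [0,1)\<close> that is the identity on \<open>\<partial>M\<close>. Being an (orientation preserving) diffeomorphism
  is expressed by the compatibility of the product charts with the atlas of the manifold.\<close>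

definition collar_chart :: "'a set \<Rightarrow> ('a \<Rightarrow> 'a) \<Rightarrow> ('a \<Rightarrow> real) \<Rightarrow> ('a, 3) chart \<Rightarrow> ('a, 4) chart" where
  "collar_chart Uc b xn c = ({p \<in> Uc. b p \<in> fst c}, \<lambda>p. join (snd c (b p)) (xn p))"

definition is_collar ::
  "'a topology \<Rightarrow> ('a, 4) chart set \<Rightarrow> 'a set \<Rightarrow> ('a \<Rightarrow> 'a) \<Rightarrow> ('a \<Rightarrow> real) \<Rightarrow> bool" where
  "is_collar X A Uc b xn \<longleftrightarrow> openin X Uc \<and> bdry X A \<subseteq> Uc \<and>
     homeomorphic_map (subtopology X Uc) (prod_topology (bdry_top X A) (top_of_set {0..<1}))
       (\<lambda>p. (b p, xn p)) \<and>
     (\<forall>p\<in>bdry X A. b p = p \<and> xn p = 0) \<and>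
     (\<forall>c\<in>bdry_charts X A. collar_chart Uc b xn c \<in> charts X half_space A)"

text \<open>The matrix of \<open>f g + dx\<^sub>4\<^sup>2\<close>, where \<open>g\<close> is a bilinear form in \<open>dx\<^sub>1, dx\<^sub>2, dx\<^sub>3\<close>.\<close>

definition collar_metric :: "real \<Rightarrow> real ^ 3 ^ 3 \<Rightarrow> real ^ 4 ^ 4" where
  "collar_metric f g = matrix (\<lambda>v. join (f *\<^sub>R (g *v tang v)) (v $ 4))"

text \<open>\<open>M \<union> (\<partial>M \<times> (-\<epsilon>, 0])\<close>, glued along \<open>\<partial>M = \<partial>M \<times> {0}\<close>, realised inside \<open>M \<times> \<real>\<close>;
  \<open>M\<close> sits inside it as \<open>M \<times> {0}\<close>. On the extended collar the normal coordinate is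
  \<open>xn p + s\<close>, since \<open>s = 0\<close> on \<open>M\<close> and \<open>xn p = 0\<close> on the added piece.\<close>

definition ext_top :: "'a topology \<Rightarrow> ('a, 4) chart set \<Rightarrow> real \<Rightarrow> ('a \<times> real) topology" where
  "ext_top X A \<epsilon> = subtopology (prod_topology X euclideanreal)
     ((topspace X \<times> {0}) \<union> (bdry X A \<times> {-\<epsilon><..0}))"

definition ext_collar_chart :: "'a topology \<Rightarrow> ('a, 4) chart set \<Rightarrow> real \<Rightarrow> 'a set \<Rightarrow> ('a \<Rightarrow> 'a) \<Rightarrow>
    ('a \<Rightarrow> real) \<Rightarrow> ('a, 3) chart \<Rightarrow> ('a \<times> real, 4) chart" where
  "ext_collar_chart X A \<epsilon> Uc b xn c =
     ({q \<in> topspace (ext_top X A \<epsilon>). fst q \<in> Uc \<and> b (fst q) \<in> fst c},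
      \<lambda>q. join (snd c (b (fst q))) (xn (fst q) + snd q))"

definition ext_atlas :: "'a topology \<Rightarrow> ('a, 4) chart set \<Rightarrow> real \<Rightarrow> 'a set \<Rightarrow> ('a \<Rightarrow> 'a) \<Rightarrow>
    ('a \<Rightarrow> real) \<Rightarrow> ('a \<times> real, 4) chart set" where
  "ext_atlas X A \<epsilon> Uc b xn =
     (\<lambda>c. ((fst c - bdry X A) \<times> {0}, \<lambda>q. snd c (fst q))) ` A \<union>
     ext_collar_chart X A \<epsilon> Uc b xn ` bdry_charts X A"

text \<open>The metric \<open>g'\<close> of the extension restricts to \<open>g\<close> on \<open>M\<close>: they have the same coefficients
  whenever a chart of the extension prolongs a chart of \<open>M\<close>.\<close>

definition metric_extends :: "('a, 4) chart set \<Rightarrow> ('a \<times> real, 4) chart set \<Rightarrow>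
    ('a, 4) metric_coeffs \<Rightarrow> ('a \<times> real, 4) metric_coeffs \<Rightarrow> bool" where
  "metric_extends C C' g g' \<longleftrightarrow> (\<forall>c\<in>C. \<forall>c'\<in>C'.
     (\<forall>p\<in>fst c. (p, 0) \<in> fst c' \<and> snd c' (p, 0) = snd c p) \<longrightarrow>
     (\<forall>p\<in>fst c. g' c' (p, 0) = g c p))"

text \<open>Flat: locally isometric to Euclidean space.\<close>

definition flat_charts :: "'a topology \<Rightarrow> (real ^ 'n::finite) set \<Rightarrow> ('a, 'n) chart set \<Rightarrow>
    ('a, 'n) metric_coeffs \<Rightarrow> ('a, 'n) chart set" where
  "flat_charts X H A g = {c \<in> charts X H A. \<forall>p\<in>fst c. g c p = mat 1}"

definition flat_manifold :: "'a topology \<Rightarrow> (real ^ 'n::finite) set \<Rightarrow> ('a, 'n) chart set \<Rightarrow>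
    ('a, 'n) metric_coeffs \<Rightarrow> bool" where
  "flat_manifold X H A g \<longleftrightarrow> (\<forall>p\<in>topspace X. \<exists>c\<in>flat_charts X H A g. p \<in> fst c)"


section \<open>Levi-Civita connection in coordinates\<close>

definition pderiv_within :: "(real ^ 'n::finite) set \<Rightarrow> 'n \<Rightarrow> (real ^ 'n \<Rightarrow> 'b::real_normed_vector) \<Rightarrow>
    real ^ 'n \<Rightarrow> 'b" where
  "pderiv_within S j f x = frechet_derivative f (at x within S) (axis j 1)"

text \<open>\<open>christoffel S G x k i j\<close> is \<open>\<Gamma>\<^sup>k\<^sub>i\<^sub>j(x)\<close>; derivatives are taken within the domain \<open>S\<close>,
  hence are one-sided in normal direction at boundary points.\<close>

definition christoffel :: "(real ^ 'n::finite) set \<Rightarrow> (real ^ 'n \<Rightarrow> real ^ 'n ^ 'n) \<Rightarrow> real ^ 'n \<Rightarrow>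
    'n \<Rightarrow> 'n \<Rightarrow> 'n \<Rightarrow> real" where
  "christoffel S G x k i j = (1 / 2) * (\<Sum>l\<in>UNIV. matrix_inv (G x) $ k $ l *
     (pderiv_within S i (\<lambda>y. G y $ j $ l) x + pderiv_within S j (\<lambda>y. G y $ i $ l) x
        - pderiv_within S l (\<lambda>y. G y $ i $ j) x))"

definition cov_deriv :: "(real ^ 'n::finite) set \<Rightarrow> (real ^ 'n \<Rightarrow> real ^ 'n ^ 'n) \<Rightarrow> real ^ 'n \<Rightarrow>
    (real ^ 'n \<Rightarrow> real ^ 'n) \<Rightarrow> real ^ 'n \<Rightarrow> real ^ 'n" where
  "cov_deriv S G u V x = (\<chi> k. (\<Sum>i\<in>UNIV. u $ i * pderiv_within S i (\<lambda>y. V y $ k) x) +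
     (\<Sum>i\<in>UNIV. \<Sum>j\<in>UNIV. christoffel S G x k i j * u $ i * V x $ j))"

text \<open>\<open>\<omega>\<^sub>s\<^sub>,\<^sub>t(e\<^sub>i)\<close> with \<open>\<nabla>e\<^sub>t = \<Sum>\<^sub>s e\<^sub>s \<omega>\<^sub>s\<^sub>,\<^sub>t\<close>, for an orthonormal frame \<open>E\<close>.\<close>

definition conn_form :: "(real ^ 'n::finite) set \<Rightarrow> (real ^ 'n \<Rightarrow> real ^ 'n ^ 'n) \<Rightarrow>
    ('n \<Rightarrow> real ^ 'n \<Rightarrow> real ^ 'n) \<Rightarrow> real ^ 'n \<Rightarrow> 'n \<Rightarrow> 'n \<Rightarrow> 'n \<Rightarrow> real" where
  "conn_form S G E x s t i = E s x \<bullet> (G x *v cov_deriv S G (E i x) (E t) x)"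


section \<open>Exterior algebra and symbols\<close>

text \<open>Endomorphisms of the complexified exterior algebra of the cotangent space, as matrices in
  the frame \<open>dx\<^sub>I = dx\<^sub>i\<^sub>1 \<and> \<dots> \<and> dx\<^sub>i\<^sub>k\<close>, \<open>I = {i\<^sub>1 < \<dots> < i\<^sub>k}\<close>. The order is \<open>1 < 2 < 3 < 4\<close>;
  this needs \<open>pos\<close> because \<open>4 = 0\<close> in the type \<open>4\<close>.\<close>

type_synonym form_mat = "complex ^ (4 set) ^ (4 set)"

definition pos :: "4 \<Rightarrow> nat" where
  "pos i = (if i = 1 then 1 else if i = 2 then 2 else if i = 3 then 3 else 4)"

definition ext_dx :: "4 \<Rightarrow> form_mat" where
  "ext_dx k = (\<chi> I J. if k \<notin> J \<and> I = insert k J then (-1) ^ card {i \<in> J. pos i < pos k} else 0)"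

definition int_dx :: "4 \<Rightarrow> form_mat" where
  "int_dx k = (\<chi> I J. if k \<in> J \<and> I = J - {k} then (-1) ^ card {i \<in> J. pos i < pos k} else 0)"

definition ext_mult :: "real ^ 4 \<Rightarrow> form_mat" where
  "ext_mult \<alpha> = (\<Sum>k\<in>UNIV. (\<alpha> $ k) *\<^sub>R ext_dx k)"

text \<open>Interior multiplication by a covector, i.e. by the vector dual to it with respect to the
  metric \<open>g\<close>.\<close>

definition int_mult :: "real ^ 4 ^ 4 \<Rightarrow> real ^ 4 \<Rightarrow> form_mat" where
  "int_mult g \<alpha> = (\<Sum>k\<in>UNIV. ((matrix_inv g *v \<alpha>) $ k) *\<^sub>R int_dx k)"

definition cliff :: "real ^ 4 ^ 4 \<Rightarrow> real ^ 4 \<Rightarrow> form_mat" where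
  "cliff g \<alpha> = ext_mult \<alpha> - int_mult g \<alpha>"

definition cliff_bar :: "real ^ 4 ^ 4 \<Rightarrow> real ^ 4 \<Rightarrow> form_mat" where
  "cliff_bar g \<alpha> = ext_mult \<alpha> + int_mult g \<alpha>"

text \<open>A symbol is a function of position and covector. \<open>sig_p1\<close> and \<open>sig_p0\<close> are the parts of order
  1 and 0 of the symbol of \<open>D = d + \<delta>\<close> for the metric \<open>G\<close> with orthonormal frame \<open>E\<close>, i.e. of
  \<open>D = \<Sum>\<^sub>i c(e\<^sub>i) [e\<^sub>i + 1/4 \<Sum>\<^sub>s\<^sub>,\<^sub>t \<omega>\<^sub>s\<^sub>,\<^sub>t(e\<^sub>i) (c'(e\<^sub>s) c'(e\<^sub>t) - c(e\<^sub>s) c(e\<^sub>t))]\<close> with \<open>c = cliff\<close>,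
  \<open>c' = cliff_bar\<close>. The covector \<open>e\<^sub>i\<^sup>*\<close> is \<open>G e\<^sub>i\<close>.\<close>

type_synonym symb = "real ^ 4 \<Rightarrow> real ^ 4 \<Rightarrow> form_mat"

definition sig_p1 :: "(real ^ 4 \<Rightarrow> real ^ 4 ^ 4) \<Rightarrow> symb" where
  "sig_p1 G x \<xi> = mat \<i> ** cliff (G x) \<xi>"

definition sig_p0 :: "(real ^ 4) set \<Rightarrow> (real ^ 4 \<Rightarrow> real ^ 4 ^ 4) \<Rightarrow>
    (4 \<Rightarrow> real ^ 4 \<Rightarrow> real ^ 4) \<Rightarrow> symb" where
  "sig_p0 S G E x \<xi> =
     (let c = (\<lambda>i. cliff (G x) (G x *v E i x)); c' = (\<lambda>i. cliff_bar (G x) (G x *v E i x))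
      in (1 / 4) *\<^sub>R (\<Sum>i\<in>UNIV. \<Sum>s\<in>UNIV. \<Sum>t\<in>UNIV.
           conn_form S G E x s t i *\<^sub>R (c i ** (c' s ** c' t - c s ** c t))))"

text \<open>The parts of order -1 and -2 of the symbol \<open>q\<close> of the inverse of an operator with symbol
  \<open>p\<^sub>1 + p\<^sub>0\<close>. The composition formula \<open>\<Sum>\<^sub>\<alpha> 1/\<alpha>! \<partial>\<^sub>\<xi>\<^sup>\<alpha> p (-\<i>\<partial>\<^sub>x)\<^sup>\<alpha> q = 1\<close> gives \<open>p\<^sub>1 q\<^sub>-\<^sub>1 = 1\<close> and
  \<open>p\<^sub>1 q\<^sub>-\<^sub>2 + p\<^sub>0 q\<^sub>-\<^sub>1 + \<Sum>\<^sub>j \<partial>\<^sub>\<xi>\<^sub>j p\<^sub>1 (-\<i>\<partial>\<^sub>x\<^sub>j) q\<^sub>-\<^sub>1 = 0\<close>.\<close>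

definition inv_symb1 :: "symb \<Rightarrow> symb" where
  "inv_symb1 p1 x \<xi> = matrix_inv (p1 x \<xi>)"

definition inv_symb2 :: "(real ^ 4) set \<Rightarrow> symb \<Rightarrow> symb \<Rightarrow> symb" where
  "inv_symb2 S p1 p0 x \<xi> = - (inv_symb1 p1 x \<xi> **
     (p0 x \<xi> ** inv_symb1 p1 x \<xi> +
      (\<Sum>j\<in>UNIV. pderiv_within UNIV j (p1 x) \<xi> **
         (mat (- \<i>) ** pderiv_within S j (\<lambda>y. inv_symb1 p1 y \<xi>) x))))"


section \<open>The boundary residue densities\<close>

text \<open>Values on the real axis: \<open>f = a/b + c/d\<close> with both fractions vanishing at infinity, the
  poles of \<open>a/b\<close> in the upper and those of \<open>c/d\<close> in the lower half-plane; \<open>pi_plus f = a/b\<close>.\<close>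

definition pi_plus :: "(real \<Rightarrow> complex) \<Rightarrow> real \<Rightarrow> complex" where
  "pi_plus f = (THE u. \<exists>a b c d :: complex poly.
     degree a < degree b \<and> degree c < degree d \<and>
     (\<forall>z. poly b z = 0 \<longrightarrow> Im z > 0) \<and> (\<forall>z. poly d z = 0 \<longrightarrow> Im z < 0) \<and>
     (\<forall>t. u t = poly a (of_real t) / poly b (of_real t) \<and>
          f t = u t + poly c (of_real t) / poly d (of_real t)))"

definition pi_plus_mat :: "(real \<Rightarrow> form_mat) \<Rightarrow> real \<Rightarrow> form_mat" where
  "pi_plus_mat F t = (\<chi> I J. pi_plus (\<lambda>s. F s $ I $ J) t)"

text \<open>Integration over the unit sphere in \<open>\<real>\<^sup>3\<close> against its canonical volume form
  \<open>(v, w) \<mapsto> det (\<xi>', v, w)\<close>, in spherical coordinates.\<close>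

definition sph :: "real \<Rightarrow> real \<Rightarrow> real ^ 3" where
  "sph \<theta> \<phi> = vector [sin \<theta> * cos \<phi>, sin \<theta> * sin \<phi>, cos \<theta>]"

definition sphere_integral :: "(real ^ 3 \<Rightarrow> complex) \<Rightarrow> complex" where
  "sphere_integral f = (LINT \<theta>:{0..pi}|lborel. LINT \<phi>:{0..2*pi}|lborel.
     of_real (det (vector [sph \<theta> \<phi>, vector_derivative (\<lambda>a. sph a \<phi>) (at \<theta>),
                           vector_derivative (\<lambda>a. sph \<theta> a) (at \<phi>)] :: real ^ 3 ^ 3)) * f (sph \<theta> \<phi>))"

text \<open>Coefficients of \<open>dx'\<close> of the residue forms at the boundary point \<open>(x', 0)\<close>, for symbols given
  in coordinates in which the boundary metric is \<open>\<delta>\<^sub>i\<^sub>j\<close>. \<open>P1\<close>, \<open>P2\<close> stand for the symbols of order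
  -1, -2 of the first operator and \<open>P1'\<close> for the symbol of order -1 of the second.\<close>

definition res11 :: "symb \<Rightarrow> symb \<Rightarrow> real ^ 3 \<Rightarrow> complex" where
  "res11 P1 P1' x' = - (1 / 2) * sphere_integral (\<lambda>\<xi>'. LINT \<tau>|lborel. trace (
     vector_derivative (\<lambda>s. pi_plus_mat (\<lambda>\<eta>. P1 (join x' s) (join \<xi>' \<eta>)) \<tau>) (at 0) **
     vector_derivative (\<lambda>\<zeta>. vector_derivative (\<lambda>\<eta>. P1' (join x' 0) (join \<xi>' \<eta>)) (at \<zeta>)) (at \<tau>)))"

definition res21 :: "symb \<Rightarrow> symb \<Rightarrow> real ^ 3 \<Rightarrow> complex" where
  "res21 P2 P1' x' = - \<i> * sphere_integral (\<lambda>\<xi>'. LINT \<tau>|lborel. trace (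
     pi_plus_mat (\<lambda>\<eta>. P2 (join x' 0) (join \<xi>' \<eta>)) \<tau> **
     vector_derivative (\<lambda>\<eta>. P1' (join x' 0) (join \<xi>' \<eta>)) (at \<tau>)))"

text \<open>The global form given in the charts \<open>f \<in> F\<close> by \<open>dens f dx\<^sub>1 \<and> \<dots> \<and> dx\<^sub>n\<close>: its coefficient in
  an arbitrary oriented chart.\<close>

definition form_from_charts :: "('a, 'n::finite) chart set \<Rightarrow>
    (('a, 'n) chart \<Rightarrow> real ^ 'n \<Rightarrow> complex) \<Rightarrow> ('a, 'n) chart \<Rightarrow> 'a \<Rightarrow> complex" where
  "form_from_charts F dens c p =
     (let f = (SOME f. f \<in> F \<and> p \<in> fst f)
      in of_real (det (jacobian c f p)) * dens f (snd f p))"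

definition collar_frame :: "(real \<Rightarrow> real) \<Rightarrow> 4 \<Rightarrow> real ^ 4 \<Rightarrow> real ^ 4" where
  "collar_frame h i x = (if i = 4 then axis 4 1 else sqrt (h (x $ 4)) *\<^sub>R axis i 1)"

definition coord_metric :: "('a, 'n::finite) metric_coeffs \<Rightarrow> ('a, 'n) chart \<Rightarrow> real ^ 'n \<Rightarrow> real ^ 'n ^ 'n" where
  "coord_metric g c x = g c (chart_inv c x)"

text \<open>The symbols of order -1 and -2 of \<open>D\<^sup>-\<^sup>1\<close> in a chart \<open>c\<close> of the extension that comes from a
  flat chart of the boundary; \<open>h\<close> is the warping function on the extended collar.\<close>

definition Dinv_symb1 :: "('a, 4) metric_coeffs \<Rightarrow> ('a, 4) chart \<Rightarrow> symb" where
  "Dinv_symb1 g c = inv_symb1 (sig_p1 (coord_metric g c))"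

definition Dinv_symb2 :: "('a, 4) metric_coeffs \<Rightarrow> (real \<Rightarrow> real) \<Rightarrow> ('a, 4) chart \<Rightarrow> symb" where
  "Dinv_symb2 g h c = (let S = snd c ` fst c; G = coord_metric g c
     in inv_symb2 S (sig_p1 G) (sig_p0 S G (collar_frame h)))"


section \<open>The boundary term of the gravitational action\<close>

definition emb :: "3 \<Rightarrow> 4" where
  "emb i = (if i = 1 then 1 else if i = 2 then 2 else 3)"

text \<open>\<open>K\<close> at \<open>p \<in> \<partial>M\<close>, from coordinates \<open>c\<close> of \<open>\<partial>M\<close> completed by the normal coordinate to
  coordinates \<open>c'\<close> of \<open>M\<close>.\<close>

definition extrinsic_K :: "('a, 4) metric_coeffs \<Rightarrow> ('a, 3) metric_coeffs \<Rightarrow>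
    ('a, 4) chart \<Rightarrow> ('a, 3) chart \<Rightarrow> 'a \<Rightarrow> real" where
  "extrinsic_K g gb c' c p = (\<Sum>i\<in>UNIV. \<Sum>j\<in>UNIV.
     - christoffel (snd c' ` fst c') (coord_metric g c') (snd c' p) 4 (emb i) (emb j) *
     matrix_inv (gb c p) $ i $ j)"

definition I_Gr_b :: "'a topology \<Rightarrow> ('a, 4) chart set \<Rightarrow> ('a, 4) metric_coeffs \<Rightarrow>
    ('a, 3) metric_coeffs \<Rightarrow> 'a set \<Rightarrow> ('a \<Rightarrow> 'a) \<Rightarrow> ('a \<Rightarrow> real) \<Rightarrow> real" where
  "I_Gr_b X A g gb Uc b xn = 2 * form_integral (bdry_top X A) UNIV (bdry_atlas X A)
     (\<lambda>c p. extrinsic_K g gb (collar_chart Uc b xn c) c p * sqrt (det (gb c p)))"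

definition Omega3 :: real where
  "Omega3 = 2 * pi powr (3 / 2) / Gamma (3 / 2)"

end

theory Submission
  imports Defs "HOL-Computational_Algebra.Polynomial_Factorial" "HOL-Computational_Algebra.Field_as_Ring"
    "HOL-Computational_Algebra.Fundamental_Theorem_Algebra" "HOL-Real_Asymp.Real_Asymp"
begin

text \<open>
  In flat boundary coordinates the metric near the boundary is \<open>h\<^sup>-\<^sup>1 (dx\<^sub>1\<^sup>2 + dx\<^sub>2\<^sup>2 + dx\<^sub>3\<^sup>2) + dx\<^sub>4\<^sup>2\<close>, so every
  local quantity at the boundary depends only on \<open>d = h'(0)\<close>. The Clifford relations and the
  cyclicity of the trace reduce both traces to rational functions of \<open>\<xi>\<^sub>n\<close> with poles at
  \<open>\<plusminus>\<i>\<close>. For \<open>|\<xi>'| = 1\<close> they are \<open>8\<i>d (\<xi>\<^sub>n - \<i>) / (1 + \<xi>\<^sub>n\<^sup>2)\<^sup>3\<close> and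
  \<open>d (4 (\<xi>\<^sub>n + \<i>) / (1 + \<xi>\<^sub>n\<^sup>2)\<^sup>3 + 6\<i> / (1 + \<xi>\<^sub>n\<^sup>2)\<^sup>2)\<close>, so the residue densities are the constants
  \<open>-6\<pi>\<^sup>2 d\<close> and \<open>18\<pi>\<^sup>2 d\<close>, while \<open>K = -3d/2\<close>. The densities are thus fixed multiples of \<open>K\<close>
  times the volume form: in an oriented chart the Jacobian determinant of the change to flat
  coordinates is \<open>\<surd>(det g)\<close>.
\<close>

section \<open>The positive part of a rational function\<close>

text \<open>Matrices are taken in the frame \<open>dx\<^sub>I\<close>, which is not orthonormal off
  the boundary. In it exterior multiplication is independent of position, while interior
  multiplication by a tangential covector scales with \<open>h\<close>. Normal derivatives of
  Clifford multiplication therefore leave the Clifford span and produce interior multiplications, so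
  traces mixing the two kinds are needed. The positive part is defined entry by entry through a
  \<open>THE\<close>. For the symbol of order -2 no entry is ever decomposed explicitly: bare
  existence of a decomposition, with uniqueness, lets the positive part pass through the trace, and
  only two scalar functions have to be decomposed. Neither the integral of the densities nor that of
  \<open>K\<close> is evaluated. Both are cut by the same arbitrarily chosen cover, so a pointwise
  comparison of the integrands is enough. The symbols are differentiated on both sides of the
  boundary, inside the extended collar, whereas \<open>K\<close> comes from one-sided derivatives on
  \<open>M\<close>.\<close>

lemma coprime_if_roots_separated:
  fixes p q :: "complex poly"
  assumes "p \<noteq> 0" and "\<And>z. poly p z = 0 \<Longrightarrow> Im z > 0" and "\<And>z. poly q z = 0 \<Longrightarrow> Im z < 0"
  shows "coprime p q"
proof (rule coprimeI)
  fix r assume r: "r dvd p" "r dvd q"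
  \<comment> \<open>A root of a common divisor would have imaginary part of both signs.\<close>
  have "\<not> (\<exists>z. poly r z = 0)"
    using r assms(2,3) by (metis poly_eq_0_iff_dvd dvd_trans less_asym)
  then have "constant (poly r)"
    using fundamental_theorem_of_algebra by blast
  then have "degree r = 0"
    by (simp add: constant_degree)
  moreover have "r \<noteq> 0" using r assms(1) by auto
  ultimately show "is_unit r"
    by (simp add: is_unit_iff_degree)
qed

text \<open>The predicate under the \<open>THE\<close> of \<open>pi_plus\<close>, isolated so that
  uniqueness, existence and closure properties can be proved separately.\<close>

definition pi_plus_rel :: "(real \<Rightarrow> complex) \<Rightarrow> (real \<Rightarrow> complex) \<Rightarrow> bool" where
  "pi_plus_rel f u \<longleftrightarrow> (\<exists>a b c d :: complex poly.
     degree a < degree b \<and> degree c < degree d \<and>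
     (\<forall>z. poly b z = 0 \<longrightarrow> Im z > 0) \<and> (\<forall>z. poly d z = 0 \<longrightarrow> Im z < 0) \<and>
     (\<forall>t. u t = poly a (of_real t) / poly b (of_real t) \<and>
          f t = u t + poly c (of_real t) / poly d (of_real t)))"

lemma poly_eq_if_eq_on_reals:
  fixes p q :: "complex poly"
  assumes "\<And>t::real. poly p (of_real t) = poly q (of_real t)"
  shows "p = q"
proof (rule ccontr)
  assume "p \<noteq> q"
  then have "finite {z. poly (p - q) z = 0}"
    by (intro poly_roots_finite) simp
  moreover have "range complex_of_real \<subseteq> {z. poly (p - q) z = 0}"
    using assms by auto
  ultimately have "finite (range complex_of_real)"
    by (rule rev_finite_subset)
  then show False
    by (simp add: finite_image_iff infinite_UNIV_char_0 inj_of_real)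
qed

text \<open>Equating two decompositions gives a fraction over \<open>b * b'\<close> equal to one
  over \<open>d * d'\<close>. These denominators are coprime, so \<open>b * b'\<close> divides a
  numerator of smaller degree, which must vanish.\<close>

lemma pi_plus_rel_unique:
  assumes "pi_plus_rel f u" and "pi_plus_rel f u'"
  shows "u = u'"
proof -
  obtain a b c d :: "complex poly" where 1: "degree a < degree b" "degree c < degree d"
     "\<And>z. poly b z = 0 \<Longrightarrow> Im z > 0" "\<And>z. poly d z = 0 \<Longrightarrow> Im z < 0"
     "\<And>t. u t = poly a (of_real t) / poly b (of_real t)"
     "\<And>t. f t = u t + poly c (of_real t) / poly d (of_real t)"
    using assms(1) unfolding pi_plus_rel_def by blast
  obtain a' b' c' d' :: "complex poly" where 2: "degree a' < degree b'" "degree c' < degree d'"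
     "\<And>z. poly b' z = 0 \<Longrightarrow> Im z > 0" "\<And>z. poly d' z = 0 \<Longrightarrow> Im z < 0"
     "\<And>t. u' t = poly a' (of_real t) / poly b' (of_real t)"
     "\<And>t. f t = u' t + poly c' (of_real t) / poly d' (of_real t)"
    using assms(2) unfolding pi_plus_rel_def by blast
  have nz: "poly b (of_real t) \<noteq> 0" "poly d (of_real t) \<noteq> 0"
    "poly b' (of_real t) \<noteq> 0" "poly d' (of_real t) \<noteq> 0" for t
    using 1(3,4)[of "of_real t"] 2(3,4)[of "of_real t"] by auto
  have bnz: "b \<noteq> 0" "b' \<noteq> 0" "d \<noteq> 0" "d' \<noteq> 0"
    using 1(1,2) 2(1,2) by auto
  have eq: "(a * b' - a' * b) * (d * d') = (c' * d - c * d') * (b * b')"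
  proof (rule poly_eq_if_eq_on_reals)
    fix t
    have "poly a (of_real t) / poly b (of_real t) + poly c (of_real t) / poly d (of_real t) =
       poly a' (of_real t) / poly b' (of_real t) + poly c' (of_real t) / poly d' (of_real t)"
      using 1(5,6)[of t] 2(5,6)[of t] by simp
    then have "(poly a (of_real t) * poly d (of_real t) + poly c (of_real t) * poly b (of_real t)) *
          (poly b' (of_real t) * poly d' (of_real t)) =
        (poly a' (of_real t) * poly d' (of_real t) + poly c' (of_real t) * poly b' (of_real t)) *
          (poly b (of_real t) * poly d (of_real t))"
      using nz[of t] by (simp only: add_frac_eq frac_eq_eq mult_eq_0_iff simp_thms)
    then show "poly ((a * b' - a' * b) * (d * d')) (of_real t) =
        poly ((c' * d - c * d') * (b * b')) (of_real t)"
      unfolding poly_mult poly_diff by algebra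
  qed
  have "coprime (b * b') (d * d')"
    by (rule coprime_if_roots_separated) (use bnz 1(3,4) 2(3,4) in auto)
  moreover have "b * b' dvd (a * b' - a' * b) * (d * d')"
    unfolding eq by simp
  ultimately have dv: "b * b' dvd a * b' - a' * b"
    by (simp add: coprime_dvd_mult_left_iff)
  have "a * b' - a' * b = 0"
  proof (rule ccontr)
    assume nz': "a * b' - a' * b \<noteq> 0"
    have "degree (a * b' - a' * b) < degree (b * b')"
    proof (rule degree_diff_less)
      show "degree (a * b') < degree (b * b')"
        using degree_mult_le[of a b'] 1(1) bnz by (simp add: degree_mult_eq)
      show "degree (a' * b) < degree (b * b')"
        using degree_mult_le[of a' b] 2(1) bnz by (simp add: degree_mult_eq)
    qed
    then show False
      using dvd_imp_degree_le[OF dv nz'] by simp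
  qed
  then have "a * b' = a' * b" by simp
  then have "poly (a * b') (of_real t) = poly (a' * b) (of_real t)" for t :: real by simp
  then show "u = u'"
    using 1(5) 2(5) nz by (auto simp: fun_eq_iff frac_eq_eq)
qed

lemma pi_plus_eq: "pi_plus_rel f u \<Longrightarrow> pi_plus f = u"
  using the_equality[of "pi_plus_rel f"] pi_plus_rel_unique
  by (simp only: pi_plus_def flip: pi_plus_rel_def) blast

text \<open>A common denominator keeps all its roots in the same half-plane. Together with
  uniqueness and scaling this makes \<open>pi_plus\<close> linear wherever decompositions
  exist.\<close>

lemma pi_plus_rel_add:
  assumes "pi_plus_rel f u" and "pi_plus_rel f' u'"
  shows "pi_plus_rel (\<lambda>t. f t + f' t) (\<lambda>t. u t + u' t)"
proof -
  obtain a b c d :: "complex poly" where 1: "degree a < degree b" "degree c < degree d"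
     "\<And>z. poly b z = 0 \<Longrightarrow> Im z > 0" "\<And>z. poly d z = 0 \<Longrightarrow> Im z < 0"
     "\<And>t. u t = poly a (of_real t) / poly b (of_real t)"
     "\<And>t. f t = u t + poly c (of_real t) / poly d (of_real t)"
    using assms(1) unfolding pi_plus_rel_def by blast
  obtain a' b' c' d' :: "complex poly" where 2: "degree a' < degree b'" "degree c' < degree d'"
     "\<And>z. poly b' z = 0 \<Longrightarrow> Im z > 0" "\<And>z. poly d' z = 0 \<Longrightarrow> Im z < 0"
     "\<And>t. u' t = poly a' (of_real t) / poly b' (of_real t)"
     "\<And>t. f' t = u' t + poly c' (of_real t) / poly d' (of_real t)"
    using assms(2) unfolding pi_plus_rel_def by blast
  have nz: "poly b (of_real t) \<noteq> 0" "poly d (of_real t) \<noteq> 0"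
    "poly b' (of_real t) \<noteq> 0" "poly d' (of_real t) \<noteq> 0" for t
    using 1(3,4)[of "of_real t"] 2(3,4)[of "of_real t"] by auto
  have bnz: "b \<noteq> 0" "b' \<noteq> 0" "d \<noteq> 0" "d' \<noteq> 0"
    using 1(1,2) 2(1,2) by auto
  have deg: "degree (p * q' + p' * q) < degree (q * q')"
    if "degree p < degree q" "degree p' < degree q'" "q \<noteq> 0" "q' \<noteq> 0" for p q p' q' :: "complex poly"
  proof (rule degree_add_less)
    show "degree (p * q') < degree (q * q')"
      using degree_mult_le[of p q'] that by (simp add: degree_mult_eq)
    show "degree (p' * q) < degree (q * q')"
      using degree_mult_le[of p' q] that by (simp add: degree_mult_eq)
  qed
  show ?thesis
    unfolding pi_plus_rel_def
  proof (intro exI conjI allI)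
    show "degree (a * b' + a' * b) < degree (b * b')" "degree (c * d' + c' * d) < degree (d * d')"
      using 1(1,2) 2(1,2) bnz by (simp_all add: deg)
    fix t :: real
    show "u t + u' t = poly (a * b' + a' * b) (of_real t) / poly (b * b') (of_real t)"
      using nz[of t] by (simp add: 1(5) 2(5) add_frac_eq)
    have "poly (c * d' + c' * d) (of_real t) / poly (d * d') (of_real t) =
        poly c (of_real t) / poly d (of_real t) + poly c' (of_real t) / poly d' (of_real t)"
      using nz[of t] by (simp add: add_frac_eq)
    then show "f t + f' t = u t + u' t + poly (c * d' + c' * d) (of_real t) / poly (d * d') (of_real t)"
      by (simp add: 1(6) 2(6))
  qed (use 1(3,4) 2(3,4) in auto)
qed

lemma pi_plus_rel_mult_left:
  assumes "pi_plus_rel f u"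
  shows "pi_plus_rel (\<lambda>t. k * f t) (\<lambda>t. k * u t)"
proof -
  obtain a b c d :: "complex poly" where 1: "degree a < degree b" "degree c < degree d"
     "\<And>z. poly b z = 0 \<Longrightarrow> Im z > 0" "\<And>z. poly d z = 0 \<Longrightarrow> Im z < 0"
     "\<And>t. u t = poly a (of_real t) / poly b (of_real t)"
     "\<And>t. f t = u t + poly c (of_real t) / poly d (of_real t)"
    using assms(1) unfolding pi_plus_rel_def by blast
  show ?thesis
    unfolding pi_plus_rel_def
    apply (rule exI[of _ "smult k a"], rule exI[of _ "b"],
        rule exI[of _ "smult k c"], rule exI[of _ "d"])
    using 1 degree_smult_le[of k a] degree_smult_le[of k c]
    by (auto simp: algebra_simps intro: le_less_trans)
qed

lemma i_plus_eq_0: "\<i> + z = 0 \<longleftrightarrow> z = - \<i>"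
  by (auto simp: add_eq_0_iff)

lemma pi_plus_rel_sum:
  assumes "\<And>k. k \<in> K \<Longrightarrow> pi_plus_rel (f k) (u k)" and "finite K"
  shows "pi_plus_rel (\<lambda>t. \<Sum>k\<in>K. f k t) (\<lambda>t. \<Sum>k\<in>K. u k t)"
  using assms(2,1)
proof (induction K)
  case empty
  show ?case
    unfolding pi_plus_rel_def
    \<comment> \<open>The strict degree bounds exclude constant denominators even over the numerator
      0; \<open>t - \<i>\<close> and \<open>t + \<i>\<close> serve as dummies, here and for single
      poles.\<close>
    by (rule exI[of _ 0], rule exI[of _ "[:-\<i>, 1:]"], rule exI[of _ 0], rule exI[of _ "[:\<i>, 1:]"])
      (auto simp: i_plus_eq_0)
next
  case (insert k K)
  then show ?case
    using pi_plus_rel_add[of "f k" "u k"] by simp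
qed

lemma pi_plus_rel_upper_pole:
  assumes "Im w > 0" "n > 0"
  shows "pi_plus_rel (\<lambda>t. k / (of_real t - w) ^ n) (\<lambda>t. k / (of_real t - w) ^ n)"
  unfolding pi_plus_rel_def
  by (rule exI[of _ "[:k:]"], rule exI[of _ "[:-w, 1:] ^ n"], rule exI[of _ 0], rule exI[of _ "[:\<i>, 1:]"])
    (use assms in \<open>auto simp: degree_power_eq i_plus_eq_0\<close>)

lemma pi_plus_rel_lower_pole:
  assumes "Im w < 0" "n > 0"
  shows "pi_plus_rel (\<lambda>t. k / (of_real t - w) ^ n) (\<lambda>t. 0)"
  unfolding pi_plus_rel_def
  by (rule exI[of _ 0], rule exI[of _ "[:-\<i>, 1:]"], rule exI[of _ "[:k:]"], rule exI[of _ "[:-w, 1:] ^ n"])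
    (use assms in \<open>auto simp: degree_power_eq i_plus_eq_0\<close>)

text \<open>Partial fractions by Bezout: from \<open>s * b + t * d = 1\<close> the numerator over
  \<open>b\<close> is \<open>p * t\<close> reduced modulo \<open>b\<close>, and the degree bound on
  \<open>p\<close> then forces the one over \<open>d\<close> to be small.\<close>

lemma pi_plus_rel_exists:
  fixes p b d :: "complex poly"
  assumes "degree p < degree (b * d)"
    and b: "\<And>z. poly b z = 0 \<Longrightarrow> Im z > 0" and d: "\<And>z. poly d z = 0 \<Longrightarrow> Im z < 0"
    and "degree b > 0" "degree d > 0"
  shows "\<exists>u. pi_plus_rel (\<lambda>t. poly p (of_real t) / poly (b * d) (of_real t)) u"
proof -
  have bnz: "b \<noteq> 0" "d \<noteq> 0" using assms by auto
  have "coprime b d"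
    by (rule coprime_if_roots_separated) (use bnz b d in auto)
  then obtain s t where st: "s * b + t * d = 1"
    using bezout_coefficients_fst_snd[of b d] by (metis coprime_imp_gcd_eq_1)
  define r q where "r = (p * t) mod b" and "q = p * s + ((p * t) div b) * d"
  have pt: "p * t = ((p * t) div b) * b + r"
    by (simp add: r_def)
  have "p = p * (s * b + t * d)" by (simp add: st)
  also have "\<dots> = p * s * b + (p * t) * d" by (simp add: algebra_simps)
  also have "\<dots> = q * b + r * d"
    by (subst pt) (simp add: q_def algebra_simps)
  finally have p: "p = q * b + r * d" .
  have r: "degree r < degree b"
    using degree_mod_less'[of b "p * t"] assms(4) bnz unfolding r_def by (cases "(p * t) mod b = 0") auto
  have "degree (q * b) < degree (b * d)"
  proof -
    have "q * b = p - r * d" using p by (simp add: algebra_simps)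
    moreover have "degree (p - r * d) < degree (b * d)"
    proof (rule degree_diff_less)
      show "degree p < degree (b * d)" by fact
      show "degree (r * d) < degree (b * d)"
        using degree_mult_le[of r d] r bnz by (simp add: degree_mult_eq)
    qed
    ultimately show ?thesis by simp
  qed
  then have q: "degree q < degree d"
    using bnz assms(5) by (cases "q = 0") (auto simp: degree_mult_eq)
  have "pi_plus_rel (\<lambda>t. poly p (of_real t) / poly (b * d) (of_real t)) (\<lambda>t. poly r (of_real t) / poly b (of_real t))"
    unfolding pi_plus_rel_def
  proof (intro exI conjI allI)
    show "degree r < degree b" "degree q < degree d" by fact+
    fix t :: real
    have "poly b (of_real t) \<noteq> 0" "poly d (of_real t) \<noteq> 0"
      using b[of "of_real t"] d[of "of_real t"] by auto
    moreover have "poly p (of_real t) = poly q (of_real t) * poly b (of_real t) + poly r (of_real t) * poly d (of_real t)"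
      using arg_cong[OF p, of "\<lambda>x. poly x (of_real t)"] by simp
    ultimately show "poly p (of_real t) / poly (b * d) (of_real t) =
       poly r (of_real t) / poly b (of_real t) + poly q (of_real t) / poly d (of_real t)"
      by (simp add: add_frac_eq mult.commute)
  qed (use b d in auto)
  then show ?thesis by blast
qed

text \<open>The trace against a constant matrix is a finite linear combination of entries, so it
  commutes with the positive part. One scalar decomposition then replaces 256 entrywise
  ones.\<close>

lemma trace_pi_plus_mat:
  assumes "\<And>I J. \<exists>u. pi_plus_rel (\<lambda>t. F t $ I $ J) u"
  shows "trace (pi_plus_mat F \<tau> ** C) = pi_plus (\<lambda>t. trace (F t ** C)) \<tau>"
proof -
  obtain u where u: "\<And>I J. pi_plus_rel (\<lambda>t. F t $ I $ J) (u I J)"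
    using assms by metis
  have "pi_plus_rel (\<lambda>t. \<Sum>I\<in>UNIV. \<Sum>J\<in>UNIV. C $ J $ I * F t $ I $ J)
      (\<lambda>t. \<Sum>I\<in>UNIV. \<Sum>J\<in>UNIV. C $ J $ I * u I J t)"
    by (intro pi_plus_rel_sum pi_plus_rel_mult_left u) auto
  then have "pi_plus (\<lambda>t. trace (F t ** C)) = (\<lambda>t. \<Sum>I\<in>UNIV. \<Sum>J\<in>UNIV. C $ J $ I * u I J t)"
    by (intro pi_plus_eq) (simp add: trace_def matrix_matrix_mult_def mult.commute[of "C $ _ $ _"])
  moreover have "pi_plus (\<lambda>t. F t $ I $ J) = u I J" for I J
    by (rule pi_plus_eq) (rule u)
  ultimately show ?thesis
    by (simp add: trace_def matrix_matrix_mult_def pi_plus_mat_def mult.commute[of "C $ _ $ _"])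
qed

section \<open>The Clifford actions on the exterior algebra\<close>

lemma bounded_bilinear_form_mat_mult: "bounded_bilinear ((**) :: form_mat \<Rightarrow> form_mat \<Rightarrow> form_mat)"
  unfolding bilinear_conv_bounded_bilinear[symmetric]
  by (auto simp: bilinear_def linear_iff matrix_add_ldistrib scalar_matrix_assoc matrix_scalar_ac)
    (simp add: vec_eq_iff matrix_matrix_mult_def sum.distrib distrib_right)

interpretation form_mat: bounded_bilinear "(**) :: form_mat \<Rightarrow> form_mat \<Rightarrow> form_mat"
  by (rule bounded_bilinear_form_mat_mult)

text \<open>Symbols carry complex factors, while \<open>*\<^sub>R\<close> scales only by reals;
  products with \<open>mat z\<close> and real scalings are both brought to this form.\<close>

definition cmul :: "complex \<Rightarrow> form_mat \<Rightarrow> form_mat" where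
  "cmul z M = (\<chi> I J. z * M $ I $ J)"

lemma cmul_nth [simp]: "cmul z M $ I $ J = z * M $ I $ J"
  by (simp add: cmul_def)

lemma mat_mult_eq_cmul: "mat z ** M = cmul z M"
  by (simp add: vec_eq_iff matrix_matrix_mult_def mat_def if_distrib[of "\<lambda>x. x * _"] cong: if_cong)

lemma cmul_mult_left [simp]: "cmul z A ** B = cmul z (A ** B)"
  by (simp add: vec_eq_iff matrix_matrix_mult_def sum_distrib_left mult.assoc)

lemma cmul_mult_right [simp]: "A ** cmul z B = cmul z (A ** B)"
  by (simp add: vec_eq_iff matrix_matrix_mult_def sum_distrib_left mult.left_commute)

lemma trace_cmul [simp]: "trace (cmul z A) = z * trace A"
  by (simp add: trace_def sum_distrib_left)

lemma cmul_cmul [simp]: "cmul z (cmul w A) = cmul (z * w) A"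
  by (simp add: vec_eq_iff mult.assoc)

lemma cmul_simps [simp]: "cmul 1 A = A" "cmul 0 A = 0" "cmul z 0 = 0"
  by (simp_all add: vec_eq_iff)

lemma cmul_distrib: "cmul z (A + B) = cmul z A + cmul z B" "cmul z (A - B) = cmul z A - cmul z B"
  by (simp_all add: vec_eq_iff algebra_simps)

lemma cmul_add_left: "cmul (z + w) A = cmul z A + cmul w A"
  by (simp add: vec_eq_iff algebra_simps)

lemma scaleR_eq_cmul: "r *\<^sub>R A = cmul (of_real r) A"
  by (simp add: vec_eq_iff scaleR_conv_of_real[symmetric])

lemma uminus_eq_cmul: "- A = cmul (-1) A"
  by (simp add: vec_eq_iff)

lemma trace_form_mat_sum: "trace (\<Sum>k\<in>K. (f k :: form_mat)) = (\<Sum>k\<in>K. trace (f k))"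
  unfolding trace_def by (simp add: sum.swap[of _ UNIV])

lemma trace_scaleR_form_mat [simp]: "trace (r *\<^sub>R (A :: form_mat)) = of_real r * trace A"
  by (simp add: scaleR_eq_cmul)

lemma trace_form_mat_mat1 [simp]: "trace (mat 1 :: form_mat) = 16"
  by (simp add: trace_I card_UNIV_set)

text \<open>The sign picked up when \<open>dx\<^sub>k\<close> moves past the factors of
  \<open>dx\<^sub>J\<close> that precede it.\<close>

definition koszul_sign :: "4 \<Rightarrow> 4 set \<Rightarrow> complex" where
  "koszul_sign k J = (-1) ^ card {i \<in> J. pos i < pos k}"

lemma pos_eq_iff: "pos i = pos j \<longleftrightarrow> i = j"
  using exhaust_4[of i] exhaust_4[of j] by (auto simp: pos_def)

lemma koszul_sign_insert:
  "l \<notin> J \<Longrightarrow> koszul_sign k (insert l J) = (if pos l < pos k then - koszul_sign k J else koszul_sign k J)"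
proof -
  assume "l \<notin> J"
  moreover have "{i \<in> insert l J. pos i < pos k} =
      (if pos l < pos k then insert l {i \<in> J. pos i < pos k} else {i \<in> J. pos i < pos k})"
    by auto
  ultimately show ?thesis by (simp add: koszul_sign_def)
qed

lemma koszul_sign_remove:
  "l \<in> J \<Longrightarrow> koszul_sign k (J - {l}) = (if pos l < pos k then - koszul_sign k J else koszul_sign k J)"
  using koszul_sign_insert[of l "J - {l}" k] by (auto simp: insert_absorb split: if_splits)

lemma koszul_sign_square: "koszul_sign k J * koszul_sign k J = 1"
  by (simp add: koszul_sign_def flip: power_add mult_2)

lemma ext_dx_nth: "ext_dx k $ I $ J = (if k \<notin> J \<and> I = insert k J then koszul_sign k J else 0)"
  by (simp add: ext_dx_def koszul_sign_def)

lemma int_dx_nth: "int_dx k $ I $ J = (if k \<in> J \<and> I = J - {k} then koszul_sign k J else 0)"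
  by (simp add: int_dx_def koszul_sign_def)

lemma mult_ext_dx_nth: "(M ** ext_dx l) $ I $ J = (if l \<notin> J then M $ I $ insert l J * koszul_sign l J else 0)"
  by (simp add: matrix_matrix_mult_def ext_dx_nth if_distrib[of "\<lambda>x. _ * x"] cong: if_cong)

lemma mult_int_dx_nth: "(M ** int_dx l) $ I $ J = (if l \<in> J then M $ I $ (J - {l}) * koszul_sign l J else 0)"
  by (simp add: matrix_matrix_mult_def int_dx_nth if_distrib[of "\<lambda>x. _ * x"] cong: if_cong)

text \<open>For distinct indices exactly one of the two orders of insertion changes the number of
  preceding factors, so the two signs are opposite.\<close>

lemma ext_dx_anticomm: "ext_dx k ** ext_dx l + ext_dx l ** ext_dx k = 0"
proof -
  have "pos k < pos l \<or> pos l < pos k \<or> k = l"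
    using pos_eq_iff[of k l] by auto
  then show ?thesis
    by (auto simp: vec_eq_iff mult_ext_dx_nth ext_dx_nth koszul_sign_insert insert_commute)
qed

lemma int_dx_anticomm: "int_dx k ** int_dx l + int_dx l ** int_dx k = 0"
proof -
  have "pos k < pos l \<or> pos l < pos k \<or> k = l"
    using pos_eq_iff[of k l] by auto
  then show ?thesis
    by (elim disjE) (simp_all add: vec_eq_iff mult_int_dx_nth int_dx_nth koszul_sign_remove 
        Diff_insert2[symmetric] insert_commute[of l])
qed

text \<open>For equal indices the two products are the complementary projections onto basis forms
  with and without \<open>dx\<^sub>k\<close>; for distinct ones the sign argument for exterior
  products applies.\<close>

lemma ext_int_dx_anticomm: "ext_dx k ** int_dx l + int_dx l ** ext_dx k = (if k = l then mat 1 else 0)"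
proof (cases "k = l")
  case True
  then show ?thesis
    by (auto simp: vec_eq_iff mult_int_dx_nth int_dx_nth mult_ext_dx_nth ext_dx_nth mat_def
        koszul_sign_insert koszul_sign_remove koszul_sign_square)
next
  case False
  then have "pos k < pos l \<or> pos l < pos k"
    using pos_eq_iff[of k l] by auto
  then show ?thesis using False
    by (elim disjE) (simp_all add: vec_eq_iff mult_int_dx_nth int_dx_nth mult_ext_dx_nth ext_dx_nth
        koszul_sign_insert koszul_sign_remove insert_Diff_if)
qed

text \<open>Contraction with a vector, so that the metric enters only through the argument and its
  position dependence can be differentiated.\<close>

definition int_vec :: "real ^ 4 \<Rightarrow> form_mat" where
  "int_vec v = (\<Sum>k\<in>UNIV. (v $ k) *\<^sub>R int_dx k)"

lemma int_mult_eq_int_vec: "int_mult g \<alpha> = int_vec (matrix_inv g *v \<alpha>)"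
  by (simp add: int_mult_def int_vec_def)

lemma form_mat_mult_sum_sum:
  fixes P Q :: "4 \<Rightarrow> form_mat"
  shows "(\<Sum>k\<in>UNIV. (a $ k) *\<^sub>R P k) ** (\<Sum>l\<in>UNIV. (b $ l) *\<^sub>R Q l) =
    (\<Sum>k\<in>UNIV. \<Sum>l\<in>UNIV. (a $ k * b $ l) *\<^sub>R (P k ** Q l))"
  by (simp only: form_mat.sum_left) (simp add: form_mat.sum_right form_mat.scaleR_left form_mat.scaleR_right
      scaleR_sum_right mult.commute)

lemma anticomm_sum:
  fixes P Q :: "4 \<Rightarrow> form_mat"
  assumes "\<And>k l. P k ** Q l + Q l ** P k = (if k = l then r *\<^sub>R mat 1 else 0)"
  shows "(\<Sum>k\<in>UNIV. (a $ k) *\<^sub>R P k) ** (\<Sum>l\<in>UNIV. (b $ l) *\<^sub>R Q l) +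
         (\<Sum>l\<in>UNIV. (b $ l) *\<^sub>R Q l) ** (\<Sum>k\<in>UNIV. (a $ k) *\<^sub>R P k) = (r * (a \<bullet> b)) *\<^sub>R mat 1"
proof -
  have "(\<Sum>k\<in>UNIV. (a $ k) *\<^sub>R P k) ** (\<Sum>l\<in>UNIV. (b $ l) *\<^sub>R Q l) +
         (\<Sum>l\<in>UNIV. (b $ l) *\<^sub>R Q l) ** (\<Sum>k\<in>UNIV. (a $ k) *\<^sub>R P k) =
     (\<Sum>k\<in>UNIV. \<Sum>l\<in>UNIV. (a $ k * b $ l) *\<^sub>R (P k ** Q l)) +
     (\<Sum>l\<in>UNIV. \<Sum>k\<in>UNIV. (a $ k * b $ l) *\<^sub>R (Q l ** P k))"
    by (simp only: form_mat_mult_sum_sum mult.commute)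
  also have "\<dots> = (\<Sum>k\<in>UNIV. \<Sum>l\<in>UNIV. (a $ k * b $ l) *\<^sub>R (P k ** Q l + Q l ** P k))"
    by (subst (2) sum.swap) (simp add: scaleR_add_right sum.distrib)
  also have "\<dots> = (\<Sum>k\<in>UNIV. (a $ k * b $ k * r) *\<^sub>R mat 1)"
    by (simp add: assms if_distrib[of "\<lambda>x. _ *\<^sub>R x"] cong: if_cong)
  finally show ?thesis
    by (simp add: inner_vec_def sum_distrib_left mult_ac flip: scaleR_sum_left)
qed

lemma ext_mult_anticomm: "ext_mult a ** ext_mult b + ext_mult b ** ext_mult a = 0"
  using anticomm_sum[of ext_dx ext_dx 0 a b] by (simp add: ext_mult_def ext_dx_anticomm)

lemma int_vec_anticomm: "int_vec a ** int_vec b + int_vec b ** int_vec a = 0"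
  using anticomm_sum[of int_dx int_dx 0 a b] by (simp add: int_vec_def int_dx_anticomm)

lemma ext_int_anticomm: "ext_mult a ** int_vec b + int_vec b ** ext_mult a = (a \<bullet> b) *\<^sub>R mat 1"
  using anticomm_sum[of ext_dx int_dx 1 a b] by (simp add: int_vec_def ext_mult_def ext_int_dx_anticomm)

text \<open>Exterior and interior parts square to zero, so only the mixed terms, with a minus sign,
  remain. This is what inverts the leading symbol.\<close>

lemma cliff_square: "cliff g \<xi> ** cliff g \<xi> = - (\<xi> \<bullet> (matrix_inv g *v \<xi>)) *\<^sub>R mat 1"
proof -
  have "ext_mult \<xi> ** ext_mult \<xi> = 0" "int_vec v ** int_vec v = 0" for v
    using ext_mult_anticomm[of \<xi> \<xi>] int_vec_anticomm[of v v] by (simp_all flip: scaleR_2)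
  then show ?thesis
    using ext_int_anticomm[of \<xi> "matrix_inv g *v \<xi>"]
    by (simp add: cliff_def int_mult_eq_int_vec form_mat.diff_left form_mat.diff_right algebra_simps)
qed

text \<open>At a boundary point in flat coordinates the metric is the identity, because
  \<open>h(0) = 1\<close>; these are the Clifford actions there.\<close>

abbreviation "cl \<equiv> cliff (mat 1)"
abbreviation "clb \<equiv> cliff_bar (mat 1)"

lemma matrix_inv_eqI:
  fixes A B :: "'a::comm_ring_1 ^ 'n ^ 'n"
  assumes "A ** B = mat 1" "B ** A = mat 1"
  shows "matrix_inv A = B"
proof -
  have "A ** matrix_inv A = mat 1 \<and> matrix_inv A ** A = mat 1"
    unfolding matrix_inv_def by (rule someI[where x = B]) (simp add: assms)
  then show ?thesis
    by (metis assms(2) matrix_mul_assoc matrix_mul_lid matrix_mul_rid)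
qed

lemma matrix_inv_mat1 [simp]: "matrix_inv (mat 1 :: 'a::comm_ring_1 ^ 'n ^ 'n) = mat 1"
  by (rule matrix_inv_eqI) auto

lemma cl_eq: "cl a = ext_mult a - int_vec a" and clb_eq: "clb a = ext_mult a + int_vec a"
  by (simp_all add: cliff_def cliff_bar_def int_mult_eq_int_vec)

text \<open>Rewriting towards a normal form with interior factors on the right; fixed instances of
  \<open>a\<close> and \<open>b\<close> keep the rewriting from looping.\<close>

lemma anticomm_eq:
  "ext_mult b ** ext_mult a = - (ext_mult a ** ext_mult b)"
  "int_vec b ** int_vec a = - (int_vec a ** int_vec b)"
  "int_vec b ** ext_mult a = (a \<bullet> b) *\<^sub>R mat 1 - ext_mult a ** int_vec b"
  using ext_mult_anticomm[of a b] int_vec_anticomm[of a b] ext_int_anticomm[of a b]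
  by (simp_all add: add_eq_0_iff algebra_simps)

lemma cl_cl: "cl a ** cl b + cl b ** cl a = (- 2 * (a \<bullet> b)) *\<^sub>R mat 1"
  unfolding cl_eq form_mat.diff_left form_mat.diff_right anticomm_eq[of b a] anticomm_eq(3)[of a b]
  by (simp add: inner_commute algebra_simps flip: scaleR_2)

lemma clb_clb: "clb a ** clb b + clb b ** clb a = (2 * (a \<bullet> b)) *\<^sub>R mat 1"
  unfolding clb_eq form_mat.add_left form_mat.add_right anticomm_eq[of b a] anticomm_eq(3)[of a b]
  by (simp add: inner_commute algebra_simps flip: scaleR_2)

lemma clb_cl: "clb a ** cl b + cl b ** clb a = 0 *\<^sub>R mat 1"
  unfolding cl_eq clb_eq form_mat.add_left form_mat.add_right form_mat.diff_left form_mat.diff_right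
    anticomm_eq[of b a] anticomm_eq(3)[of a b]
  by (simp add: inner_commute algebra_simps flip: scaleR_2)

lemma int_cl: "int_vec a ** cl b + cl b ** int_vec a = (a \<bullet> b) *\<^sub>R mat 1"
  unfolding cl_eq form_mat.diff_left form_mat.diff_right anticomm_eq(2)[of b a] anticomm_eq(3)[of a b]
  by (simp add: inner_commute algebra_simps)

section \<open>Traces of Clifford words from cyclicity\<close>

lemma trace_anticomm1:
  fixes X Y :: form_mat
  assumes "X ** Y + Y ** X = r *\<^sub>R mat 1"
  shows "trace (X ** Y) = 8 * of_real r"
  using arg_cong[OF assms, of trace] by (simp add: trace_add trace_mul_sym[of Y X])

text \<open>Moving \<open>X\<close> past three factors changes the sign three times, and cyclicity
  then identifies the moved word with the original, so twice its trace is the sum of the correction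
  terms. The case of one factor is the same argument, with 8 being half of the trace 16 of the
  identity.\<close>

lemma trace_anticomm3:
  fixes X Y\<^sub>1 Y\<^sub>2 Y\<^sub>3 :: form_mat
  assumes "X ** Y\<^sub>1 + Y\<^sub>1 ** X = r\<^sub>1 *\<^sub>R mat 1" "X ** Y\<^sub>2 + Y\<^sub>2 ** X = r\<^sub>2 *\<^sub>R mat 1"
    "X ** Y\<^sub>3 + Y\<^sub>3 ** X = r\<^sub>3 *\<^sub>R mat 1"
  shows "2 * trace (X ** Y\<^sub>1 ** Y\<^sub>2 ** Y\<^sub>3) = of_real r\<^sub>1 * trace (Y\<^sub>2 ** Y\<^sub>3)
           - of_real r\<^sub>2 * trace (Y\<^sub>1 ** Y\<^sub>3) + of_real r\<^sub>3 * trace (Y\<^sub>1 ** Y\<^sub>2)"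
proof -
  have "X ** Y\<^sub>1 ** Y\<^sub>2 ** Y\<^sub>3 + Y\<^sub>1 ** Y\<^sub>2 ** Y\<^sub>3 ** X =
      (X ** Y\<^sub>1 + Y\<^sub>1 ** X) ** Y\<^sub>2 ** Y\<^sub>3 - Y\<^sub>1 ** (X ** Y\<^sub>2 + Y\<^sub>2 ** X) ** Y\<^sub>3 + Y\<^sub>1 ** Y\<^sub>2 ** (X ** Y\<^sub>3 + Y\<^sub>3 ** X)"
    by (simp add: form_mat.add_left form_mat.add_right matrix_mul_assoc)
  also have "\<dots> = r\<^sub>1 *\<^sub>R (Y\<^sub>2 ** Y\<^sub>3) - r\<^sub>2 *\<^sub>R (Y\<^sub>1 ** Y\<^sub>3) + r\<^sub>3 *\<^sub>R (Y\<^sub>1 ** Y\<^sub>2)"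
    by (simp add: assms form_mat.scaleR_left form_mat.scaleR_right)
  finally have "trace (X ** Y\<^sub>1 ** Y\<^sub>2 ** Y\<^sub>3 + Y\<^sub>1 ** Y\<^sub>2 ** Y\<^sub>3 ** X) =
      trace (r\<^sub>1 *\<^sub>R (Y\<^sub>2 ** Y\<^sub>3) - r\<^sub>2 *\<^sub>R (Y\<^sub>1 ** Y\<^sub>3) + r\<^sub>3 *\<^sub>R (Y\<^sub>1 ** Y\<^sub>2))"
    by (rule arg_cong)
  moreover have "trace (Y\<^sub>1 ** Y\<^sub>2 ** Y\<^sub>3 ** X) = trace (X ** Y\<^sub>1 ** Y\<^sub>2 ** Y\<^sub>3)"
    by (subst trace_mul_sym) (simp add: matrix_mul_assoc)
  ultimately show ?thesis
    by (simp add: trace_add trace_sub)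
qed

lemma trace_cl_cl: "trace (cl a ** cl b) = of_real (- 16 * (a \<bullet> b))"
  using trace_anticomm1[OF cl_cl[of a b]] by simp

lemma trace_int_cl: "trace (int_vec a ** cl b) = of_real (8 * (a \<bullet> b))"
  using trace_anticomm1[OF int_cl[of a b]] by simp

lemma trace_cl4: "trace (cl a ** cl b ** cl c ** cl e) =
    of_real (16 * ((a \<bullet> b) * (c \<bullet> e) - (a \<bullet> c) * (b \<bullet> e) + (a \<bullet> e) * (b \<bullet> c)))"
  (is "?t = ?r")
proof -
  have "2 * ?t = 2 * ?r"
    unfolding trace_anticomm3[OF cl_cl[of a b] cl_cl[of a c] cl_cl[of a e]]
    by (simp add: trace_cl_cl algebra_simps)
  then show ?thesis by (metis mult_left_cancel zero_neq_numeral)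
qed

lemma trace_int_cl3: "trace (int_vec a ** cl b ** cl c ** cl e) =
    of_real (- 8 * ((a \<bullet> b) * (c \<bullet> e) - (a \<bullet> c) * (b \<bullet> e) + (a \<bullet> e) * (b \<bullet> c)))"
  (is "?t = ?r")
proof -
  have "2 * ?t = 2 * ?r"
    unfolding trace_anticomm3[OF int_cl[of a b] int_cl[of a c] int_cl[of a e]]
    by (simp add: trace_cl_cl algebra_simps)
  then show ?thesis by (metis mult_left_cancel zero_neq_numeral)
qed

text \<open>The two Clifford actions anticommute exactly, so only the pairing of the two
  \<open>clb\<close> factors survives.\<close>

lemma trace_clb_clb_cl_cl: "trace (clb a ** clb b ** cl c ** cl e) = of_real (- 16 * ((a \<bullet> b) * (c \<bullet> e)))"
  using trace_anticomm3[OF clb_clb[of a b] clb_cl[of a c] clb_cl[of a e]]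
  by (simp add: trace_cl_cl)

text \<open>The right-hand side is \<open>|a|^2\<close> times the Clifford action of the reflection
  of \<open>b\<close> in the hyperplane orthogonal to \<open>a\<close>; in particular it is again
  linear in \<open>cl\<close>.\<close>

lemma cl_sandwich: "cl a ** cl b ** cl a = (a \<bullet> a) *\<^sub>R cl b - (2 * (a \<bullet> b)) *\<^sub>R cl a"
proof -
  have "cl a ** cl b = (- 2 * (a \<bullet> b)) *\<^sub>R mat 1 - cl b ** cl a"
    using cl_cl[of a b] by (simp add: algebra_simps)
  then have "cl a ** cl b ** cl a = (- 2 * (a \<bullet> b)) *\<^sub>R cl a - cl b ** (cl a ** cl a)"
    by (simp add: form_mat.diff_left form_mat.scaleR_left form_mat.minus_left matrix_mul_assoc)
  then show ?thesis
    by (simp add: cliff_square form_mat.scaleR_right form_mat.minus_right)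
qed

section \<open>Charts of the boundary\<close>

lemma smooth_on_imp_differentiable_within:
  assumes "smooth_on S f" "x \<in> S"
  shows "f differentiable (at x within S)"
proof -
  obtain W F where W: "open W" "x \<in> W" "\<And>k. Ck_on k W F" "\<And>y. y \<in> W \<inter> S \<Longrightarrow> F y = f y"
    using assms unfolding smooth_on_def by meson
  have "F differentiable (at x)"
    using W(2) W(3)[of "Suc 0"] by simp
  then obtain F' where "(F has_derivative F') (at x within S)"
    by (auto simp: differentiable_def intro: has_derivative_at_withinI)
  moreover obtain e where "e > 0" "ball x e \<subseteq> W"
    using W(1,2) open_contains_ball by blast
  ultimately have "(f has_derivative F') (at x within S)"
    using assms(2) W(4)
    by (intro has_derivative_transform_within[of F F' x S e f]) (auto simp: dist_commute subset_iff)
  then show ?thesis by (auto simp: differentiable_def)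
qed

lemma smooth_on_imp_differentiable:
  assumes "smooth_on S f" "x \<in> S" "open S"
  shows "f differentiable (at x)"
  using smooth_on_imp_differentiable_within[OF assms(1,2)] by (simp only: at_within_open[OF assms(2,3)])

lemma smooth_on_imp_continuous_on: "smooth_on S f \<Longrightarrow> continuous_on S f"
  by (meson continuous_on_eq_continuous_within differentiable_imp_continuous_within
      smooth_on_imp_differentiable_within)

lemma is_chart_inj: "is_chart X H c \<Longrightarrow> inj_on (snd c) (fst c)"
  by (metis homeomorphic_imp_injective_map is_chart_def topspace_subtopology_subset openin_subset)

lemma chart_inv_apply: "inj_on (snd c) (fst c) \<Longrightarrow> p \<in> fst c \<Longrightarrow> chart_inv c (snd c p) = p"
  by (simp add: chart_inv_def)

lemma is_chart_openin_image:
  assumes "is_chart X H c" "openin X V" "V \<subseteq> fst c"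
  shows "openin (top_of_set H) (snd c ` V)"
proof -
  have "openin (subtopology X (fst c)) V"
    using assms by (simp add: is_chart_def openin_open_subtopology)
  then have "openin (top_of_set (snd c ` fst c)) (snd c ` V)"
    using assms(1) by (meson homeomorphic_imp_open_map is_chart_def open_map_def)
  then show ?thesis
    using assms(1) by (meson is_chart_def openin_trans)
qed

lemma is_chart_open_image:
  "is_chart X UNIV c \<Longrightarrow> openin X V \<Longrightarrow> V \<subseteq> fst c \<Longrightarrow> open (snd c ` V)"
  using is_chart_openin_image[of X UNIV c V] by simp

lemma is_chart_openin_preimage:
  assumes "is_chart X H c" "open T"
  shows "openin X {p \<in> fst c. snd c p \<in> T}"
proof -
  have "continuous_map (subtopology X (fst c)) (top_of_set (snd c ` fst c)) (snd c)"
    using assms(1) by (simp add: is_chart_def homeomorphic_imp_continuous_map)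
  moreover have "openin (top_of_set (snd c ` fst c)) (snd c ` fst c \<inter> T)"
    using assms(2) by (simp add: openin_open_Int)
  ultimately have "openin (subtopology X (fst c))
      {p \<in> topspace (subtopology X (fst c)). snd c p \<in> snd c ` fst c \<inter> T}"
    by (rule openin_continuous_map_preimage)
  moreover have "{p \<in> topspace (subtopology X (fst c)). snd c p \<in> snd c ` fst c \<inter> T} = {p \<in> fst c. snd c p \<in> T}"
    using assms(1) openin_subset by (auto simp: is_chart_def)
  ultimately show ?thesis
    using assms(1) by (metis is_chart_def openin_trans_full)
qed

lemma is_chart_in_model: "is_chart X H c \<Longrightarrow> p \<in> fst c \<Longrightarrow> snd c p \<in> H"
  by (auto simp: is_chart_def dest!: openin_imp_subset)

text \<open>Invariance of domain: a transition map cannot send an interior point of the half-space to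
  its boundary.\<close>

lemma bdry_coordinate_0:
  assumes A: "oriented_atlas X half_space A" and c: "c \<in> A" and p: "p \<in> fst c" "p \<in> bdry X A"
  shows "snd c p $ 4 = 0"
proof (rule ccontr)
  assume nz: "snd c p $ 4 \<noteq> 0"
  obtain c' where c': "c' \<in> A" "p \<in> fst c'" "snd c' p $ 4 = 0"
    using p(2) unfolding bdry_def by blast
  have ch: "is_chart X half_space c" "is_chart X half_space c'" and comp: "oriented_compatible c c'"
    using A c c'(1) by (auto simp: oriented_atlas_def)
  define V where "V = fst c \<inter> fst c'"
  \<comment> \<open>Cutting with the open half-space turns a relatively open chart image into an
    open subset of the full space, as invariance of domain requires.\<close>
  define U where "U = snd c ` V \<inter> {x. x $ 4 > 0}"
  define \<phi> where "\<phi> = (\<lambda>x. snd c' (chart_inv c x))"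
  note inj = is_chart_inj[OF ch(1)] is_chart_inj[OF ch(2)]
  have "openin X V"
    using ch by (auto simp: V_def is_chart_def)
  then have "openin (top_of_set half_space) (snd c ` V)"
    by (intro is_chart_openin_image[OF ch(1)]) (auto simp: V_def)
  then obtain T where "open T" and TV: "snd c ` V = half_space \<inter> T"
    unfolding openin_open by blast
  moreover have "U = T \<inter> {x. x $ 4 > 0}"
    unfolding U_def TV by (auto simp: half_space_def)
  ultimately have "open U"
    by (simp only: open_Int open_halfspace_component_gt_cart)
  moreover have "continuous_on U \<phi>"
    using comp smooth_on_imp_continuous_on continuous_on_subset
    unfolding oriented_compatible_def U_def V_def \<phi>_def by blast
  moreover have "inj_on \<phi> U"
  proof (rule inj_onI)
    fix x y assume xy: "x \<in> U" "y \<in> U" "\<phi> x = \<phi> y"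
    then obtain q r where qr: "q \<in> V" "r \<in> V" "x = snd c q" "y = snd c r"
      by (auto simp: U_def)
    then have "snd c' q = snd c' r"
      using xy(3) inj by (simp add: \<phi>_def V_def chart_inv_apply)
    then show "x = y"
      using qr inj(2) by (auto simp: V_def dest: inj_onD)
  qed
  ultimately have "open (\<phi> ` U)"
    by (intro invariance_of_domain)
  moreover have "snd c' p \<in> \<phi> ` U"
  proof
    show "snd c' p = \<phi> (snd c p)"
      using p inj by (simp add: \<phi>_def chart_inv_apply)
    show "snd c p \<in> U"
      using nz p(1) c'(2) is_chart_in_model[OF ch(1) p(1)] by (auto simp: U_def V_def half_space_def)
  qed
  ultimately obtain e where e: "e > 0" "ball (snd c' p) e \<subseteq> \<phi> ` U"
    using open_contains_ball by blast
  \<comment> \<open>Lowering the fourth coordinate by \<open>e/2\<close> stays in the ball, all of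
    whose points are values of \<open>c'\<close>, but leaves the half-space.\<close>
  define z where "z = snd c' p - (e/2) *\<^sub>R axis 4 1"
  have "z \<in> ball (snd c' p) e"
    using e(1) by (simp add: z_def dist_norm)
  then obtain q where "q \<in> V" "z = snd c' q"
    using e(2) inj by (auto simp: U_def V_def \<phi>_def chart_inv_apply subset_iff image_iff)
  then have "z \<in> half_space"
    using is_chart_in_model[OF ch(2)] by (simp add: V_def)
  then show False
    using c'(3) e(1) by (simp add: half_space_def z_def axis_def)
qed

text \<open>The boundary is closed: around any other point the condition of positive fourth
  coordinate is open, and no boundary point satisfies it in any chart of the atlas.\<close>

lemma compact_space_bdry_top:
  assumes A: "oriented_atlas X half_space A" and X: "compact_space X"
  shows "compact_space (bdry_top X A)"
proof -
  have sub: "bdry X A \<subseteq> topspace X" by (auto simp: bdry_def)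
  have "openin X (topspace X - bdry X A)"
    unfolding openin_subopen[of X "topspace X - bdry X A"]
  proof
    fix p assume p: "p \<in> topspace X - bdry X A"
    then obtain c where c: "c \<in> A" "p \<in> fst c"
      using A unfolding oriented_atlas_def by blast
    then have ch: "is_chart X half_space c"
      using A by (auto simp: oriented_atlas_def)
    define V where "V = {q \<in> fst c. snd c q \<in> {x. x $ 4 > 0}}"
    have "openin X V"
      unfolding V_def by (rule is_chart_openin_preimage[OF ch]) (simp add: open_halfspace_component_gt_cart)
    moreover have "p \<in> V"
      using p c is_chart_in_model[OF ch c(2)] by (force simp: V_def bdry_def half_space_def)
    moreover have "V \<subseteq> topspace X - bdry X A"
      using bdry_coordinate_0[OF A c(1)] openin_subset[OF calculation(1)] by (force simp: V_def)
    ultimately show "\<exists>T. openin X T \<and> p \<in> T \<and> T \<subseteq> topspace X - bdry X A" by blast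
  qed
  then have "closedin X (bdry X A)"
    using sub by (simp add: closedin_def)
  then show ?thesis
    using X by (simp add: bdry_top_def closedin_compact_space compact_space_subtopology)
qed

text \<open>This guarantees that the \<open>SOME\<close> in \<open>form_integral\<close> selects a
  genuine finite cover.\<close>

lemma finite_chart_cover:
  assumes "compact_space Y" "\<And>c. c \<in> F \<Longrightarrow> openin Y (fst c)" "\<And>p. p \<in> topspace Y \<Longrightarrow> \<exists>c\<in>F. p \<in> fst c"
  shows "\<exists>cs. set cs \<subseteq> F \<and> (\<Union>c\<in>set cs. fst c) = topspace Y"
proof -
  have "\<forall>U\<in>fst ` F. openin Y U"
    using assms(2) by blast
  moreover have "topspace Y \<subseteq> \<Union>(fst ` F)"
    using assms(3) by blast
  ultimately have "\<exists>\<F>. finite \<F> \<and> \<F> \<subseteq> fst ` F \<and> topspace Y \<subseteq> \<Union>\<F>"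
    by (intro assms(1)[unfolded compact_space_alt, THEN spec, THEN mp] conjI)
  then obtain K where "finite K" "K \<subseteq> F" "topspace Y \<subseteq> (\<Union>c\<in>K. fst c)"
    by (metis finite_subset_image)
  moreover obtain cs where "set cs = K"
    using \<open>finite K\<close> finite_list by blast
  moreover have "(\<Union>c\<in>K. fst c) \<subseteq> topspace Y"
    using \<open>K \<subseteq> F\<close> assms(2) openin_subset by blast
  ultimately show ?thesis by blast
qed

text \<open>Charts of the maximal atlas are related by definition only to charts of the given atlas,
  so the transition from \<open>c\<close> to \<open>f\<close> is factored through \<open>a\<close>
  and the chain rule multiplies two positive determinants.\<close>

lemma det_jacobian_pos:
  fixes c f a :: "('a, 'n::finite) chart"
  assumes c: "c \<in> charts Y UNIV B" and f: "f \<in> charts Y UNIV B" and a: "a \<in> B"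
    and a_open: "openin Y (fst a)" and a_inj: "inj_on (snd a) (fst a)"
    and p: "p \<in> fst c" "p \<in> fst f" "p \<in> fst a"
  shows "det (jacobian c f p) > 0"
proof -
  have ch: "is_chart Y UNIV c" "is_chart Y UNIV f"
    and comp: "oriented_compatible a c" "oriented_compatible a f"
    using c f a by (auto simp: charts_def)
  note inj = is_chart_inj[OF ch(1)] is_chart_inj[OF ch(2)] a_inj
  have op: "openin Y (fst c)" "openin Y (fst f)" using ch by (auto simp: is_chart_def)
  let ?ca = "snd c ` (fst c \<inter> fst a)" and ?af = "snd a ` (fst a \<inter> fst f)" and ?cf = "snd c ` (fst c \<inter> fst f)"
  let ?fa = "snd f ` (fst a \<inter> fst f)"
  let ?u = "\<lambda>x. snd a (chart_inv c x)" and ?v = "\<lambda>x. snd f (chart_inv a x)" and ?w = "\<lambda>x. snd f (chart_inv c x)"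
  have ca: "open ?ca" and cf: "open ?cf" and caf: "open (snd c ` (fst c \<inter> fst a \<inter> fst f))"
    by (intro is_chart_open_image[OF ch(1)] openin_Int op a_open; blast)+
  \<comment> \<open>About \<open>a\<close> only an open domain and injectivity are known; its image
    is seen to be open through \<open>f\<close> by invariance of domain.\<close>
  have af: "open ?af"
  proof -
    have "open ?fa"
      by (intro is_chart_open_image[OF ch(2)] openin_Int op a_open) auto
    moreover have "continuous_on ?fa (\<lambda>x. snd a (chart_inv f x))"
      using comp(2) by (simp add: oriented_compatible_def smooth_on_imp_continuous_on)
    moreover have "inj_on (\<lambda>x. snd a (chart_inv f x)) ?fa"
      using inj by (auto simp: inj_on_def chart_inv_apply)
    ultimately have "open ((\<lambda>x. snd a (chart_inv f x)) ` ?fa)"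
      by (intro invariance_of_domain)
    also have "(\<lambda>x. snd a (chart_inv f x)) ` ?fa = ?af"
      using inj by (auto simp: chart_inv_apply image_image intro!: image_cong)
    finally show ?thesis .
  qed
  have "?u differentiable (at (snd c p))"
    using comp(1) p ca by (intro smooth_on_imp_differentiable[of ?ca]) (auto simp: oriented_compatible_def Int_commute)
  then have u: "(?u has_derivative frechet_derivative ?u (at (snd c p))) (at (snd c p))"
    by (simp add: frechet_derivative_works)
  have "?v differentiable (at (snd a p))"
    using comp(2) p af by (intro smooth_on_imp_differentiable[of ?af]) (auto simp: oriented_compatible_def)
  then have v: "(?v has_derivative frechet_derivative ?v (at (snd a p))) (at (?u (snd c p)))"
    using inj p by (simp add: frechet_derivative_works chart_inv_apply)
  have "(?v \<circ> ?u has_derivative frechet_derivative ?v (at (snd a p)) \<circ> frechet_derivative ?u (at (snd c p))) (at (snd c p))"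
    by (rule diff_chain_at[OF u v])
  then have "(?w has_derivative frechet_derivative ?v (at (snd a p)) \<circ> frechet_derivative ?u (at (snd c p))) (at (snd c p))"
    by (rule has_derivative_transform_within_open[OF _ caf]) (use p inj in \<open>auto simp: chart_inv_apply\<close>)
  then have w: "frechet_derivative ?w (at (snd c p)) =
      frechet_derivative ?v (at (snd a p)) \<circ> frechet_derivative ?u (at (snd c p))"
    by (metis frechet_derivative_at)
  have "jacobian c f p = jacobian a f p ** jacobian c a p"
    unfolding jacobian_def using ca cf af p w
    by (simp add: at_within_open[OF _ ca] at_within_open[OF _ cf] at_within_open[OF _ af]
        matrix_compose has_derivative_linear[OF u] has_derivative_linear[OF v])
  moreover have "det (jacobian a f p) > 0" "det (jacobian c a p) > 0"
    using comp p by (auto simp: oriented_compatible_def)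
  ultimately show ?thesis by (simp add: det_mul)
qed

section \<open>Orientation and volume density in boundary charts\<close>

lemma tang_nth: "tang x $ 1 = x $ 1" "tang x $ 2 = x $ 2" "tang x $ 3 = x $ 3"
  by (simp_all add: tang_def)

lemma tang_eqD: "tang x = tang y \<Longrightarrow> x $ 4 = y $ 4 \<Longrightarrow> x = y"
  unfolding vec_eq_iff forall_4 forall_3 tang_nth by blast

lemma openin_bdry_atlas:
  assumes "oriented_atlas X half_space A" "a \<in> bdry_atlas X A"
  shows "openin (bdry_top X A) (fst a)"
proof -
  obtain c where c: "c \<in> A" "a = (fst c \<inter> bdry X A, \<lambda>p. tang (snd c p))"
    using assms(2) unfolding bdry_atlas_def by (rule imageE)
  then have "openin X (fst c)"
    using assms(1) unfolding oriented_atlas_def is_chart_def by blast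
  then show ?thesis
    by (simp add: c(2) bdry_top_def openin_subtopology_Int)
qed

text \<open>Dropping the fourth coordinate loses nothing, because it vanishes on the boundary in
  every chart of the atlas.\<close>

lemma inj_on_bdry_atlas:
  assumes A: "oriented_atlas X half_space A" "a \<in> bdry_atlas X A"
  shows "inj_on (snd a) (fst a)"
proof -
  obtain c where c: "c \<in> A" "a = (fst c \<inter> bdry X A, \<lambda>p. tang (snd c p))"
    using A(2) unfolding bdry_atlas_def by (rule imageE)
  have inj: "inj_on (snd c) (fst c)"
    using A(1) c(1) is_chart_inj[of X half_space c] unfolding oriented_atlas_def by blast
  show ?thesis
  proof (rule inj_onI)
    fix p q assume "p \<in> fst a" "q \<in> fst a" and eq: "snd a p = snd a q"
    then have pq: "p \<in> fst c" "p \<in> bdry X A" "q \<in> fst c" "q \<in> bdry X A"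
      by (simp_all add: c(2))
    have "snd c p = snd c q"
    proof (rule tang_eqD)
      show "snd c p $ 4 = snd c q $ 4"
        by (simp add: bdry_coordinate_0[OF A(1) c(1)] pq)
    qed (use eq c(2) in simp)
    then show "p = q"
      by (rule inj_onD[OF inj _ pq(1,3)])
  qed
qed

lemma bdry_det_jacobian_pos:
  assumes A: "oriented_atlas X half_space A"
    and c: "c \<in> bdry_charts X A" and f: "f \<in> bdry_charts X A" and p: "p \<in> fst c" "p \<in> fst f"
  shows "det (jacobian c f p) > 0"
proof -
  have "p \<in> topspace (bdry_top X A)"
    using c p(1) openin_subset[of "bdry_top X A" "fst c"] unfolding charts_def is_chart_def by blast
  then have "p \<in> topspace X" "p \<in> bdry X A" by (simp_all add: bdry_top_def)
  then obtain a where "a \<in> bdry_atlas X A" "p \<in> fst a"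
  proof -
    obtain c' where "c' \<in> A" "p \<in> fst c'"
      using A \<open>p \<in> topspace X\<close> unfolding oriented_atlas_def by blast
    then show ?thesis
      using that[of "(fst c' \<inter> bdry X A, \<lambda>p. tang (snd c' p))"] \<open>p \<in> bdry X A\<close>
      by (auto simp: bdry_atlas_def)
  qed
  then show ?thesis
    using det_jacobian_pos[OF c f] openin_bdry_atlas[OF A] inj_on_bdry_atlas[OF A] p by blast
qed

text \<open>The transformation law determines the Jacobian determinant only up to sign; orientation
  selects the positive root.\<close>

lemma bdry_sqrt_det_metric:
  assumes A: "oriented_atlas X half_space A"
    and gB: "riemannian_metric (bdry_top X A) UNIV (bdry_atlas X A) gB"
    and c: "c \<in> bdry_charts X A" and f: "f \<in> flat_charts (bdry_top X A) UNIV (bdry_atlas X A) gB"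
    and p: "p \<in> fst c" "p \<in> fst f"
  shows "sqrt (det (gB c p)) = det (jacobian c f p)"
proof -
  have f': "f \<in> bdry_charts X A" "gB f p = mat 1"
    using f p by (auto simp: flat_charts_def)
  have "gB c p = transpose (jacobian c f p) ** gB f p ** jacobian c f p"
    using gB c f'(1) p unfolding riemannian_metric_def by blast
  then have "det (gB c p) = (det (jacobian c f p))\<^sup>2"
    by (simp add: f'(2) det_mul det_transpose power2_eq_square)
  then show ?thesis
    using bdry_det_jacobian_pos[OF A c f'(1) p] by (simp add: real_sqrt_unique)
qed

section \<open>The extrinsic curvature of a collar\<close>

lemma join_nth: "join x s $ 1 = x $ 1" "join x s $ 2 = x $ 2" "join x s $ 3 = x $ 3" "join x s $ 4 = s"
  by (simp_all add: join_def)

lemma tang_join [simp]: "tang (join x s) = x"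
  by (simp add: vec_eq_iff forall_3 tang_nth join_nth)

lemma join_tang: "join (tang x) (x $ 4) = x"
  by (simp add: vec_eq_iff forall_4 tang_nth join_nth)

lemma emb_simps: "emb 1 = 1" "emb 2 = 2" "emb 3 = 3"
  by (simp_all add: emb_def)

lemma bounded_linear_tang: "bounded_linear tang"
  unfolding linear_conv_bounded_linear[symmetric]
  by (simp add: linear_iff vec_eq_iff forall_3 tang_nth)

lemma tang_axis: "tang (axis 4 1) = 0"
  by (simp add: vec_eq_iff forall_3 tang_nth axis_def)

lemma tang_axis_emb: "tang (axis (emb j) 1) = axis j 1"
  using exhaust_3[of j] by (auto simp: vec_eq_iff forall_3 tang_nth axis_def emb_simps)

lemma emb_neq_4: "emb i \<noteq> 4" "4 \<noteq> emb i"
  using exhaust_3[of i] by (auto simp: emb_simps)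

lemma join_emb: "join x s $ emb i = x $ i"
  using exhaust_3[of i] by (auto simp: emb_simps join_nth)

lemma collar_metric_nth:
  "collar_metric f g $ emb i $ emb j = f * g $ i $ j"
  "collar_metric f g $ 4 $ emb j = 0" "collar_metric f g $ emb i $ 4 = 0" "collar_metric f g $ 4 $ 4 = 1"
proof -
  have 1: "axis (emb j) (1::real) $ 4 = 0"
    using emb_neq_4 by (simp add: axis_def)
  show "collar_metric f g $ emb i $ emb j = f * g $ i $ j"
    by (simp add: collar_metric_def matrix_def join_emb tang_axis_emb matrix_vector_mult_basis column_def)
  show "collar_metric f g $ 4 $ emb j = 0"
    by (simp add: collar_metric_def matrix_def join_nth 1)
  show "collar_metric f g $ emb i $ 4 = 0" "collar_metric f g $ 4 $ 4 = 1"
    by (simp_all add: collar_metric_def matrix_def join_emb join_nth tang_axis)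
qed

lemma exhaust_emb: "(k :: 4) = 4 \<or> (\<exists>i. k = emb i)"
  using exhaust_4[of k] emb_simps by metis

lemma pos_def_matrix_inv:
  fixes g :: "real ^ 'n::finite ^ 'n"
  assumes "\<And>v. v \<noteq> 0 \<Longrightarrow> v \<bullet> (g *v v) > 0"
  shows "g ** matrix_inv g = mat 1" "matrix_inv g ** g = mat 1"
proof -
  have "\<forall>v. g *v v = 0 \<longrightarrow> v = 0"
    using assms by (metis inner_zero_right less_irrefl)
  then have "invertible g"
    using matrix_left_invertible_ker[of g] invertible_left_inverse[of g] by blast
  then have "\<exists>B. g ** B = mat 1 \<and> B ** g = mat 1"
    by (simp add: invertible_def)
  then show "g ** matrix_inv g = mat 1" "matrix_inv g ** g = mat 1"
    unfolding matrix_inv_def by (metis (mono_tags, lifting) someI_ex)+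
qed

text \<open>The derivative within a set is unique once the set has points arbitrarily near
  \<open>x\<close> along every coordinate axis, if only on one side.\<close>

lemma pderiv_within_eq:
  fixes f :: "real ^ 'n::finite \<Rightarrow> 'b::real_normed_vector"
  assumes "(f has_derivative D) (at x within S)"
    and "\<And>i e. \<lbrakk>i\<in>Basis; e>0\<rbrakk> \<Longrightarrow> \<exists>d. 0 < \<bar>d\<bar> \<and> \<bar>d\<bar> < e \<and> x + d *\<^sub>R i \<in> S"
  shows "pderiv_within S j f x = D (axis j 1)"
proof -
  have "f differentiable (at x within S)"
    using assms(1) by (auto simp: differentiable_def)
  then have "(f has_derivative frechet_derivative f (at x within S)) (at x within S)"
    by (simp add: frechet_derivative_works)
  then have "frechet_derivative f (at x within S) = D"
    using frechet_derivative_unique_within[OF _ assms(1)] assms(2) by blast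
  then show ?thesis by (simp add: pderiv_within_def)
qed

text \<open>A positive step along an axis never lowers the fourth coordinate, so small positive
  steps stay in the half-space.\<close>

lemma half_space_neighbourhood_thick:
  fixes x :: "real ^ 4"
  assumes "open O'" "x \<in> O'" "O' \<inter> half_space \<subseteq> S" "x \<in> half_space" "i \<in> Basis" "e > 0"
  shows "\<exists>d. 0 < \<bar>d\<bar> \<and> \<bar>d\<bar> < e \<and> x + d *\<^sub>R i \<in> S"
proof -
  obtain r where r: "r > 0" "ball x r \<subseteq> O'"
    using assms(1,2) open_contains_ball by blast
  define d where "d = min e r / 2"
  have d: "0 < d" "d < e" "d < r" using r(1) assms(6) by (auto simp: d_def)
  obtain k where i: "i = axis k 1"
    using assms(5) by (auto simp: Basis_vec_def)
  have "x + d *\<^sub>R i \<in> O'"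
    using r(2) d assms(5) by (auto simp: dist_norm subset_iff)
  moreover have "x + d *\<^sub>R i \<in> half_space"
    using assms(4) d by (auto simp: half_space_def i axis_def)
  ultimately show ?thesis using d assms(3) by (intro exI[of _ d]) auto
qed

text \<open>Surjectivity of the collar map onto \<open>\<partial>M \<times> [0,1)\<close> makes the
  image a full product. The one-sided derivatives behind \<open>K\<close> are taken within this
  set.\<close>

lemma collar_chart_image:
  assumes "is_collar X A Uc b xn" "c \<in> bdry_charts X A"
  shows "snd (collar_chart Uc b xn c) ` fst (collar_chart Uc b xn c) = {y. tang y \<in> snd c ` fst c \<and> 0 \<le> y $ 4 \<and> y $ 4 < 1}"
    (is "?L = ?R")
proof -
  have hom: "homeomorphic_map (subtopology X Uc) (prod_topology (bdry_top X A) (top_of_set {0..<1})) (\<lambda>p. (b p, xn p))"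
    and Uc: "openin X Uc"
    using assms(1) by (auto simp: is_collar_def)
  have "(\<lambda>p. (b p, xn p)) ` topspace (subtopology X Uc) = topspace (prod_topology (bdry_top X A) (top_of_set {0..<1}))"
    using hom homeomorphic_imp_surjective_map by blast
  moreover have "topspace (subtopology X Uc) = Uc"
    using openin_subset[OF Uc] by auto
  ultimately have im: "(\<lambda>p. (b p, xn p)) ` Uc = topspace (bdry_top X A) \<times> {0..<1}"
    by simp
  have c: "fst c \<subseteq> topspace (bdry_top X A)"
    using assms(2) openin_subset[of "bdry_top X A" "fst c"] unfolding charts_def is_chart_def by blast
  show ?thesis
  proof
    show "?L \<subseteq> ?R"
    proof
      fix y assume "y \<in> ?L"
      then obtain p where p: "p \<in> Uc" "b p \<in> fst c" "y = join (snd c (b p)) (xn p)"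
        by (auto simp: collar_chart_def)
      then have "xn p \<in> {0..<1}" using im by blast
      then show "y \<in> ?R" using p by (simp add: join_nth)
    qed
    show "?R \<subseteq> ?L"
    proof
      fix y assume y: "y \<in> ?R"
      then obtain q where q: "q \<in> fst c" "tang y = snd c q" by auto
      then have "(q, y $ 4) \<in> (\<lambda>p. (b p, xn p)) ` Uc"
        unfolding im using y c by auto
      then obtain p where p: "p \<in> Uc" "b p = q" "xn p = y $ 4" by auto
      have "y = snd (collar_chart Uc b xn c) p"
        using p q by (simp add: collar_chart_def join_tang flip: q(2))
      moreover have "p \<in> fst (collar_chart Uc b xn c)"
        using p q by (simp add: collar_chart_def)
      ultimately show "y \<in> ?L" by blast
    qed
  qed
qed

text \<open>The collar metric has no mixed entries and its normal coefficient is constant, so that only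
  the normal derivative of the tangential part enters \<open>\<Gamma>\<^sup>4\<^sub>i\<^sub>j\<close>.\<close>

lemma extrinsic_K_collar:
  assumes collar: "is_collar X A Uc b xn" and c: "c \<in> bdry_charts X A"
    and gM: "riemannian_metric X half_space A gM"
    and gB: "riemannian_metric (bdry_top X A) UNIV (bdry_atlas X A) gB"
    and gM_collar: "\<And>p. p \<in> fst (collar_chart Uc b xn c) \<Longrightarrow>
        gM (collar_chart Uc b xn c) p = collar_metric (1 / h (xn p)) (gB c (b p))"
    and h: "\<And>s. 0 \<le> s \<Longrightarrow> s < 1 \<Longrightarrow> h s = hh s" "hh 0 = 1"
    and d: "(hh has_real_derivative d) (at 0)"
    and p: "p \<in> fst c" "p \<in> bdry X A"
  shows "extrinsic_K gM gB (collar_chart Uc b xn c) c p = - 3 / 2 * d"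
proof -
  define c' where "c' = collar_chart Uc b xn c"
  define S where "S = snd c' ` fst c'"
  define W where "W = snd c ` fst c"
  define x where "x = join (snd c p) 0"
  define G where "G = coord_metric gM c'"
  define gBc where "gBc = (\<lambda>x'. gB c (chart_inv c x'))"
  have ch: "is_chart (bdry_top X A) UNIV c"
    using c by (simp add: charts_def)
  note inj = is_chart_inj[OF ch]
  have S: "S = {y. tang y \<in> W \<and> 0 \<le> y $ 4 \<and> y $ 4 < 1}"
    unfolding S_def W_def c'_def by (rule collar_chart_image[OF collar c])
  have W: "open W"
    unfolding W_def using ch by (simp add: is_chart_def)
  have p': "b p = p" "xn p = 0" "p \<in> Uc"
    using collar p(2) by (auto simp: is_collar_def)
  have pc': "p \<in> fst c'" and x: "snd c' p = x"
    using p p' by (auto simp: c'_def collar_chart_def x_def)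
  have G: "G y = collar_metric (1 / hh (y $ 4)) (gBc (tang y))" if "y \<in> S" for y
  proof -
    define q where "q = chart_inv c' y"
    have q: "q \<in> fst c'" "snd c' q = y"
      using that by (simp_all add: q_def chart_inv_def S_def inv_into_into f_inv_into_f)
    then have y: "y = join (snd c (b q)) (xn q)" and bq: "b q \<in> fst c"
      by (auto simp: c'_def collar_chart_def)
    have "G y = collar_metric (1 / h (xn q)) (gB c (b q))"
      using gM_collar[of q] q(1) by (simp add: G_def coord_metric_def flip: q_def c'_def)
    moreover have "h (xn q) = hh (y $ 4)"
      using that h(1) by (simp add: S y join_nth)
    moreover have "gB c (b q) = gBc (tang y)"
      by (simp add: gBc_def y chart_inv_apply[OF inj bq])
    ultimately show ?thesis by simp
  qed
  have xS: "x \<in> S" using p by (simp add: S x_def join_nth W_def)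
  \<comment> \<open>The image without its constraint at height 0: an open set that meets the
    half-space inside \<open>S\<close>.\<close>
  define O' where "O' = tang -` W \<inter> {y. y $ 4 < 1}"
  have "open O'"
    unfolding O'_def
    by (intro open_Int open_vimage W open_halfspace_component_lt_cart
        linear_continuous_on bounded_linear_tang)
  moreover have "x \<in> O'" using xS by (simp add: S O'_def x_def join_nth)
  moreover have "O' \<inter> half_space \<subseteq> S" by (auto simp: O'_def half_space_def S)
  moreover have "x \<in> half_space" by (simp add: half_space_def x_def join_nth)
  ultimately have thick: "\<And>i e. \<lbrakk>i\<in>Basis; e>0\<rbrakk> \<Longrightarrow> \<exists>d. 0 < \<bar>d\<bar> \<and> \<bar>d\<bar> < e \<and> x + d *\<^sub>R i \<in> S"
    by (rule half_space_neighbourhood_thick)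
  have xt: "tang x = snd c p" "x $ 4 = 0" by (simp_all add: x_def join_nth)
  have gBx: "gBc (tang x) = gB c p"
    by (simp add: gBc_def xt chart_inv_apply[OF inj p(1)])
  have mixed: "pderiv_within S k (\<lambda>y. G y $ emb i $ 4) x = 0" for k i
  proof -
    have "((\<lambda>y. G y $ emb i $ 4) has_derivative (\<lambda>_. 0)) (at x within S)"
      by (rule has_derivative_transform[OF xS _ has_derivative_const[of 0]])
        (simp add: G collar_metric_nth)
    from pderiv_within_eq[OF this thick] show ?thesis by simp
  qed
  have normal: "pderiv_within S 4 (\<lambda>y. G y $ emb i $ emb j) x = - d * gB c p $ i $ j" for i j
  proof -
    have "smooth_on W gBc"
      using gB c unfolding riemannian_metric_def W_def gBc_def by blast
    then have "gBc differentiable (at (tang x))"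
      using W p(1) by (intro smooth_on_imp_differentiable[of W]) (auto simp: W_def xt)
    then obtain D where D: "(gBc has_derivative D) (at (tang x))"
      by (auto simp: differentiable_def)
    have "(gBc \<circ> tang has_derivative D \<circ> tang) (at x)"
      by (rule diff_chain_at[OF bounded_linear_imp_has_derivative[OF bounded_linear_tang] D])
    then have D1: "((\<lambda>y. gBc (tang y)) has_derivative (\<lambda>v. D (tang v))) (at x)"
      by (simp add: o_def)
    have D2: "((\<lambda>y. hh (y $ 4)) has_derivative (\<lambda>v. d * v $ 4)) (at x)"
    proof -
      have "(hh has_derivative (\<lambda>t. d * t)) (at (x $ 4))"
        using d by (simp add: has_field_derivative_def xt)
      moreover have "((\<lambda>y. y $ 4) has_derivative (\<lambda>v. v $ 4)) (at x)"
        by (rule bounded_linear_imp_has_derivative[OF bounded_linear_vec_nth])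
      ultimately show ?thesis
        using diff_chain_at[of "\<lambda>y. y $ 4" "\<lambda>v. v $ 4" x hh "\<lambda>t. d * t"] by (simp add: o_def)
    qed
    \<comment> \<open>Since \<open>hh 0 = 1\<close>, the product rule leaves the tangential
      derivative \<open>D\<close> unscaled; it disappears along the normal axis, whose tangential
      part is 0.\<close>
    have D3: "((\<lambda>y. 1 / hh (y $ 4) * gBc (tang y) $ i $ j) has_derivative
        (\<lambda>v. - d * v $ 4 * gB c p $ i $ j + D (tang v) $ i $ j)) (at x)"
      by (rule derivative_eq_intros D2 D1 bounded_linear.has_derivative[OF bounded_linear_vec_nth] | simp add: xt h(2))+
        (simp add: fun_eq_iff gBx[unfolded xt] xt h(2) algebra_simps)
    have "((\<lambda>y. G y $ emb i $ emb j) has_derivative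
        (\<lambda>v. - d * v $ 4 * gB c p $ i $ j + D (tang v) $ i $ j)) (at x within S)"
      by (rule has_derivative_transform[OF xS _ has_derivative_at_withinI[OF D3]])
        (simp add: G collar_metric_nth)
    from pderiv_within_eq[OF this thick, of 4] show ?thesis
      using linear_0[OF has_derivative_linear[OF D]] by (simp add: tang_axis)
  qed
  have pos_B: "v \<bullet> (gB c p *v v) > 0" if "v \<noteq> 0" for v
    using gB c p(1) that unfolding riemannian_metric_def by blast
  have sym_B: "transpose (gB c p) = gB c p"
    using gB c p(1) unfolding riemannian_metric_def by blast
  have "c' \<in> charts X half_space A"
    using collar c by (auto simp: is_collar_def c'_def)
  then have pos_M: "v \<bullet> (gM c' p *v v) > 0" if "v \<noteq> 0" for v
    using gM pc' that unfolding riemannian_metric_def by blast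
  have "inj_on (snd c') (fst c')"
    using \<open>c' \<in> _\<close> is_chart_inj[of X half_space c'] by (auto simp: charts_def)
  then have Gx: "G x = gM c' p"
    unfolding G_def coord_metric_def x[symmetric] by (simp add: chart_inv_apply pc')
  \<comment> \<open>The fourth row of the metric is the fourth unit vector, so the fourth row of the
    inverse can be read off from the product with it, without inverting the tangential
    block.\<close>
  have inv4: "matrix_inv (G x) $ 4 $ l = (if l = 4 then 1 else 0)" for l
  proof -
    have "(G x ** matrix_inv (G x)) $ 4 $ l = (\<Sum>k\<in>UNIV. G x $ 4 $ k * matrix_inv (G x) $ k $ l)"
      by (simp add: matrix_matrix_mult_def)
    also have "\<dots> = matrix_inv (G x) $ 4 $ l"
      using collar_metric_nth(2)[of _ _ 1] collar_metric_nth(2)[of _ _ 2] collar_metric_nth(2)[of _ _ 3]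
      by (simp add: sum_4 G[OF xS] collar_metric_nth(4) emb_simps)
    also have "G x ** matrix_inv (G x) = mat 1"
      unfolding Gx by (rule pos_def_matrix_inv) (rule pos_M)
    finally show ?thesis by (auto simp: mat_def)
  qed
  have chr: "christoffel S G x 4 (emb i) (emb j) = d / 2 * gB c p $ i $ j" for i j
    unfolding christoffel_def by (simp add: inv4 mixed normal if_distrib[of "\<lambda>x. x * _"] cong: if_cong)
  have inv_B: "gB c p ** matrix_inv (gB c p) = mat 1"
    by (rule pos_def_matrix_inv) (rule pos_B)
  have diag: "(\<Sum>j\<in>UNIV. gB c p $ i $ j * matrix_inv (gB c p) $ j $ i) = 1" for i
  proof -
    have "(\<Sum>j\<in>UNIV. gB c p $ i $ j * matrix_inv (gB c p) $ j $ i) = (gB c p ** matrix_inv (gB c p)) $ i $ i"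
      by (simp add: matrix_matrix_mult_def)
    also have "\<dots> = 1"
      by (simp only: inv_B) (simp add: mat_def)
    finally show ?thesis .
  qed
  have sym: "gB c p $ i $ j = gB c p $ j $ i" for i j
    using arg_cong[OF sym_B, of "\<lambda>M. M $ j $ i"] by (simp add: transpose_def)
  \<comment> \<open>Symmetry of the metric turns the full contraction into the trace of the matrix
    times its inverse; this is the 3 in \<open>- 3 / 2 * d\<close>.\<close>
  have "(\<Sum>i\<in>UNIV. \<Sum>j\<in>UNIV. gB c p $ i $ j * matrix_inv (gB c p) $ i $ j) =
      (\<Sum>j\<in>UNIV. \<Sum>i\<in>UNIV. gB c p $ i $ j * matrix_inv (gB c p) $ i $ j)"
    by (rule sum.swap)
  also have "\<dots> = (\<Sum>j\<in>UNIV. \<Sum>i\<in>UNIV. gB c p $ j $ i * matrix_inv (gB c p) $ i $ j)"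
    by (intro sum.cong refl arg_cong2[of _ _ _ _ "(*)"] sym)
  also have "\<dots> = 3"
    by (simp only: diag) simp
  finally have "(\<Sum>i\<in>UNIV. \<Sum>j\<in>UNIV. gB c p $ i $ j * matrix_inv (gB c p) $ i $ j) = 3" .
  moreover have "extrinsic_K gM gB c' c p = - (d / 2) * (\<Sum>i\<in>UNIV. \<Sum>j\<in>UNIV. gB c p $ i $ j * matrix_inv (gB c p) $ i $ j)"
    unfolding extrinsic_K_def S_def[symmetric] G_def[symmetric] x chr
    by (simp add: sum_distrib_left mult.assoc)
  ultimately show ?thesis by (simp add: c'_def)
qed

section \<open>Integrals over the line and the sphere\<close>

text \<open>Nonnegativity makes integrability a consequence of the finite limits of the
  antiderivative.\<close>

lemma has_bochner_integral_FTC_real_line: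
  fixes f F :: "real \<Rightarrow> real"
  assumes "\<And>x. (F has_real_derivative f x) (at x)" "\<And>x. isCont f x" "\<And>x. f x \<ge> 0"
    and "(F \<longlongrightarrow> A) at_bot" "(F \<longlongrightarrow> B) at_top"
  shows "has_bochner_integral lborel f (B - A)"
proof -
  have 1: "((F \<circ> real_of_ereal) \<longlongrightarrow> A) (at_right (-\<infinity>))" "((F \<circ> real_of_ereal) \<longlongrightarrow> B) (at_left \<infinity>)"
    using assms(4,5) by (simp_all add: ereal_tendsto_simps)
  have "set_integrable lborel (einterval (-\<infinity>) \<infinity>) f" "(LBINT x=-\<infinity>..\<infinity>. f x) = B - A"
    using interval_integral_FTC_nonneg[of "-\<infinity>" \<infinity> F f, OF _ _ _ _ 1] assms(1-3) by auto
  moreover have "einterval (-\<infinity>) \<infinity> = UNIV" by (auto simp: einterval_def)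
  ultimately show ?thesis
    by (simp add: has_bochner_integral_iff set_integrable_def interval_lebesgue_integral_def
        set_lebesgue_integral_def)
qed

lemma one_plus_square_neq_0: "1 + x\<^sup>2 \<noteq> (0::real)"
  by (metis add_pos_nonneg less_irrefl zero_le_power2 zero_less_one)

text \<open>With \<open>y = 1 + x^2\<close>, the derivative of \<open>x / y^n\<close> is
  \<open>2 n / y^(n+1) - (2 n - 1) / y^n\<close>. Keeping the numerator in terms of \<open>y\<close>
  reduces the later checks to rational identities in \<open>y\<close>.\<close>

lemma has_real_derivative_div_one_plus_square:
  "((\<lambda>x. x / (1 + x\<^sup>2)) has_real_derivative (2 - (1 + x\<^sup>2)) / (1 + x\<^sup>2) ^ 2) (at x)"
proof (rule DERIV_cong)
  show "((\<lambda>x. x / (1 + x\<^sup>2)) has_real_derivative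
      (1 * (1 + x\<^sup>2) - x * (2 * x)) / ((1 + x\<^sup>2) * (1 + x\<^sup>2))) (at x)"
    by (rule DERIV_divide) (auto intro!: derivative_eq_intros simp: one_plus_square_neq_0)
qed (simp add: power2_eq_square)

lemma has_real_derivative_div_one_plus_square_power2:
  "((\<lambda>x. x / (1 + x\<^sup>2) ^ 2) has_real_derivative (4 - 3 * (1 + x\<^sup>2)) / (1 + x\<^sup>2) ^ 3) (at x)"
proof (rule DERIV_cong)
  show "((\<lambda>x. x / (1 + x\<^sup>2) ^ 2) has_real_derivative
      (1 * (1 + x\<^sup>2) ^ 2 - x * (4 * x * (1 + x\<^sup>2))) / ((1 + x\<^sup>2) ^ 2 * (1 + x\<^sup>2) ^ 2)) (at x)"
    by (rule DERIV_divide) (auto intro!: derivative_eq_intros simp: one_plus_square_neq_0)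
  have "1 * (1 + x\<^sup>2) ^ 2 - x * (4 * x * (1 + x\<^sup>2)) = (1 + x\<^sup>2) * (4 - 3 * (1 + x\<^sup>2))" by algebra
  moreover have "(1 + x\<^sup>2) ^ 2 * (1 + x\<^sup>2) ^ 2 = (1 + x\<^sup>2) * (1 + x\<^sup>2) ^ 3" by algebra
  ultimately show "(1 * (1 + x\<^sup>2) ^ 2 - x * (4 * x * (1 + x\<^sup>2))) / ((1 + x\<^sup>2) ^ 2 * (1 + x\<^sup>2) ^ 2) =
      (4 - 3 * (1 + x\<^sup>2)) / (1 + x\<^sup>2) ^ 3"
    by (simp only: mult_divide_mult_cancel_left[OF one_plus_square_neq_0])
qed

lemma has_bochner_integral_inverse_square:
  "has_bochner_integral lborel (\<lambda>x::real. 1 / (1 + x\<^sup>2) ^ 2) (pi / 2)"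
proof -
  let ?F = "\<lambda>x::real. 1 / 2 * (x / (1 + x\<^sup>2)) + 1 / 2 * arctan x"
  have "has_bochner_integral lborel (\<lambda>x::real. 1 / (1 + x\<^sup>2) ^ 2) (pi / 4 - (- (pi / 4)))"
  proof (rule has_bochner_integral_FTC_real_line)
    fix x :: real
    have "(?F has_real_derivative 1 / 2 * ((2 - (1 + x\<^sup>2)) / (1 + x\<^sup>2) ^ 2) + 1 / 2 * inverse (1 + x\<^sup>2)) (at x)"
      by (intro DERIV_add DERIV_cmult has_real_derivative_div_one_plus_square DERIV_arctan)
    then show "(?F has_real_derivative 1 / (1 + x\<^sup>2) ^ 2) (at x)"
    proof (rule DERIV_cong)
      have "1 / 2 * ((2 - y) / y ^ 2) + 1 / 2 * inverse y = 1 / y ^ 2" if "y \<noteq> 0" for y :: real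
      using that by (simp add: field_simps power2_eq_square)
      from this[OF one_plus_square_neq_0] show "1 / 2 * ((2 - (1 + x\<^sup>2)) / (1 + x\<^sup>2) ^ 2) + 1 / 2 * inverse (1 + x\<^sup>2) = 1 / (1 + x\<^sup>2) ^ 2"
        .
    qed
    show "isCont (\<lambda>x. 1 / (1 + x\<^sup>2) ^ 2) x"
      by (intro continuous_intros) (simp add: one_plus_square_neq_0)
  next
    show "(?F \<longlongrightarrow> - (pi / 4)) at_bot" by real_asymp
    show "(?F \<longlongrightarrow> pi / 4) at_top" by real_asymp
  qed auto
  then show ?thesis by simp
qed

lemma has_bochner_integral_inverse_cube:
  "has_bochner_integral lborel (\<lambda>x::real. 1 / (1 + x\<^sup>2) ^ 3) (3 * pi / 8)"
proof -
  \<comment> \<open>Solving the recursion for the top power at \<open>n = 2\<close> and then at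
    \<open>n = 1\<close> gives the coefficients \<open>1/4\<close>, \<open>3/4 * 1/2\<close> and
    \<open>3/4 * 1/2\<close>.\<close>
  let ?F = "\<lambda>x::real. 1 / 4 * (x / (1 + x\<^sup>2) ^ 2) + 3 / 8 * (x / (1 + x\<^sup>2)) + 3 / 8 * arctan x"
  have "has_bochner_integral lborel (\<lambda>x::real. 1 / (1 + x\<^sup>2) ^ 3) (3 * pi / 16 - (- (3 * pi / 16)))"
  proof (rule has_bochner_integral_FTC_real_line)
    fix x :: real
    have "(?F has_real_derivative 1 / 4 * ((4 - 3 * (1 + x\<^sup>2)) / (1 + x\<^sup>2) ^ 3) +
        3 / 8 * ((2 - (1 + x\<^sup>2)) / (1 + x\<^sup>2) ^ 2) + 3 / 8 * inverse (1 + x\<^sup>2)) (at x)"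
      by (intro DERIV_add DERIV_cmult has_real_derivative_div_one_plus_square
          has_real_derivative_div_one_plus_square_power2 DERIV_arctan)
    then show "(?F has_real_derivative 1 / (1 + x\<^sup>2) ^ 3) (at x)"
    proof (rule DERIV_cong)
      have "1 / 4 * ((4 - 3 * y) / y ^ 3) + 3 / 8 * ((2 - y) / y ^ 2) + 3 / 8 * inverse y = 1 / y ^ 3"
      if "y \<noteq> 0" for y :: real
      using that by (simp add: field_simps power2_eq_square power3_eq_cube)
      from this[OF one_plus_square_neq_0] show "1 / 4 * ((4 - 3 * (1 + x\<^sup>2)) / (1 + x\<^sup>2) ^ 3) + 3 / 8 * ((2 - (1 + x\<^sup>2)) / (1 + x\<^sup>2) ^ 2) + 3 / 8 * inverse (1 + x\<^sup>2) = 1 / (1 + x\<^sup>2) ^ 3"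
        .
    qed
    show "isCont (\<lambda>x. 1 / (1 + x\<^sup>2) ^ 3) x"
      by (intro continuous_intros) (simp add: one_plus_square_neq_0)
  next
    show "(?F \<longlongrightarrow> - (3 * pi / 16)) at_bot" by real_asymp
    show "(?F \<longlongrightarrow> 3 * pi / 16) at_top" by real_asymp
  qed auto
  then show ?thesis by simp
qed

text \<open>The bound \<open>|x| \<le> 1 + x^2\<close> gives integrability, and the substitution of
  \<open>-x\<close> for \<open>x\<close> shows that the integral equals its own negative.\<close>

lemma has_bochner_integral_odd_cube:
  "has_bochner_integral lborel (\<lambda>x::real. x / (1 + x\<^sup>2) ^ 3) 0"
proof -
  let ?f = "\<lambda>x::real. x / (1 + x\<^sup>2) ^ 3"
  have "integrable lborel ?f"
  proof (rule Bochner_Integration.integrable_bound)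
    show "integrable lborel (\<lambda>x::real. 1 / (1 + x\<^sup>2) ^ 2)"
      using has_bochner_integral_inverse_square by (simp only: has_bochner_integral_iff)
    have "norm (?f x) \<le> norm (1 / (1 + x\<^sup>2) ^ 2)" for x :: real
    proof -
      have "0 \<le> (\<bar>x\<bar> - 1)\<^sup>2" by simp
      then have "\<bar>x\<bar> \<le> 1 + x\<^sup>2"
        by (simp add: power2_eq_square algebra_simps)
      then have "\<bar>x\<bar> / (1 + x\<^sup>2) ^ 3 \<le> (1 + x\<^sup>2) / (1 + x\<^sup>2) ^ 3"
        by (intro divide_right_mono) auto
      also have "\<dots> = 1 / (1 + x\<^sup>2) ^ 2"
        using one_plus_square_neq_0[of x] by (simp add: power3_eq_cube power2_eq_square)
      finally show ?thesis by simp
    qed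
    then show "AE x in lborel. norm (?f x) \<le> norm (1 / (1 + x\<^sup>2) ^ 2)" by simp
  qed simp
  moreover have "integral\<^sup>L lborel ?f = - integral\<^sup>L lborel ?f"
    by (subst lborel_integral_real_affine[of "-1" ?f 0]) simp_all
  ultimately show ?thesis by (simp add: has_bochner_integral_iff)
qed

lemma has_bochner_integral_complex_of_real:
  "has_bochner_integral M f x \<Longrightarrow> has_bochner_integral M (\<lambda>t. complex_of_real (f t)) (complex_of_real x)"
  by (simp add: has_bochner_integral_iff)

lemma integral_res11:
  "(LINT t|lborel. (complex_of_real t - \<i>) / (1 + (complex_of_real t)\<^sup>2) ^ 3) = - \<i> * of_real (3 * pi / 8)"
proof -
  have "has_bochner_integral lborel (\<lambda>t. complex_of_real (t / (1 + t\<^sup>2) ^ 3) - \<i> * complex_of_real (1 / (1 + t\<^sup>2) ^ 3))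
     (complex_of_real 0 - \<i> * of_real (3 * pi / 8))"
    by (intro has_bochner_integral_diff has_bochner_integral_mult_right has_bochner_integral_complex_of_real
        has_bochner_integral_odd_cube has_bochner_integral_inverse_cube)
  then show ?thesis
    by (auto simp: diff_divide_distrib dest!: has_bochner_integral_integral_eq)
qed

lemma integral_res21:
  "(LINT t|lborel. 4 * (complex_of_real t + \<i>) / (1 + (complex_of_real t)\<^sup>2) ^ 3 + 6 * \<i> / (1 + (complex_of_real t)\<^sup>2) ^ 2) =
    \<i> * of_real (9 * pi / 2)"
proof -
  have "has_bochner_integral lborel (\<lambda>t. 4 * complex_of_real (t / (1 + t\<^sup>2) ^ 3) +
      4 * \<i> * complex_of_real (1 / (1 + t\<^sup>2) ^ 3) + 6 * \<i> * complex_of_real (1 / (1 + t\<^sup>2) ^ 2))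
     (4 * complex_of_real 0 + 4 * \<i> * of_real (3 * pi / 8) + 6 * \<i> * of_real (pi / 2))"
    by (intro has_bochner_integral_add has_bochner_integral_mult_right has_bochner_integral_complex_of_real
        has_bochner_integral_odd_cube has_bochner_integral_inverse_cube has_bochner_integral_inverse_square)
  then show ?thesis
    by (auto simp: add_divide_distrib distrib_left dest!: has_bochner_integral_integral_eq)
qed

section \<open>Spherical coordinates on the cosphere\<close>

lemma sph_eq: "sph \<theta> \<phi> = (sin \<theta> * cos \<phi>) *\<^sub>R axis 1 1 + (sin \<theta> * sin \<phi>) *\<^sub>R axis 2 1 + cos \<theta> *\<^sub>R axis 3 1"
  by (simp add: sph_def vec_eq_iff forall_3 axis_def)

lemma norm_sph: "norm (sph \<theta> \<phi>) = 1"
proof -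
  have "sph \<theta> \<phi> \<bullet> sph \<theta> \<phi> = (sin \<theta>)\<^sup>2 * ((sin \<phi>)\<^sup>2 + (cos \<phi>)\<^sup>2) + (cos \<theta>)\<^sup>2"
    unfolding inner_vec_def sum_3 sph_def vector_3 inner_real_def by algebra
  then show ?thesis by (simp add: norm_eq_1)
qed

text \<open>The determinant of the spherical parametrisation is \<open>sin \<theta>\<close>, which
  integrates to the area \<open>4 pi\<close>. Only constants on the unit sphere occur, since the
  traces depend on \<xi>' through its norm alone.\<close>

lemma sphere_integral_const:
  assumes "\<And>\<xi>. norm \<xi> = 1 \<Longrightarrow> f \<xi> = \<kappa>"
  shows "sphere_integral f = of_real (4 * pi) * \<kappa>"
proof -
  have d1: "vector_derivative (\<lambda>a. sph a \<phi>) (at \<theta>) = vector [cos \<theta> * cos \<phi>, cos \<theta> * sin \<phi>, - sin \<theta>]" for \<theta> \<phi>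
    unfolding sph_eq
    by (rule vector_derivative_at) (auto intro!: derivative_eq_intros simp: vec_eq_iff forall_3 axis_def)
  have d2: "vector_derivative (\<lambda>a. sph \<theta> a) (at \<phi>) = vector [- sin \<theta> * sin \<phi>, sin \<theta> * cos \<phi>, 0]" for \<theta> \<phi>
    unfolding sph_eq
    by (rule vector_derivative_at) (auto intro!: derivative_eq_intros simp: vec_eq_iff forall_3 axis_def)
  have det: "det (vector [sph \<theta> \<phi>, vector_derivative (\<lambda>a. sph a \<phi>) (at \<theta>),
                           vector_derivative (\<lambda>a. sph \<theta> a) (at \<phi>)] :: real ^ 3 ^ 3) = sin \<theta>" for \<theta> \<phi>
  proof -
    have "det (vector [sph \<theta> \<phi>, vector_derivative (\<lambda>a. sph a \<phi>) (at \<theta>),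
                           vector_derivative (\<lambda>a. sph \<theta> a) (at \<phi>)] :: real ^ 3 ^ 3) =
       sin \<theta> * ((sin \<theta>)\<^sup>2 + (cos \<theta>)\<^sup>2) * ((cos \<phi>)\<^sup>2 + (sin \<phi>)\<^sup>2)"
      unfolding d1 d2 unfolding det_3 sph_def vector_3 by algebra
    then show ?thesis by simp
  qed
  have "sphere_integral f = (LINT \<theta>:{0..pi}|lborel. LINT \<phi>:{0..2*pi}|lborel. of_real (sin \<theta>) * \<kappa>)"
    unfolding sphere_integral_def det by (simp add: assms norm_sph)
  also have "\<dots> = (LINT \<theta>:{0..pi}|lborel. complex_of_real (sin \<theta>) * (2 * pi * \<kappa>))"
    by (simp add: set_lebesgue_integral_def scaleR_conv_of_real mult_ac)
  also have "\<dots> = (LINT \<theta>:{0..pi}|lborel. complex_of_real (sin \<theta>)) * (2 * pi * \<kappa>)"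
    by simp
  also have "(LINT \<theta>:{0..pi}|lborel. complex_of_real (sin \<theta>)) = of_real (LINT \<theta>:{0..pi}|lborel. sin \<theta>)"
    by (rule set_integral_complex_of_real)
  also have "(LINT \<theta>:{0..pi}|lborel. sin \<theta>) = (- cos pi) - (- cos 0)"
    unfolding set_lebesgue_integral_def
    by (simp only: real_scaleR_def mult.commute[of "indicator _ _"], rule integral_FTC_Icc_real)
      (auto intro!: derivative_eq_intros continuous_intros)
  finally show ?thesis by simp
qed

section \<open>Residue densities of a flat collar\<close>

lemma collar_metric_vector_mult: "collar_metric f g *v v = join (f *\<^sub>R (g *v tang v)) (v $ 4)"
proof -
  have tang: "tang (v + w) = tang v + tang w" "tang (r *\<^sub>R v) = r *\<^sub>R tang v" for v w r
    using linear_add[OF bounded_linear.linear[OF bounded_linear_tang]]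
      linear_scale[OF bounded_linear.linear[OF bounded_linear_tang]] by auto
  have "linear (\<lambda>v. join (f *\<^sub>R (g *v tang v)) (v $ 4))"
    unfolding linear_iff tang
    by (simp add: vec_eq_iff forall_4 join_nth matrix_vector_right_distrib matrix_vector_mult_scaleR algebra_simps)
  then show ?thesis
    by (simp add: collar_metric_def matrix_works)
qed

lemma collar_metric_mult: "collar_metric f (mat 1) ** collar_metric f' (mat 1) = collar_metric (f * f') (mat 1)"
  unfolding matrix_eq matrix_vector_mul_assoc[symmetric] collar_metric_vector_mult
  by (simp add: join_nth)

lemma collar_metric_1: "collar_metric 1 (mat 1) = mat 1"
  unfolding matrix_eq collar_metric_vector_mult by (simp add: join_tang)

lemma matrix_inv_collar_metric: "H \<noteq> 0 \<Longrightarrow> matrix_inv (collar_metric (1 / H) (mat 1)) = collar_metric H (mat 1)"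
  by (rule matrix_inv_eqI) (simp_all add: collar_metric_mult collar_metric_1)

lemma linear_ext_mult: "linear ext_mult"
  by (simp add: linear_iff ext_mult_def scaleR_add_left sum.distrib scaleR_sum_right)

lemma linear_int_vec: "linear int_vec"
  by (simp add: linear_iff int_vec_def scaleR_add_left sum.distrib scaleR_sum_right)

abbreviation dxn :: "real ^ 4" where "dxn \<equiv> axis 4 1"

lemma join_eq: "join v s = join v 0 + s *\<^sub>R dxn" "join (r *\<^sub>R v) 0 = r *\<^sub>R join v 0"
  by (simp_all add: vec_eq_iff forall_4 join_nth axis_def)

lemma inner_join: "join v s \<bullet> join w r = v \<bullet> w + s * r" "join v s \<bullet> dxn = s" "dxn \<bullet> join v s = s" "dxn \<bullet> dxn = 1"
  by (simp_all add: inner_vec_def sum_4 sum_3 join_nth axis_def)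

lemma has_vector_derivative_cmul:
  "(f has_vector_derivative f') F \<Longrightarrow> ((\<lambda>t. cmul (f t) M) has_vector_derivative cmul f' M) F"
proof -
  have "bounded_linear (\<lambda>z. cmul z M)"
    unfolding linear_conv_bounded_linear[symmetric]
    by (simp add: linear_iff cmul_add_left scaleR_eq_cmul scaleR_conv_of_real)
  then show "(f has_vector_derivative f') F \<Longrightarrow> ?thesis"
    by (rule bounded_linear.has_vector_derivative)
qed

text \<open>Raising the index multiplies only the tangential part by \<open>H\<close>, and only
  interior multiplication raises an index. All dependence on position is thus concentrated in one
  scalar factor.\<close>

lemma cliff_collar_metric:
  assumes "H \<noteq> 0"
  shows "cliff (collar_metric (1 / H) (mat 1)) (join v \<eta>) =
    ext_mult (join v 0) - H *\<^sub>R int_vec (join v 0) + \<eta> *\<^sub>R cl dxn"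
proof -
  have "cliff (collar_metric (1 / H) (mat 1)) (join v \<eta>) = ext_mult (join v \<eta>) - int_vec (join (H *\<^sub>R v) \<eta>)"
    using assms by (simp add: cliff_def int_mult_eq_int_vec matrix_inv_collar_metric collar_metric_vector_mult join_nth)
  also have "\<dots> = ext_mult (join v 0) - H *\<^sub>R int_vec (join v 0) + \<eta> *\<^sub>R cl dxn"
    unfolding join_eq(1)[of _ \<eta>] join_eq(2) cl_eq
    by (simp add: linear_add[OF linear_ext_mult] linear_scale[OF linear_ext_mult]
        linear_add[OF linear_int_vec] linear_scale[OF linear_int_vec] scaleR_diff_right)
  finally show ?thesis .
qed

text \<open>For a unit tangential covector the squared length of \<xi> is
  \<open>H + \<eta>\<^sup>2\<close>. The leading symbol squares to this number, so its inverse is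
  the symbol divided by it.\<close>

lemma inv_symb1_collar_metric:
  assumes "G y = collar_metric (1 / H) (mat 1)" "H > 0" "norm v = 1"
  shows "inv_symb1 (sig_p1 G) y (join v \<eta>) = cmul (\<i> / of_real (H + \<eta>\<^sup>2))
     (ext_mult (join v 0) - H *\<^sub>R int_vec (join v 0) + \<eta> *\<^sub>R cl dxn)"
proof -
  define C where "C = cliff (collar_metric (1 / H) (mat 1)) (join v \<eta>)"
  have N: "H + \<eta>\<^sup>2 > 0" using assms(2) by (simp add: add_pos_nonneg)
  have "v \<bullet> v = 1" using assms(3) by (simp add: norm_eq_1)
  then have "join v \<eta> \<bullet> (matrix_inv (collar_metric (1 / H) (mat 1)) *v join v \<eta>) = H + \<eta>\<^sup>2"
    using assms(2) by (simp add: matrix_inv_collar_metric collar_metric_vector_mult inner_join join_nth power2_eq_square)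
  then have C2: "C ** C = - (H + \<eta>\<^sup>2) *\<^sub>R mat 1"
    unfolding C_def by (simp add: cliff_square)
  have s: "sig_p1 G y (join v \<eta>) = cmul \<i> C"
    by (simp add: sig_p1_def assms(1) C_def mat_mult_eq_cmul)
  define n where "n = H + \<eta>\<^sup>2"
  have "n \<noteq> 0" using N by (simp add: n_def)
  then have "cmul (\<i> * (\<i> / complex_of_real n)) (C ** C) = mat 1"
    unfolding C2 n_def[symmetric] scaleR_eq_cmul by simp
  then have "inv_symb1 (sig_p1 G) y (join v \<eta>) = cmul (\<i> / of_real (H + \<eta>\<^sup>2)) C"
    unfolding inv_symb1_def s n_def[symmetric] by (intro matrix_inv_eqI) (simp_all add: mult.commute)
  then show ?thesis
    using assms(2) by (simp add: C_def cliff_collar_metric)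
qed

text \<open>Two simple poles: the numerator of the positive part is the residue at
  \<open>\<i> * \<alpha>\<close>.\<close>

lemma pi_plus_rel_inverse_quadratic:
  assumes "\<alpha> > 0"
  shows "pi_plus_rel (\<lambda>t. \<i> / of_real (\<alpha>\<^sup>2 + t\<^sup>2) * (P + of_real t * R))
    (\<lambda>t. (P / (2 * of_real \<alpha>) + \<i> * R / 2) / (of_real t - \<i> * of_real \<alpha>))"
proof -
  let ?k = "P / (2 * complex_of_real \<alpha>) + \<i> * R / 2" and ?m = "- P / (2 * complex_of_real \<alpha>) + \<i> * R / 2"
  have "pi_plus_rel (\<lambda>t. ?k / (of_real t - \<i> * of_real \<alpha>) ^ 1 + ?m / (of_real t - (- \<i> * of_real \<alpha>)) ^ 1)
     (\<lambda>t. ?k / (of_real t - \<i> * of_real \<alpha>) ^ 1 + 0)"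
    using assms by (intro pi_plus_rel_add pi_plus_rel_upper_pole pi_plus_rel_lower_pole) auto
  moreover have "?k / (of_real t - \<i> * of_real \<alpha>) ^ 1 + ?m / (of_real t - (- \<i> * of_real \<alpha>)) ^ 1 =
      \<i> / of_real (\<alpha>\<^sup>2 + t\<^sup>2) * (P + of_real t * R)" for t
  proof -
    define z where "z = complex_of_real t"
    define a where "a = complex_of_real \<alpha>"
    have a: "a \<noteq> 0" using assms by (simp add: a_def)
    have "Im (z - \<i> * a) \<noteq> 0" "Im (z + \<i> * a) \<noteq> 0"
      using assms by (simp_all add: z_def a_def)
    then have nz: "z - \<i> * a \<noteq> 0" "z + \<i> * a \<noteq> 0" by (metis zero_complex.sel(2))+
    have e: "(z - \<i> * a) * (z + \<i> * a) = a\<^sup>2 + z\<^sup>2"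
      by (simp add: algebra_simps power2_eq_square)
    have "(P / (2 * a) + \<i> * R / 2) / (z - \<i> * a) + (- P / (2 * a) + \<i> * R / 2) / (z + \<i> * a) =
       ((P / (2 * a) + \<i> * R / 2) * (z + \<i> * a) + (- P / (2 * a) + \<i> * R / 2) * (z - \<i> * a)) / (a\<^sup>2 + z\<^sup>2)"
      using nz by (simp add: add_frac_eq e)
    also have "(P / (2 * a) + \<i> * R / 2) * (z + \<i> * a) + (- P / (2 * a) + \<i> * R / 2) * (z - \<i> * a) = \<i> * (P + z * R)"
    proof -
      define Q where "Q = P / (2 * a)"
      define r where "r = R / 2"
      have PR: "P = 2 * a * Q" "R = 2 * r" using a by (simp_all add: Q_def r_def)
      have "(Q + \<i> * r) * (z + \<i> * a) + (- Q + \<i> * r) * (z - \<i> * a) = \<i> * (2 * a * Q + z * (2 * r))"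
        by algebra
      then show ?thesis using a by (simp add: PR)
    qed
    finally show ?thesis by (simp add: z_def a_def)
  qed
  ultimately show ?thesis by (simp only: power_one_right add_0_right)
qed

text \<open>The data of the local computation at a boundary point. \<open>N\<close> is open, hence
  reaches to both sides of the boundary and makes derivatives there ordinary ones; \<open>S\<close>
  is kept apart because the connection form and the symbol of order -2 differentiate within a whole
  chart image.\<close>

locale flat_collar =
  fixes S N :: "(real ^ 4) set" and G :: "real ^ 4 \<Rightarrow> real ^ 4 ^ 4" and hh :: "real \<Rightarrow> real"
    and d :: real and x' :: "real ^ 3"
  assumes N: "open N" "N \<subseteq> S" "join x' 0 \<in> N"
    and G: "\<And>y. y \<in> N \<Longrightarrow> G y = collar_metric (1 / hh (y $ 4)) (mat 1)"
    and hh_pos: "\<And>y. y \<in> N \<Longrightarrow> hh (y $ 4) > 0"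
    and hh_0: "hh 0 = 1" and hh_deriv: "(hh has_real_derivative d) (at 0)"
begin

abbreviation "x0 \<equiv> join x' 0"

lemma G_x0: "G x0 = mat 1"
  using G[OF N(3)] by (simp add: join_nth hh_0 collar_metric_1)

lemma symb1:
  assumes "y \<in> N" "norm v = 1"
  shows "inv_symb1 (sig_p1 G) y (join v \<eta>) = cmul (\<i> / of_real (hh (y $ 4) + \<eta>\<^sup>2))
     (ext_mult (join v 0) - hh (y $ 4) *\<^sub>R int_vec (join v 0) + \<eta> *\<^sub>R cl dxn)"
  by (rule inv_symb1_collar_metric[where G = G and H = "hh (y $ 4)", OF G[OF assms(1)] hh_pos[OF assms(1)] assms(2)])

lemma symb1_x0:
  assumes "norm v = 1"
  shows "inv_symb1 (sig_p1 G) x0 (join v \<eta>) =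
    (1 / (1 + \<eta>\<^sup>2)) *\<^sub>R cmul \<i> (cl (join v 0)) + (\<eta> / (1 + \<eta>\<^sup>2)) *\<^sub>R cmul \<i> (cl dxn)"
proof -
  have "ext_mult (join v 0) - 1 *\<^sub>R int_vec (join v 0) = cl (join v 0)"
    by (simp add: cl_eq)
  then show ?thesis
    unfolding symb1[OF N(3) assms] join_nth hh_0
    by (simp add: scaleR_eq_cmul cmul_distrib mult.commute)
qed

lemma eventually_N: "\<forall>\<^sub>F s in nhds 0. join x' s \<in> N"
proof -
  have "isCont (\<lambda>s. join x' 0 + s *\<^sub>R dxn) 0"
    by (intro continuous_intros)
  moreover have "(\<lambda>s. join x' 0 + s *\<^sub>R dxn) = join x'"
    by (rule ext) (rule join_eq(1)[symmetric])
  ultimately have "(join x' \<longlongrightarrow> join x' 0) (nhds 0)"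
    by (simp only: continuous_at tendsto_nhds_iff)
  then show ?thesis
    using N(1,3) by (rule topological_tendstoD)
qed

text \<open>The pole \<open>\<i> * sqrt (hh s)\<close> moves with \<open>s\<close>, so the positive
  part is computed for every \<open>s\<close> near 0 before the normal derivative is taken.\<close>

lemma pi_plus_symb1:
  assumes "join x' s \<in> N" "norm v = 1"
  shows "pi_plus_mat (\<lambda>\<eta>. inv_symb1 (sig_p1 G) (join x' s) (join v \<eta>)) \<tau> =
    cmul (1 / (2 * of_real (sqrt (hh s)) * (of_real \<tau> - \<i> * of_real (sqrt (hh s))))) (ext_mult (join v 0)) +
    cmul (- of_real (sqrt (hh s)) / (2 * (of_real \<tau> - \<i> * of_real (sqrt (hh s))))) (int_vec (join v 0)) +
    cmul (\<i> / (2 * (of_real \<tau> - \<i> * of_real (sqrt (hh s))))) (cl dxn)"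
proof -
  define \<alpha> where "\<alpha> = sqrt (hh s)"
  have "hh s > 0" using hh_pos[OF assms(1)] by (simp add: join_nth)
  then have \<alpha>: "\<alpha> > 0" "hh s = \<alpha>\<^sup>2" by (simp_all add: \<alpha>_def)
  define P where "P = (\<lambda>I J. ext_mult (join v 0) $ I $ J - of_real (\<alpha>\<^sup>2) * int_vec (join v 0) $ I $ J)"
  have "pi_plus (\<lambda>\<eta>. inv_symb1 (sig_p1 G) (join x' s) (join v \<eta>) $ I $ J) =
     (\<lambda>t. (P I J / (2 * of_real \<alpha>) + \<i> * cl dxn $ I $ J / 2) / (of_real t - \<i> * of_real \<alpha>))" for I J
  proof (rule pi_plus_eq)
    have "(\<lambda>\<eta>. inv_symb1 (sig_p1 G) (join x' s) (join v \<eta>) $ I $ J) =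
        (\<lambda>t. \<i> / of_real (\<alpha>\<^sup>2 + t\<^sup>2) * (P I J + of_real t * cl dxn $ I $ J))"
      unfolding symb1[OF assms] by (simp add: join_nth \<alpha>(2) scaleR_eq_cmul P_def)
    then show "pi_plus_rel (\<lambda>\<eta>. inv_symb1 (sig_p1 G) (join x' s) (join v \<eta>) $ I $ J)
       (\<lambda>t. (P I J / (2 * of_real \<alpha>) + \<i> * cl dxn $ I $ J / 2) / (of_real t - \<i> * of_real \<alpha>))"
      using pi_plus_rel_inverse_quadratic[OF \<alpha>(1)] by simp
  qed
  note entries = this
  define w where "w = of_real \<tau> - \<i> * complex_of_real \<alpha>"
  have "Im w \<noteq> 0" using \<alpha>(1) by (simp add: w_def)
  then have w: "w \<noteq> 0" by (metis zero_complex.sel(2))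
  have ident: "((p - of_real (\<alpha>\<^sup>2) * q) / (2 * complex_of_real \<alpha>) + \<i> * r / 2) / w =
     1 / (2 * of_real \<alpha> * w) * p + - of_real \<alpha> / (2 * w) * q + \<i> / (2 * w) * r" for p q r
    using \<alpha>(1) w by (simp add: field_simps power2_eq_square)
  show ?thesis
    unfolding \<alpha>_def[symmetric] vec_eq_iff
    by (simp only: pi_plus_mat_def vec_lambda_beta entries P_def w_def[symmetric] ident vector_add_component cmul_nth)
      simp
qed

lemma sqrt_hh_deriv: "((\<lambda>s. complex_of_real (sqrt (hh s))) has_vector_derivative of_real (d / 2)) (at 0)"
proof -
  have "((\<lambda>s. sqrt (hh s)) has_real_derivative d / 2) (at 0)"
    using hh_deriv by (auto intro!: derivative_eq_intros simp: hh_0)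
  then show ?thesis
    by (intro has_vector_derivative_of_real) (simp add: has_real_derivative_iff_has_vector_derivative)
qed

text \<open>All coefficients depend on \<open>s\<close> only through
  \<open>A s = sqrt (hh s)\<close>, with \<open>A 0 = 1\<close> and derivative \<open>d / 2\<close>.
  The chain rule therefore gives \<open>d / 2\<close> times complex derivatives at 1.\<close>

lemma pi_plus_symb1_deriv:
  assumes "norm v = 1"
  shows "vector_derivative (\<lambda>s. pi_plus_mat (\<lambda>\<eta>. inv_symb1 (sig_p1 G) (join x' s) (join v \<eta>)) \<tau>) (at 0) =
    cmul (of_real (d / 2) * (- (of_real \<tau> - 2 * \<i>) / (2 * (of_real \<tau> - \<i>) ^ 2))) (ext_mult (join v 0)) +
    cmul (of_real (d / 2) * (- of_real \<tau> / (2 * (of_real \<tau> - \<i>) ^ 2))) (int_vec (join v 0)) +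
    cmul (of_real (d / 2) * (- 1 / (2 * (of_real \<tau> - \<i>) ^ 2))) (cl dxn)" (is "_ = ?D")
proof -
  define A where "A = (\<lambda>s. complex_of_real (sqrt (hh s)))"
  have A: "(A has_vector_derivative of_real (d / 2)) (at 0)" "A 0 = 1"
    using sqrt_hh_deriv by (simp_all add: A_def hh_0)
  have "Im (of_real \<tau> - \<i>) \<noteq> 0" by simp
  then have w: "of_real \<tau> - \<i> \<noteq> 0" by force
  have half: "2 * a / (2 * w * (2 * w)) = a / (2 * w ^ 2)" for a w :: complex
    by (simp add: power2_eq_square)
  have 1: "((\<lambda>z. 1 / (2 * z * (of_real \<tau> - \<i> * z))) has_field_derivative
      - (of_real \<tau> - 2 * \<i>) / (2 * (of_real \<tau> - \<i>) ^ 2)) (at (A 0))"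
    unfolding A(2) half[symmetric]
    by (rule DERIV_cong, rule DERIV_divide[where D = 0 and E = "2 * of_real \<tau> - 4 * \<i>"])
      (use w in \<open>auto intro!: derivative_eq_intros simp: algebra_simps\<close>)
  have 2: "((\<lambda>z. - z / (2 * (of_real \<tau> - \<i> * z))) has_field_derivative
      - of_real \<tau> / (2 * (of_real \<tau> - \<i>) ^ 2)) (at (A 0))"
    unfolding A(2) half[symmetric]
    by (rule DERIV_cong, rule DERIV_divide[where D = "-1" and E = "- 2 * \<i>"])
      (use w in \<open>auto intro!: derivative_eq_intros simp: algebra_simps\<close>)
  have 3: "((\<lambda>z. \<i> / (2 * (of_real \<tau> - \<i> * z))) has_field_derivative
      - 1 / (2 * (of_real \<tau> - \<i>) ^ 2)) (at (A 0))"
    unfolding A(2) half[symmetric]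
    by (rule DERIV_cong, rule DERIV_divide[where D = 0 and E = "- 2 * \<i>"])
      (use w in \<open>auto intro!: derivative_eq_intros simp: algebra_simps\<close>)
  have D: "((\<lambda>s. cmul (1 / (2 * A s * (of_real \<tau> - \<i> * A s))) (ext_mult (join v 0)) +
    cmul (- A s / (2 * (of_real \<tau> - \<i> * A s))) (int_vec (join v 0)) +
    cmul (\<i> / (2 * (of_real \<tau> - \<i> * A s))) (cl dxn)) has_vector_derivative ?D) (at 0)"
    by (intro has_vector_derivative_add has_vector_derivative_cmul
        field_vector_diff_chain_at[OF A(1) 1, unfolded o_def] field_vector_diff_chain_at[OF A(1) 2, unfolded o_def]
        field_vector_diff_chain_at[OF A(1) 3, unfolded o_def])
  \<comment> \<open>The explicit formula is valid for \<open>s\<close> of both signs, as the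
    two-sided \<open>vector_derivative\<close> at 0 requires; negative \<open>s\<close> lies in the
    extension.\<close>
  obtain U where U: "open U" "0 \<in> U" "\<And>s. s \<in> U \<Longrightarrow> join x' s \<in> N"
    using eventually_N by (auto simp: eventually_nhds)
  show ?thesis
  proof (rule vector_derivative_at, rule has_vector_derivative_transform_within_open[OF D U(1,2)])
    fix s assume "s \<in> U"
    from pi_plus_symb1[OF U(3)[OF this] assms, of \<tau>]
    show "cmul (1 / (2 * A s * (of_real \<tau> - \<i> * A s))) (ext_mult (join v 0)) +
      cmul (- A s / (2 * (of_real \<tau> - \<i> * A s))) (int_vec (join v 0)) +
      cmul (\<i> / (2 * (of_real \<tau> - \<i> * A s))) (cl dxn) =
      pi_plus_mat (\<lambda>\<eta>. inv_symb1 (sig_p1 G) (join x' s) (join v \<eta>)) \<tau>"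
      by (simp add: A_def)
  qed
qed

section \<open>Covector derivatives of the leading symbol at the boundary\<close>

lemma symb1_x0_deriv:
  assumes "norm v = 1"
  shows "vector_derivative (\<lambda>\<eta>. inv_symb1 (sig_p1 G) x0 (join v \<eta>)) (at \<tau>) =
    (- 2 * \<tau> / (1 + \<tau>\<^sup>2) ^ 2) *\<^sub>R cmul \<i> (cl (join v 0)) + ((1 - \<tau>\<^sup>2) / (1 + \<tau>\<^sup>2) ^ 2) *\<^sub>R cmul \<i> (cl dxn)"
  unfolding symb1_x0[OF assms]
proof (rule vector_derivative_at)
  have 1: "((\<lambda>\<eta>. 1 / (1 + \<eta>\<^sup>2)) has_real_derivative - 2 * \<tau> / (1 + \<tau>\<^sup>2) ^ 2) (at \<tau>)"
    using one_plus_square_neq_0[of \<tau>] by (auto intro!: derivative_eq_intros simp: power2_eq_square)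
  have 2: "((\<lambda>\<eta>. \<eta> / (1 + \<eta>\<^sup>2)) has_real_derivative (1 - \<tau>\<^sup>2) / (1 + \<tau>\<^sup>2) ^ 2) (at \<tau>)"
    using has_real_derivative_div_one_plus_square[of \<tau>] by simp
  show "((\<lambda>\<eta>. (1 / (1 + \<eta>\<^sup>2)) *\<^sub>R cmul \<i> (cl (join v 0)) + (\<eta> / (1 + \<eta>\<^sup>2)) *\<^sub>R cmul \<i> (cl dxn)) has_vector_derivative
    (- 2 * \<tau> / (1 + \<tau>\<^sup>2) ^ 2) *\<^sub>R cmul \<i> (cl (join v 0)) + ((1 - \<tau>\<^sup>2) / (1 + \<tau>\<^sup>2) ^ 2) *\<^sub>R cmul \<i> (cl dxn)) (at \<tau>)"
    using has_vector_derivative_scaleR[OF 1 has_vector_derivative_const[of "cmul \<i> (cl (join v 0))"]]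
      has_vector_derivative_scaleR[OF 2 has_vector_derivative_const[of "cmul \<i> (cl dxn)"]]
    by (intro has_vector_derivative_add) simp_all
qed

lemma symb1_x0_deriv2:
  assumes "norm v = 1"
  shows "vector_derivative (\<lambda>\<zeta>. vector_derivative (\<lambda>\<eta>. inv_symb1 (sig_p1 G) x0 (join v \<eta>)) (at \<zeta>)) (at \<tau>) =
    ((6 * \<tau>\<^sup>2 - 2) / (1 + \<tau>\<^sup>2) ^ 3) *\<^sub>R cmul \<i> (cl (join v 0)) +
    ((2 * \<tau> ^ 3 - 6 * \<tau>) / (1 + \<tau>\<^sup>2) ^ 3) *\<^sub>R cmul \<i> (cl dxn)"
  unfolding symb1_x0_deriv[OF assms]
proof (rule vector_derivative_at)
  have n: "(1 + \<tau>\<^sup>2) ^ 2 \<noteq> 0" using one_plus_square_neq_0[of \<tau>] by simp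
  have cancel: "(1 + \<tau>\<^sup>2) * a / ((1 + \<tau>\<^sup>2) ^ 2 * (1 + \<tau>\<^sup>2) ^ 2) = a / (1 + \<tau>\<^sup>2) ^ 3" for a
  proof -
    have "(1 + \<tau>\<^sup>2) ^ 2 * (1 + \<tau>\<^sup>2) ^ 2 = (1 + \<tau>\<^sup>2) * (1 + \<tau>\<^sup>2) ^ 3" by algebra
    then show ?thesis by (simp only: mult_divide_mult_cancel_left[OF one_plus_square_neq_0])
  qed
  have p: "((\<lambda>\<eta>. (1 + \<eta>\<^sup>2) ^ 2) has_real_derivative 4 * \<tau> * (1 + \<tau>\<^sup>2)) (at \<tau>)"
    by (auto intro!: derivative_eq_intros)
  have 1: "((\<lambda>\<eta>. - 2 * \<eta> / (1 + \<eta>\<^sup>2) ^ 2) has_real_derivative (6 * \<tau>\<^sup>2 - 2) / (1 + \<tau>\<^sup>2) ^ 3) (at \<tau>)"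
  proof (rule DERIV_cong[OF DERIV_divide[OF _ p n]])
    show "((\<lambda>\<eta>. - 2 * \<eta>) has_real_derivative - 2) (at \<tau>)"
      by (auto intro!: derivative_eq_intros)
    have "- 2 * (1 + \<tau>\<^sup>2)\<^sup>2 - - 2 * \<tau> * (4 * \<tau> * (1 + \<tau>\<^sup>2)) = (1 + \<tau>\<^sup>2) * (6 * \<tau>\<^sup>2 - 2)" by algebra
    then show "(- 2 * (1 + \<tau>\<^sup>2)\<^sup>2 - - 2 * \<tau> * (4 * \<tau> * (1 + \<tau>\<^sup>2))) / ((1 + \<tau>\<^sup>2)\<^sup>2 * (1 + \<tau>\<^sup>2)\<^sup>2) =
        (6 * \<tau>\<^sup>2 - 2) / (1 + \<tau>\<^sup>2) ^ 3"
      by (simp only: cancel)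
  qed
  have 2: "((\<lambda>\<eta>. (1 - \<eta>\<^sup>2) / (1 + \<eta>\<^sup>2) ^ 2) has_real_derivative (2 * \<tau> ^ 3 - 6 * \<tau>) / (1 + \<tau>\<^sup>2) ^ 3) (at \<tau>)"
  proof (rule DERIV_cong[OF DERIV_divide[OF _ p n]])
    show "((\<lambda>\<eta>. 1 - \<eta>\<^sup>2) has_real_derivative - 2 * \<tau>) (at \<tau>)"
      by (auto intro!: derivative_eq_intros)
    have "- 2 * \<tau> * (1 + \<tau>\<^sup>2)\<^sup>2 - (1 - \<tau>\<^sup>2) * (4 * \<tau> * (1 + \<tau>\<^sup>2)) = (1 + \<tau>\<^sup>2) * (2 * \<tau> ^ 3 - 6 * \<tau>)" by algebra
    then show "(- 2 * \<tau> * (1 + \<tau>\<^sup>2)\<^sup>2 - (1 - \<tau>\<^sup>2) * (4 * \<tau> * (1 + \<tau>\<^sup>2))) / ((1 + \<tau>\<^sup>2)\<^sup>2 * (1 + \<tau>\<^sup>2)\<^sup>2) =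
        (2 * \<tau> ^ 3 - 6 * \<tau>) / (1 + \<tau>\<^sup>2) ^ 3"
      by (simp only: cancel)
  qed
  show "((\<lambda>\<zeta>. (- 2 * \<zeta> / (1 + \<zeta>\<^sup>2) ^ 2) *\<^sub>R cmul \<i> (cl (join v 0)) + ((1 - \<zeta>\<^sup>2) / (1 + \<zeta>\<^sup>2) ^ 2) *\<^sub>R cmul \<i> (cl dxn))
    has_vector_derivative ((6 * \<tau>\<^sup>2 - 2) / (1 + \<tau>\<^sup>2) ^ 3) *\<^sub>R cmul \<i> (cl (join v 0)) +
    ((2 * \<tau> ^ 3 - 6 * \<tau>) / (1 + \<tau>\<^sup>2) ^ 3) *\<^sub>R cmul \<i> (cl dxn)) (at \<tau>)"
    using has_vector_derivative_scaleR[OF 1 has_vector_derivative_const[of "cmul \<i> (cl (join v 0))"]]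
      has_vector_derivative_scaleR[OF 2 has_vector_derivative_const[of "cmul \<i> (cl dxn)"]]
    by (intro has_vector_derivative_add) simp_all
qed

end

lemma emb_eq_iff: "emb i = emb j \<longleftrightarrow> i = j"
  using exhaust_3[of i] exhaust_3[of j] by (auto simp: emb_simps)

lemma collar_metric_mat1_nth:
  "collar_metric f (mat 1) $ j $ l = (if j = l then if j = 4 then 1 else f else 0)"
proof -
  consider "j = 4" "l = 4" | i where "j = 4" "l = emb i" | i where "j = emb i" "l = 4"
    | i k where "j = emb i" "l = emb k"
    using exhaust_emb[of j] exhaust_emb[of l] by blast
  then show ?thesis
    by cases (simp_all add: collar_metric_nth emb_neq_4 emb_eq_iff mat_def)
qed

lemma cl_join: "cl (join v \<eta>) = cl (join v 0) + \<eta> *\<^sub>R cl dxn"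
  using cliff_collar_metric[of 1 v \<eta>] by (simp add: collar_metric_1 cl_eq)

lemma linear_cl: "linear cl"
  using linear_compose_sub[OF linear_ext_mult linear_int_vec] by (simp add: cl_eq[abs_def])

lemma trace_ext_cl: "trace (ext_mult a ** cl b) = of_real (- 8 * (a \<bullet> b))"
proof -
  have "ext_mult a = cl a + int_vec a" by (simp add: cl_eq)
  then show ?thesis
    by (simp add: form_mat.add_left trace_add trace_cl_cl trace_int_cl)
qed

text \<open>The shape of the entries of the symbol of order -2. The bound on \<open>k\<close> puts
  the degree 2 of the numerator below the degree \<open>2 k\<close> of the denominator.\<close>

lemma ex_pi_plus_rel_quadratic:
  assumes "2 \<le> k"
  shows "\<exists>u. pi_plus_rel (\<lambda>t. of_real (1 / (1 + t\<^sup>2) ^ k) * (m\<^sub>0 + of_real t * m\<^sub>1 + of_real (t\<^sup>2) * m\<^sub>2)) u"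
proof -
  have deg: "degree [:m\<^sub>0, m\<^sub>1, m\<^sub>2:] < degree ([:- \<i>, 1:] ^ k * [:\<i>, 1:] ^ k)"
    using assms by (simp add: degree_mult_eq degree_power_eq)
  have "\<exists>u. pi_plus_rel (\<lambda>t. poly [:m\<^sub>0, m\<^sub>1, m\<^sub>2:] (of_real t) / poly ([:- \<i>, 1:] ^ k * [:\<i>, 1:] ^ k) (of_real t)) u"
    by (rule pi_plus_rel_exists[OF deg]) (use assms in \<open>auto simp: degree_power_eq i_plus_eq_0\<close>)
  moreover have "poly [:m\<^sub>0, m\<^sub>1, m\<^sub>2:] (of_real t) / poly ([:- \<i>, 1:] ^ k * [:\<i>, 1:] ^ k) (of_real t) =
      of_real (1 / (1 + t\<^sup>2) ^ k) * (m\<^sub>0 + of_real t * m\<^sub>1 + of_real (t\<^sup>2) * m\<^sub>2)" for t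
  proof -
    have "(- \<i> + of_real t) * (\<i> + of_real t) = complex_of_real (1 + t\<^sup>2)"
      by (simp add: algebra_simps power2_eq_square)
    moreover have "poly ([:- \<i>, 1:] ^ k * [:\<i>, 1:] ^ k) (of_real t) = ((- \<i> + of_real t) * (\<i> + of_real t)) ^ k"
      by (simp add: power_mult_distrib)
    ultimately have "poly ([:- \<i>, 1:] ^ k * [:\<i>, 1:] ^ k) (of_real t) = complex_of_real ((1 + t\<^sup>2) ^ k)"
      by (simp only: of_real_power)
    moreover have "poly [:m\<^sub>0, m\<^sub>1, m\<^sub>2:] (of_real t) = m\<^sub>0 + of_real t * m\<^sub>1 + of_real (t\<^sup>2) * m\<^sub>2"
      by (simp add: power2_eq_square algebra_simps)
    ultimately show ?thesis
      by (simp only: of_real_inverse of_real_1 divide_inverse mult_1_left mult.commute)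
  qed
  ultimately show ?thesis by simp
qed

lemma sum_axis: "(\<Sum>i\<in>UNIV. axis k 1 $ i * f i) = (f k :: real)"
  by (simp add: axis_def if_distrib[of "\<lambda>x. x * _"] cong: if_cong)

lemma sum_axis_axis: "(\<Sum>i\<in>UNIV. \<Sum>j\<in>UNIV. f i j * axis k 1 $ i * axis l 1 $ j) = (f k l :: real)"
  by (simp add: axis_def if_distrib[of "\<lambda>x. _ * x"] cong: if_cong)

context flat_collar
begin

lemma trace_res11:
  assumes "norm v = 1"
  shows "trace (vector_derivative (\<lambda>s. pi_plus_mat (\<lambda>\<eta>. inv_symb1 (sig_p1 G) (join x' s) (join v \<eta>)) \<tau>) (at 0) **
     vector_derivative (\<lambda>\<zeta>. vector_derivative (\<lambda>\<eta>. inv_symb1 (sig_p1 G) x0 (join v \<eta>)) (at \<zeta>)) (at \<tau>)) =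
    of_real d * 8 * \<i> * ((of_real \<tau> - \<i>) / (1 + (of_real \<tau>)\<^sup>2) ^ 3)"
proof -
  define t where "t = complex_of_real \<tau>"
  define w where "w = t - \<i>"
  define n where "n = (1 + t\<^sup>2) ^ 3"
  define q where "q = inverse (2 * w ^ 2)"
  define D where "D = complex_of_real (d / 2)"
  define X where "X = 6 * t ^ 2 - 2"
  define Y where "Y = 2 * t ^ 3 - 6 * t"
  have "Im w \<noteq> 0" by (simp add: w_def t_def)
  then have w: "w \<noteq> 0" by (metis zero_complex.sel(2))
  have v: "v \<bullet> v = 1" using assms by (simp add: norm_eq_1)
  \<comment> \<open>Tangential and normal covectors are orthogonal, so mixed pairings vanish; -8, 8
    and -16 are the traces of exterior, interior and Clifford multiplication against
    \<open>cl\<close>.\<close>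
  have expand: "trace ((cmul x (ext_mult (join v 0)) + cmul y (int_vec (join v 0)) + cmul z (cl dxn)) **
      (r *\<^sub>R cmul \<i> (cl (join v 0)) + s *\<^sub>R cmul \<i> (cl dxn))) =
      \<i> * (- 8 * x * of_real r + 8 * y * of_real r - 16 * z * of_real s)" for x y z r s
    by (simp add: form_mat.add_left form_mat.add_right trace_add scaleR_eq_cmul
        trace_cl_cl trace_int_cl trace_ext_cl inner_join v algebra_simps)
  have rs: "complex_of_real ((6 * \<tau>\<^sup>2 - 2) / (1 + \<tau>\<^sup>2) ^ 3) = X * inverse n"
    "complex_of_real ((2 * \<tau> ^ 3 - 6 * \<tau>) / (1 + \<tau>\<^sup>2) ^ 3) = Y * inverse n"
    by (simp_all add: X_def Y_def n_def t_def divide_inverse)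
  have key: "\<i> * (- 8 * (D * (- (t - 2 * \<i>) * q)) * (X * m) + 8 * (D * (- t * q)) * (X * m)
      - 16 * (D * (- 1 * q)) * (Y * m)) = 16 * \<i> * D * q * m * (Y - \<i> * X)" for m
    by (simp add: algebra_simps)
  \<comment> \<open>The numerators combine to twice the cube of \<open>w\<close>, which absorbs the
    double pole in \<open>q\<close> and leaves a single factor \<open>w\<close>.\<close>
  have XY: "Y - \<i> * X = 2 * w ^ 3"
    unfolding X_def Y_def w_def power2_eq_square power3_eq_cube by (simp add: algebra_simps)
  have q: "q * (2 * w ^ 3) = w"
    using w by (simp add: q_def field_simps power2_eq_square power3_eq_cube)
  have "16 * \<i> * D * q * inverse n * (2 * w ^ 3) = 16 * \<i> * D * inverse n * (q * (2 * w ^ 3))"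
    by (simp only: mult.assoc mult.left_commute[of q])
  also have "\<dots> = of_real d * 8 * \<i> * (w / n)"
  proof -
    have "2 * D = of_real d" by (simp add: D_def)
    moreover have "16 * \<i> * D * m * w = (2 * D) * 8 * \<i> * (w * m)" for m
      by algebra
    ultimately show ?thesis unfolding q divide_inverse by simp
  qed
  finally show ?thesis
    unfolding pi_plus_symb1_deriv[OF assms] symb1_x0_deriv2[OF assms] expand rs
      D_def[symmetric] t_def[symmetric] w_def[symmetric] n_def[symmetric]
    by (simp only: divide_inverse[of _ "2 * w\<^sup>2"] q_def[symmetric] key XY)
qed

text \<open>Each direction contributes \<open>3 pi d\<close> to the line integral; the area
  \<open>4 pi\<close> and the prefactor \<open>-1/2\<close> give the constant.\<close>

lemma res11_value:
  "res11 (inv_symb1 (sig_p1 G)) (inv_symb1 (sig_p1 G)) x' = of_real (- 6 * pi\<^sup>2 * d)"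
proof -
  have "sphere_integral (\<lambda>\<xi>'. LINT \<tau>|lborel. trace (
     vector_derivative (\<lambda>s. pi_plus_mat (\<lambda>\<eta>. inv_symb1 (sig_p1 G) (join x' s) (join \<xi>' \<eta>)) \<tau>) (at 0) **
     vector_derivative (\<lambda>\<zeta>. vector_derivative (\<lambda>\<eta>. inv_symb1 (sig_p1 G) (join x' 0) (join \<xi>' \<eta>)) (at \<zeta>)) (at \<tau>)))
     = of_real (4 * pi) * of_real (3 * pi * d)"
  proof (rule sphere_integral_const)
    fix v :: "real ^ 3" assume v: "norm v = 1"
    have "(LINT \<tau>|lborel. of_real d * 8 * \<i> * ((complex_of_real \<tau> - \<i>) / (1 + (of_real \<tau>)\<^sup>2) ^ 3)) =
       of_real d * 8 * \<i> * (- \<i> * of_real (3 * pi / 8))"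
      unfolding integral_mult_right_zero integral_res11 ..
    then show "(LINT \<tau>|lborel. trace (
     vector_derivative (\<lambda>s. pi_plus_mat (\<lambda>\<eta>. inv_symb1 (sig_p1 G) (join x' s) (join v \<eta>)) \<tau>) (at 0) **
     vector_derivative (\<lambda>\<zeta>. vector_derivative (\<lambda>\<eta>. inv_symb1 (sig_p1 G) (join x' 0) (join v \<eta>)) (at \<zeta>)) (at \<tau>)))
      = of_real (3 * pi * d)"
      unfolding trace_res11[OF v] by simp
  qed
  then show ?thesis
    unfolding res11_def by (simp add: power2_eq_square)
qed

text \<open>The point is interior to \<open>S\<close>, so the derivative within \<open>S\<close> is
  the ordinary one, and a function of height alone varies only in direction 4.\<close>

lemma pderiv_within_N:
  fixes f :: "real ^ 4 \<Rightarrow> 'b::real_normed_vector"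
  assumes f: "\<And>y. y \<in> N \<Longrightarrow> f y = \<phi> (y $ 4)" and \<phi>: "(\<phi> has_vector_derivative \<phi>') (at 0)"
  shows "pderiv_within S j f x0 = (if j = 4 then \<phi>' else 0)"
proof -
  have "x0 \<in> interior S"
    using N interior_maximal by blast
  then have at: "at x0 within S = at x0"
    by (rule at_within_interior)
  have "(\<phi> has_derivative (\<lambda>t. t *\<^sub>R \<phi>')) (at (x0 $ 4))"
    using \<phi> by (simp add: has_vector_derivative_def join_nth)
  moreover have "((\<lambda>y. y $ 4) has_derivative (\<lambda>v. v $ 4)) (at x0)"
    by (rule bounded_linear_imp_has_derivative[OF bounded_linear_vec_nth])
  ultimately have "(\<phi> \<circ> (\<lambda>y. y $ 4) has_derivative (\<lambda>t. t *\<^sub>R \<phi>') \<circ> (\<lambda>v. v $ 4)) (at x0)"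
    by (rule diff_chain_at[rotated])
  then have "(f has_derivative (\<lambda>t. t *\<^sub>R \<phi>') \<circ> (\<lambda>v. v $ 4)) (at x0)"
    by (rule has_derivative_transform_within_open[OF _ N(1,3)]) (simp add: f)
  then have "frechet_derivative f (at x0) = (\<lambda>t. t *\<^sub>R \<phi>') \<circ> (\<lambda>v. v $ 4)"
    by (rule frechet_derivative_at[symmetric])
  then show ?thesis
    unfolding pderiv_within_def at by (simp add: axis_def)
qed

section \<open>First derivatives of metric and frame, and the symbol of order 0\<close>

lemma pderiv_metric:
  "pderiv_within S i (\<lambda>y. G y $ j $ l) x0 = (if i = 4 \<and> j = l \<and> j \<noteq> 4 then - d else 0)"
proof -
  have "((\<lambda>s. 1 / hh s) has_real_derivative - d) (at 0)"
    using hh_deriv by (auto intro!: derivative_eq_intros simp: hh_0)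
  then have "((\<lambda>s. if j = l then if j = 4 then 1 else 1 / hh s else 0) has_vector_derivative
      (if j = l \<and> j \<noteq> 4 then - d else 0)) (at 0)"
    by (cases "j = l"; cases "l = 4"; simp flip: has_real_derivative_iff_has_vector_derivative)
  from pderiv_within_N[OF _ this, of "\<lambda>y. G y $ j $ l" i] show ?thesis
    by (auto simp: G collar_metric_mat1_nth)
qed

lemma pderiv_frame:
  "pderiv_within S i (\<lambda>y. collar_frame hh t y $ k) x0 = (if i = 4 \<and> k = t \<and> t \<noteq> 4 then d / 2 else 0)"
proof -
  have "((\<lambda>s. sqrt (hh s)) has_real_derivative d / 2) (at 0)"
    using hh_deriv by (auto intro!: derivative_eq_intros simp: hh_0)
  then have "((\<lambda>s. if k = t then if t = 4 then 1 else sqrt (hh s) else 0) has_vector_derivative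
      (if k = t \<and> t \<noteq> 4 then d / 2 else 0)) (at 0)"
    by (cases "k = t"; cases "t = 4"; simp flip: has_real_derivative_iff_has_vector_derivative)
  from pderiv_within_N[OF _ this, of "\<lambda>y. collar_frame hh t y $ k" i] show ?thesis
    by (auto simp: collar_frame_def axis_def)
qed

lemma frame_x0: "collar_frame hh i x0 = axis i 1"
  by (simp add: collar_frame_def join_nth hh_0)

text \<open>For \<open>i = 4\<close> and \<open>s = t\<close> tangential, the derivative
  \<open>d / 2\<close> of the frame cancels the Christoffel symbol \<open>- d / 2\<close>. What
  remains is the second fundamental form, antisymmetric in \<open>s\<close> and
  \<open>t\<close>.\<close>

lemma conn_form_x0:
  "conn_form S G (collar_frame hh) x0 s t i =
     (if i \<noteq> 4 \<and> s = 4 \<and> i = t then d / 2 else 0) - (if i \<noteq> 4 \<and> t = 4 \<and> i = s then d / 2 else 0)"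
proof -
  have chr: "christoffel S G x0 k i j = (1 / 2) *
      ((if i = 4 \<and> j = k \<and> j \<noteq> 4 then - d else 0) + (if j = 4 \<and> i = k \<and> i \<noteq> 4 then - d else 0)
       - (if k = 4 \<and> i = j \<and> i \<noteq> 4 then - d else 0))" for k i j
    unfolding christoffel_def G_x0 pderiv_metric matrix_inv_mat1
    by (simp add: mat_def if_distrib[of "\<lambda>x. x * _"] cong: if_cong)
  have "conn_form S G (collar_frame hh) x0 s t i =
      (if i = 4 \<and> s = t \<and> t \<noteq> 4 then d / 2 else 0) + christoffel S G x0 s i t"
    unfolding conn_form_def G_x0 frame_x0 matrix_vector_mul_lid cov_deriv_def pderiv_frame
      inner_axis' vec_lambda_beta sum_axis sum_axis_axis by simp
  then show ?thesis unfolding chr by auto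
qed

text \<open>The only information about the order 0 part that enters the residue. The
  \<open>clb\<close> terms contribute only for \<open>s = t\<close>, where the connection form
  vanishes. Each of the three tangential directions contributes \<open>8 * d * \<beta> $ 4\<close>
  twice, and the factor \<open>1 / 4\<close> turns 48 into 12.\<close>

lemma trace_p0_cl:
  "trace (sig_p0 S G (collar_frame hh) x0 \<xi> ** cl \<beta>) = of_real (12 * d * \<beta> $ 4)"
proof -
  have 1: "trace (cl (axis i 1) ** (clb (axis s 1) ** clb (axis t 1) - cl (axis s 1) ** cl (axis t 1)) ** cl \<beta>) =
    of_real (- 16 * ((if s = t then 2 * \<beta> $ i else 0) + (if i = s then \<beta> $ t else 0) - (if i = t then \<beta> $ s else 0)))" for i s t
  proof -
    have "trace (cl (axis i 1) ** (clb (axis s 1) ** clb (axis t 1)) ** cl \<beta>) =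
        trace (clb (axis s 1) ** clb (axis t 1) ** cl \<beta> ** cl (axis i 1))"
      by (simp only: matrix_mul_assoc[symmetric] trace_mul_sym[of "cl (axis i 1)"])
    also have "\<dots> = of_real (- 16 * (if s = t then \<beta> $ i else 0))"
      unfolding trace_clb_clb_cl_cl inner_axis by (simp add: axis_def)
    finally have 2: "trace (cl (axis i 1) ** (clb (axis s 1) ** clb (axis t 1)) ** cl \<beta>) =
        of_real (- 16 * (if s = t then \<beta> $ i else 0))" .
    have 3: "trace (cl (axis i 1) ** (cl (axis s 1) ** cl (axis t 1)) ** cl \<beta>) =
        of_real (16 * ((if i = s then \<beta> $ t else 0) - (if i = t then \<beta> $ s else 0) + (if s = t then \<beta> $ i else 0)))"
      unfolding matrix_mul_assoc trace_cl4 inner_axis inner_axis'[of _ _ \<beta>] by (simp add: axis_def)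
    show ?thesis
      by (simp only: form_mat.diff_left form_mat.diff_right trace_sub 2 3) (simp add: algebra_simps)
  qed
  have "trace (sig_p0 S G (collar_frame hh) x0 \<xi> ** cl \<beta>) = (1 / 4) *
     (\<Sum>i\<in>UNIV. \<Sum>s\<in>UNIV. \<Sum>t\<in>UNIV. of_real (conn_form S G (collar_frame hh) x0 s t i) *
       trace (cl (axis i 1) ** (clb (axis s 1) ** clb (axis t 1) - cl (axis s 1) ** cl (axis t 1)) ** cl \<beta>))"
    unfolding sig_p0_def Let_def G_x0 frame_x0 matrix_vector_mul_lid
    by (simp add: form_mat.scaleR_left form_mat.sum_left trace_form_mat_sum)
  also have "\<dots> = of_real (12 * d * \<beta> $ 4)"
    unfolding 1 conn_form_x0 sum_4 by (simp add: algebra_simps)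
  finally show ?thesis .
qed

end

section \<open>The symbol of order -2 and its positive part\<close>

lemma ex_pi_plus_rel_add:
  "\<exists>u. pi_plus_rel f u \<Longrightarrow> \<exists>u. pi_plus_rel f' u \<Longrightarrow> \<exists>u. pi_plus_rel (\<lambda>t. f t + f' t) u"
  by (blast intro: pi_plus_rel_add)

lemma ex_pi_plus_rel_mult_left: "\<exists>u. pi_plus_rel f u \<Longrightarrow> \<exists>u. pi_plus_rel (\<lambda>t. k * f t) u"
  by (blast intro: pi_plus_rel_mult_left)

lemma linear_cmul_cl: "linear (\<lambda>\<xi>. cmul \<i> (cl \<xi>))"
  using linear_cl by (simp add: linear_iff cmul_distrib scaleR_eq_cmul mult.commute)

lemma sandwich_quadratic:
  fixes A B M :: form_mat
  shows "((A + t *\<^sub>R B) ** M ** (A + t *\<^sub>R B)) $ I $ J =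
    (A ** M ** A) $ I $ J + of_real t * (A ** M ** B + B ** M ** A) $ I $ J + of_real (t\<^sup>2) * (B ** M ** B) $ I $ J"
  by (simp add: form_mat.add_left form_mat.add_right scaleR_eq_cmul power2_eq_square algebra_simps)

context flat_collar
begin

abbreviation "p0 \<xi> \<equiv> sig_p0 S G (collar_frame hh) x0 \<xi>"

lemma symb1_x0_eq:
  assumes "norm v = 1"
  shows "inv_symb1 (sig_p1 G) x0 (join v \<eta>) = cmul (\<i> / of_real (1 + \<eta>\<^sup>2)) (cl (join v \<eta>))"
  unfolding symb1_x0[OF assms] cl_join[of v \<eta>]
  by (simp add: scaleR_eq_cmul cmul_distrib mult.commute)

text \<open>The first term comes from differentiating the squared length of \<xi>, the second from
  the interior part of c(\<xi>). The remaining exterior part is regrouped as \<open>cl\<close> plus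
  \<open>int_vec\<close>, so that a full Clifford factor appears.\<close>

lemma pderiv_symb1:
  assumes "norm v = 1"
  shows "pderiv_within S j (\<lambda>y. inv_symb1 (sig_p1 G) y (join v \<eta>)) x0 =
    (if j = 4 then cmul (- \<i> * of_real (d / (1 + \<eta>\<^sup>2) ^ 2)) (cl (join v \<eta>)) +
       cmul (- \<i> * of_real (d / (1 + \<eta>\<^sup>2))) (int_vec (join v 0)) else 0)"
proof -
  let ?E = "cmul \<i> (ext_mult (join v 0) + \<eta> *\<^sub>R cl dxn)" and ?I = "cmul \<i> (int_vec (join v 0))"
  let ?\<phi> = "\<lambda>s. (1 / (hh s + \<eta>\<^sup>2)) *\<^sub>R ?E - (hh s / (hh s + \<eta>\<^sup>2)) *\<^sub>R ?I"
  define n where "n = 1 + \<eta>\<^sup>2"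
  have n: "n \<noteq> 0" unfolding n_def by (rule one_plus_square_neq_0)
  have n0: "hh 0 + \<eta>\<^sup>2 = n" by (simp add: n_def hh_0)
  have 0: "((\<lambda>s. hh s + \<eta>\<^sup>2) has_real_derivative d) (at 0)"
    using hh_deriv by (auto intro!: derivative_eq_intros)
  have 1: "((\<lambda>s. 1 / (hh s + \<eta>\<^sup>2)) has_real_derivative - d / n\<^sup>2) (at 0)"
    by (rule DERIV_cong[OF DERIV_divide[OF DERIV_const 0, unfolded n0]]) (simp_all add: n power2_eq_square)
  have 2: "((\<lambda>s. hh s / (hh s + \<eta>\<^sup>2)) has_real_derivative (d * n - d) / n\<^sup>2) (at 0)"
    by (rule DERIV_cong[OF DERIV_divide[OF hh_deriv 0, unfolded n0, unfolded hh_0]])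
      (simp_all add: n power2_eq_square)
  have \<phi>: "(?\<phi> has_vector_derivative (- d / n\<^sup>2) *\<^sub>R ?E - ((d * n - d) / n\<^sup>2) *\<^sub>R ?I) (at 0)"
    using has_vector_derivative_scaleR[OF 1 has_vector_derivative_const[of ?E]]
      has_vector_derivative_scaleR[OF 2 has_vector_derivative_const[of ?I]]
    by (intro has_vector_derivative_diff) simp_all
  have "inv_symb1 (sig_p1 G) y (join v \<eta>) = ?\<phi> (y $ 4)" if "y \<in> N" for y
    unfolding symb1[OF that assms]
    by (simp add: scaleR_eq_cmul cmul_distrib mult.commute algebra_simps)
  from pderiv_within_N[OF this \<phi>, of j]
  have "pderiv_within S j (\<lambda>y. inv_symb1 (sig_p1 G) y (join v \<eta>)) x0 =
    (if j = 4 then (- d / n\<^sup>2) *\<^sub>R ?E - ((d * n - d) / n\<^sup>2) *\<^sub>R ?I else 0)" .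
  moreover have "(- d / n\<^sup>2) *\<^sub>R ?E - ((d * n - d) / n\<^sup>2) *\<^sub>R ?I =
     cmul (- \<i> * of_real (d / n\<^sup>2)) (cl (join v \<eta>)) + cmul (- \<i> * of_real (d / n)) (int_vec (join v 0))"
  proof -
    have E: "ext_mult (join v 0) + \<eta> *\<^sub>R cl dxn = cl (join v \<eta>) + int_vec (join v 0)"
      unfolding cl_join[of v \<eta>] cl_eq[of "join v 0"] by simp
    have coeff: "(d * n - d) / n\<^sup>2 = d / n - d / n\<^sup>2" "- d / n\<^sup>2 = - (d / n\<^sup>2)"
      using n by (simp_all add: diff_divide_distrib power2_eq_square)
    have "(- a) *\<^sub>R cmul \<i> (P + Q) - (b - a) *\<^sub>R cmul \<i> Q =
        cmul (- \<i> * of_real a) P + cmul (- \<i> * of_real b) Q" for a b P Q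
      by (simp add: scaleR_eq_cmul cmul_distrib vec_eq_iff algebra_simps)
    then show ?thesis unfolding E coeff .
  qed
  ultimately show ?thesis by (simp only: n_def)
qed

text \<open>In the composition formula \<open>p\<^sub>1\<close> is linear in \<xi>, so its
  derivative in \<open>\<xi>\<^sub>j\<close> is \<open>\<i>\<close> times
  \<open>cl (axis j 1)\<close>, and only the normal position derivative is nonzero. The outer
  inverse supplies the common left factor \<open>cl (join v \<eta>)\<close>.\<close>

lemma symb2:
  assumes "norm v = 1"
  shows "inv_symb2 S (sig_p1 G) (sig_p0 S G (collar_frame hh)) x0 (join v \<eta>) =
    cmul (of_real (1 / (1 + \<eta>\<^sup>2) ^ 2)) (cl (join v \<eta>) ** p0 (join v \<eta>) ** cl (join v \<eta>)) +
    cmul (of_real (- d / (1 + \<eta>\<^sup>2) ^ 3)) (cl (join v \<eta>) ** cl dxn ** cl (join v \<eta>)) +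
    cmul (of_real (- d / (1 + \<eta>\<^sup>2) ^ 2)) (cl (join v \<eta>) ** cl dxn ** int_vec (join v 0))"
proof -
  have lin: "pderiv_within UNIV j (sig_p1 G x0) \<xi> = cmul \<i> (cl (axis j 1))" for j \<xi>
  proof -
    have "sig_p1 G x0 = (\<lambda>\<xi>. cmul \<i> (cl \<xi>))"
      by (simp add: sig_p1_def G_x0 mat_mult_eq_cmul fun_eq_iff)
    moreover have "bounded_linear (\<lambda>\<xi>. cmul \<i> (cl \<xi>))"
      using linear_cmul_cl by (simp add: linear_conv_bounded_linear)
    then have "frechet_derivative (\<lambda>\<xi>. cmul \<i> (cl \<xi>)) (at \<xi>) = (\<lambda>\<xi>. cmul \<i> (cl \<xi>))"
      by (rule frechet_derivative_at[OF bounded_linear_imp_has_derivative, symmetric])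
    ultimately show ?thesis by (simp add: pderiv_within_def)
  qed
  define c where "c = cl (join v \<eta>)"
  define m where "m = complex_of_real (1 + \<eta>\<^sup>2)"
  have sum: "(\<Sum>j\<in>UNIV. pderiv_within UNIV j (sig_p1 G x0) (join v \<eta>) **
         (mat (- \<i>) ** pderiv_within S j (\<lambda>y. inv_symb1 (sig_p1 G) y (join v \<eta>)) x0)) =
     cmul (- \<i> * of_real d / m ^ 2) (cl dxn ** c) + cmul (- \<i> * of_real d / m) (cl dxn ** int_vec (join v 0))"
    unfolding lin pderiv_symb1[OF assms(1)] mat_mult_eq_cmul
    by (simp add: sum_4 cmul_distrib form_mat.add_right m_def c_def)
  have i: "\<i> * x * \<i> = - x" for x :: complex
    by (simp add: mult.commute)
  show ?thesis
    unfolding inv_symb2_def sum symb1_x0_eq[OF assms(1)] c_def[symmetric] m_def[symmetric] uminus_eq_cmul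
      of_real_divide of_real_power of_real_minus of_real_1
    by (simp add: form_mat.add_right cmul_distrib matrix_mul_assoc power2_eq_square power3_eq_cube i)
qed

text \<open>Clifford multiplication is affine in \<eta>, so each entry is a polynomial of degree at
  most 2 over a power of \<open>1 + \<eta>\<^sup>2\<close> with exponent 2 or 3.\<close>

lemma symb2_decomposable:
  assumes "norm v = 1"
  shows "\<exists>u. pi_plus_rel (\<lambda>\<eta>. inv_symb2 S (sig_p1 G) (sig_p0 S G (collar_frame hh)) x0 (join v \<eta>) $ I $ J) u"
proof -
  define p where "p = p0 0"
  define A where "A = cl (join v 0)"
  define B where "B = cl dxn"
  define I' where "I' = int_vec (join v 0)"
  \<comment> \<open>The order 0 part is constant in the covector, so it does not raise the degree in
    \<eta>.\<close>
  have p: "p0 \<xi> = p" for \<xi> by (simp add: p_def sig_p0_def)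
  have "inv_symb2 S (sig_p1 G) (sig_p0 S G (collar_frame hh)) x0 (join v \<eta>) $ I $ J =
     of_real (1 / (1 + \<eta>\<^sup>2) ^ 2) * ((A ** p ** A) $ I $ J + of_real \<eta> * (A ** p ** B + B ** p ** A) $ I $ J
        + of_real (\<eta>\<^sup>2) * (B ** p ** B) $ I $ J) +
     of_real (- d) * (of_real (1 / (1 + \<eta>\<^sup>2) ^ 3) * ((A ** B ** A) $ I $ J + of_real \<eta> * (A ** B ** B + B ** B ** A) $ I $ J
        + of_real (\<eta>\<^sup>2) * (B ** B ** B) $ I $ J)) +
     of_real (- d) * (of_real (1 / (1 + \<eta>\<^sup>2) ^ 2) * ((A ** B ** I') $ I $ J + of_real \<eta> * (B ** B ** I') $ I $ J
        + of_real (\<eta>\<^sup>2) * 0))" for \<eta>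
    unfolding symb2[OF assms] p cl_join[of v \<eta>] A_def[symmetric] B_def[symmetric] I'_def[symmetric]
      vector_add_component cmul_nth sandwich_quadratic
    by (simp add: form_mat.add_left scaleR_eq_cmul)
  then show ?thesis
    by (simp only:) (intro ex_pi_plus_rel_add ex_pi_plus_rel_mult_left ex_pi_plus_rel_quadratic; simp)
qed

text \<open>Cyclicity brings both outer factors c(\<xi>) around c(\<beta>), where the sandwich
  formula reduces them to a combination of \<open>cl\<close> terms whose trace against the order 0
  part is known. The other two terms are words of four factors.\<close>

lemma trace_symb2_cl:
  assumes "norm v = 1"
  shows "trace (inv_symb2 S (sig_p1 G) (sig_p0 S G (collar_frame hh)) x0 (join v \<eta>) ** cl \<beta>) =
    of_real ((12 * d * ((1 + \<eta>\<^sup>2) * \<beta> $ 4 - 2 * (join v \<eta> \<bullet> \<beta>) * \<eta>)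
        + 8 * d * (\<eta> * (join v 0 \<bullet> \<beta>) - \<beta> $ 4)) / (1 + \<eta>\<^sup>2) ^ 2
      - 16 * d * (2 * \<eta> * (join v \<eta> \<bullet> \<beta>) - (1 + \<eta>\<^sup>2) * \<beta> $ 4) / (1 + \<eta>\<^sup>2) ^ 3)"
proof -
  let ?c = "cl (join v \<eta>)"
  have v: "v \<bullet> v = 1" using assms by (simp add: norm_eq_1)
  have \<beta>: "dxn \<bullet> \<beta> = \<beta> $ 4" "\<beta> \<bullet> dxn = \<beta> $ 4"
    by (simp_all add: inner_axis inner_axis')
  have 1: "trace (?c ** p0 (join v \<eta>) ** ?c ** cl \<beta>) =
      of_real (12 * d * ((1 + \<eta>\<^sup>2) * \<beta> $ 4 - 2 * (join v \<eta> \<bullet> \<beta>) * \<eta>))"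
  proof -
    have "trace (?c ** p0 (join v \<eta>) ** ?c ** cl \<beta>) = trace (p0 (join v \<eta>) ** (?c ** cl \<beta> ** ?c))"
      by (simp only: matrix_mul_assoc[symmetric] trace_mul_sym[of ?c])
    then show ?thesis
      unfolding cl_sandwich form_mat.diff_right form_mat.scaleR_right trace_sub trace_scaleR_form_mat trace_p0_cl
      by (simp add: inner_join v join_nth power2_eq_square algebra_simps)
  qed
  have 2: "trace (?c ** cl dxn ** ?c ** cl \<beta>) = of_real (16 * (2 * \<eta> * (join v \<eta> \<bullet> \<beta>) - (1 + \<eta>\<^sup>2) * \<beta> $ 4))"
    unfolding trace_cl4 by (simp add: inner_join v \<beta> power2_eq_square algebra_simps)
  have 3: "trace (?c ** cl dxn ** int_vec (join v 0) ** cl \<beta>) = of_real (- 8 * (\<eta> * (join v 0 \<bullet> \<beta>) - \<beta> $ 4))"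
  proof -
    have "trace (?c ** cl dxn ** int_vec (join v 0) ** cl \<beta>) = trace (int_vec (join v 0) ** cl \<beta> ** ?c ** cl dxn)"
      by (metis matrix_mul_assoc trace_mul_sym)
    then show ?thesis
      unfolding trace_int_cl3 by (simp add: inner_join v \<beta> inner_commute[of \<beta>] algebra_simps)
  qed
  show ?thesis
    unfolding symb2[OF assms] form_mat.add_left cmul_mult_left trace_add trace_cmul 1 2 3
      of_real_mult[symmetric] of_real_add[symmetric]
    by (rule arg_cong[of _ _ complex_of_real]) (simp add: add_divide_distrib diff_divide_distrib algebra_simps)
qed

text \<open>The \<xi>-derivative of the leading symbol is a combination of \<open>cl dxn\<close> and
  \<open>cl (join v 0)\<close>, so these two scalar positive parts are all that the second residue
  requires.\<close>

lemma pi_plus_trace_symb2_cl: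
  assumes "norm v = 1"
  shows "pi_plus (\<lambda>\<eta>. trace (inv_symb2 S (sig_p1 G) (sig_p0 S G (collar_frame hh)) x0 (join v \<eta>) ** cl dxn)) \<tau> =
      of_real d * (4 * \<i> / (of_real \<tau> - \<i>) ^ 3 - 6 / (of_real \<tau> - \<i>) ^ 2)" (is "?n")
    and "pi_plus (\<lambda>\<eta>. trace (inv_symb2 S (sig_p1 G) (sig_p0 S G (collar_frame hh)) x0 (join v \<eta>) ** cl (join v 0))) \<tau> =
      of_real d * (4 / (of_real \<tau> - \<i>) ^ 3 + 6 * \<i> / (of_real \<tau> - \<i>) ^ 2)" (is "?t")
proof -
  have v: "v \<bullet> v = 1" using assms by (simp add: norm_eq_1)
  \<comment> \<open>The numerators admit an expansion with double and triple poles at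
    \<open>\<i>\<close> and \<open>- \<i>\<close> and no simple ones; the coefficients supplied
    below are checked by the polynomial identity \<open>f\<close>, and the lower poles are
    discarded.\<close>
  have frac: "pi_plus (\<lambda>t. of_real d * (f t / (1 + (of_real t)\<^sup>2) ^ 3)) \<tau> =
      of_real d * (a / (of_real \<tau> - \<i>) ^ 3 + b / (of_real \<tau> - \<i>) ^ 2)"
    if f: "\<And>t. f t = a * (of_real t + \<i>) ^ 3 + b * (of_real t - \<i>) * (of_real t + \<i>) ^ 3 +
      a' * (of_real t - \<i>) ^ 3 + b' * (of_real t + \<i>) * (of_real t - \<i>) ^ 3" for f a b a' b'
  proof -
    have *: "f t / (1 + (of_real t)\<^sup>2) ^ 3 = (a / (of_real t - \<i>) ^ 3 + b / (of_real t - \<i>) ^ 2) +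
        (a' / (of_real t - - \<i>) ^ 3 + b' / (of_real t - - \<i>) ^ 2)" for t
    proof -
      define p where "p = complex_of_real t - \<i>"
      define q where "q = complex_of_real t + \<i>"
      have "Im p \<noteq> 0" "Im q \<noteq> 0" by (simp_all add: p_def q_def)
      then have pq: "p \<noteq> 0" "q \<noteq> 0" by (metis zero_complex.sel(2))+
      have N: "1 + (of_real t)\<^sup>2 = p * q"
        by (simp add: p_def q_def algebra_simps power2_eq_square)
      have "a / p ^ 3 + b / p ^ 2 + (a' / q ^ 3 + b' / q ^ 2) =
          (a * q ^ 3 + b * p * q ^ 3 + a' * p ^ 3 + b' * q * p ^ 3) / (p * q) ^ 3"
        using pq by (simp add: field_simps power2_eq_square power3_eq_cube)
      then show ?thesis
        unfolding N f p_def[symmetric] q_def[symmetric] diff_minus_eq_add by simp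
    qed
    have "pi_plus_rel (\<lambda>t. of_real d * (f t / (1 + (of_real t)\<^sup>2) ^ 3))
      (\<lambda>t. of_real d * ((a / (of_real t - \<i>) ^ 3 + b / (of_real t - \<i>) ^ 2) + (0 + 0)))"
      unfolding * by (intro pi_plus_rel_mult_left pi_plus_rel_add pi_plus_rel_upper_pole pi_plus_rel_lower_pole) auto
    then show ?thesis by (simp add: pi_plus_eq)
  qed
  have nz: "1 + complex_of_real (t\<^sup>2) \<noteq> 0" for t
    using one_plus_square_neq_0[of t] by (metis of_real_1 of_real_add of_real_eq_0_iff)
  have split: "complex_of_real (d * x / (1 + t\<^sup>2) ^ 2 - d * y / (1 + t\<^sup>2) ^ 3) =
      of_real d * ((of_real x * (1 + (of_real t)\<^sup>2) - of_real y) / (1 + (of_real t)\<^sup>2) ^ 3)" for x y t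
  proof -
    define M where "M = 1 + (complex_of_real t)\<^sup>2"
    have "M \<noteq> 0" using nz[of t] by (simp add: M_def)
    then have "D * x' / M ^ 2 - D * y' / M ^ 3 = D * ((x' * M - y') / M ^ 3)" for D x' y'
      by (simp add: field_simps power2_eq_square power3_eq_cube)
    then show ?thesis by (simp add: M_def)
  qed
  have n: "(12 * d * ((1 + t\<^sup>2) * dxn $ 4 - 2 * (join v t \<bullet> dxn) * t) + 8 * d * (t * (join v 0 \<bullet> dxn) - dxn $ 4)) / (1 + t\<^sup>2) ^ 2
      - 16 * d * (2 * t * (join v t \<bullet> dxn) - (1 + t\<^sup>2) * dxn $ 4) / (1 + t\<^sup>2) ^ 3 =
      d * (4 - 12 * t\<^sup>2) / (1 + t\<^sup>2) ^ 2 - d * (16 * (t\<^sup>2 - 1)) / (1 + t\<^sup>2) ^ 3" for t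
    by (simp add: inner_join power2_eq_square algebra_simps)
  show ?n
    unfolding trace_symb2_cl[OF assms] n split
    by (subst frac[of _ "4 * \<i>" "-6" "-4 * \<i>" "-6"])
      (simp_all add: power2_eq_square power3_eq_cube algebra_simps)
  have t: "(12 * d * ((1 + t\<^sup>2) * join v 0 $ 4 - 2 * (join v t \<bullet> join v 0) * t) + 8 * d * (t * (join v 0 \<bullet> join v 0) - join v 0 $ 4)) / (1 + t\<^sup>2) ^ 2
      - 16 * d * (2 * t * (join v t \<bullet> join v 0) - (1 + t\<^sup>2) * join v 0 $ 4) / (1 + t\<^sup>2) ^ 3 =
      d * (- 16 * t) / (1 + t\<^sup>2) ^ 2 - d * (32 * t) / (1 + t\<^sup>2) ^ 3" for t
    by (simp add: inner_join join_nth v power2_eq_square algebra_simps)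
  show ?t
    unfolding trace_symb2_cl[OF assms] t split
    by (subst frac[of _ 4 "6 * \<i>" 4 "-6 * \<i>"])
      (simp_all add: power2_eq_square power3_eq_cube algebra_simps)
qed

lemma trace_res21:
  assumes "norm v = 1"
  shows "trace (pi_plus_mat (\<lambda>\<eta>. inv_symb2 S (sig_p1 G) (sig_p0 S G (collar_frame hh)) x0 (join v \<eta>)) \<tau> **
     vector_derivative (\<lambda>\<eta>. inv_symb1 (sig_p1 G) x0 (join v \<eta>)) (at \<tau>)) =
    of_real d * (4 * (of_real \<tau> + \<i>) / (1 + (of_real \<tau>)\<^sup>2) ^ 3 + 6 * \<i> / (1 + (of_real \<tau>)\<^sup>2) ^ 2)"
proof -
  define p where "p = complex_of_real \<tau> - \<i>"
  define q where "q = complex_of_real \<tau> + \<i>"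
  have "Im p \<noteq> 0" "Im q \<noteq> 0" by (simp_all add: p_def q_def)
  then have pq: "p \<noteq> 0" "q \<noteq> 0" by (metis zero_complex.sel(2))+
  have N: "1 + (of_real \<tau>)\<^sup>2 = p * q"
    by (simp add: p_def q_def algebra_simps power2_eq_square)
  define X where "X = 4 * \<i> / p ^ 3 - 6 / p ^ 2"
  \<comment> \<open>The tangential positive part is \<open>- \<i>\<close> times the normal one. Both
    terms of the derivative then combine to one multiple of \<open>X\<close> with numerator
    \<open>- (p ^ 2)\<close>, which cancels the double pole and lowers the triple one.\<close>
  have X: "4 / p ^ 3 + 6 * \<i> / p ^ 2 = - \<i> * X"
    by (simp add: X_def algebra_simps)
  have X2: "p ^ 2 * X = 4 * \<i> / p - 6"
    using pq by (simp add: X_def right_diff_distrib power2_eq_square power3_eq_cube)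
  note deco = trace_pi_plus_mat[OF symb2_decomposable[OF assms]]
  have "trace (pi_plus_mat (\<lambda>\<eta>. inv_symb2 S (sig_p1 G) (sig_p0 S G (collar_frame hh)) x0 (join v \<eta>)) \<tau> **
     vector_derivative (\<lambda>\<eta>. inv_symb1 (sig_p1 G) x0 (join v \<eta>)) (at \<tau>)) =
     of_real (- 2 * \<tau> / (1 + \<tau>\<^sup>2) ^ 2) * (\<i> * (of_real d * (- \<i> * X))) +
     of_real ((1 - \<tau>\<^sup>2) / (1 + \<tau>\<^sup>2) ^ 2) * (\<i> * (of_real d * X))"
    unfolding symb1_x0_deriv[OF assms] form_mat.add_right form_mat.scaleR_right cmul_mult_right
      trace_add trace_scaleR_form_mat trace_cmul deco pi_plus_trace_symb2_cl[OF assms]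
      p_def[symmetric] X X_def[symmetric] ..
  also have "\<dots> = of_real d * \<i> * X * ((1 - (of_real \<tau>)\<^sup>2 + 2 * \<i> * of_real \<tau>) / (p * q) ^ 2)"
    unfolding N[symmetric] by (simp add: divide_inverse algebra_simps)
  also have "1 - (of_real \<tau>)\<^sup>2 + 2 * \<i> * of_real \<tau> = - (p ^ 2)"
    by (simp add: p_def power2_eq_square algebra_simps)
  also have "of_real d * \<i> * X * (- (p ^ 2) / (p * q) ^ 2) = of_real d * ((- \<i> * (p ^ 2 * X)) / (p * q) ^ 2)"
    by (simp add: divide_inverse)
  also have "- \<i> * (p ^ 2 * X) = 4 / p + 6 * \<i>"
    unfolding X2 by (simp add: right_diff_distrib mult.left_commute[of \<i> 4])
  also have "(4 / p + 6 * \<i>) / (p * q) ^ 2 = 4 * q / (p * q) ^ 3 + 6 * \<i> / (p * q) ^ 2"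
    using pq by (simp add: add_divide_distrib power2_eq_square power3_eq_cube)
  finally show ?thesis by (simp only: N q_def)
qed

text \<open>The line integral is \<open>\<i> * (9 * pi / 2)\<close> times \<open>d\<close>; the
  prefactor \<open>- \<i>\<close> makes it real and the sphere contributes
  \<open>4 pi\<close>.\<close>

lemma res21_value:
  "res21 (inv_symb2 S (sig_p1 G) (sig_p0 S G (collar_frame hh))) (inv_symb1 (sig_p1 G)) x' = of_real (18 * pi\<^sup>2 * d)"
proof -
  have "sphere_integral (\<lambda>\<xi>'. LINT \<tau>|lborel. trace (
     pi_plus_mat (\<lambda>\<eta>. inv_symb2 S (sig_p1 G) (sig_p0 S G (collar_frame hh)) (join x' 0) (join \<xi>' \<eta>)) \<tau> **
     vector_derivative (\<lambda>\<eta>. inv_symb1 (sig_p1 G) (join x' 0) (join \<xi>' \<eta>)) (at \<tau>)))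
     = of_real (4 * pi) * (of_real d * (\<i> * of_real (9 * pi / 2)))"
  proof (rule sphere_integral_const)
    fix v :: "real ^ 3" assume v: "norm v = 1"
    show "(LINT \<tau>|lborel. trace (
     pi_plus_mat (\<lambda>\<eta>. inv_symb2 S (sig_p1 G) (sig_p0 S G (collar_frame hh)) (join x' 0) (join v \<eta>)) \<tau> **
     vector_derivative (\<lambda>\<eta>. inv_symb1 (sig_p1 G) (join x' 0) (join v \<eta>)) (at \<tau>))) =
      of_real d * (\<i> * of_real (9 * pi / 2))"
      unfolding trace_res21[OF v] integral_mult_right_zero integral_res21 ..
  qed
  then show ?thesis
    unfolding res21_def by (simp add: power2_eq_square mult_ac)
qed

end

section \<open>Globalisation over the boundary\<close>

text \<open>The cover chosen by \<open>SOME\<close> does not depend on the form, so both integrals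
  are cut into the same pieces and no independence of the cover is involved. Pulling out \<kappa> is
  valid for every integrand: a Lebesgue integral that does not exist has value 0.\<close>

lemma form_integral_scaled:
  fixes \<omega>' :: "('a, 'n::finite) chart \<Rightarrow> 'a \<Rightarrow> real"
  assumes ex: "\<exists>cs. set cs \<subseteq> charts X H A \<and> (\<Union>c\<in>set cs. fst c) = topspace X"
    and eq: "\<And>c p. c \<in> charts X H A \<Longrightarrow> p \<in> fst c \<Longrightarrow> \<omega> c p = \<kappa> * complex_of_real (\<omega>' c p)"
  shows "form_integral X H A \<omega> = \<kappa> * of_real (form_integral X H A \<omega>')"
proof -
  define cs where "cs = (SOME cs. set cs \<subseteq> charts X H A \<and> (\<Union>c\<in>set cs. fst c) = topspace X)"
  have cs: "set cs \<subseteq> charts X H A"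
    using someI_ex[OF ex] by (simp add: cs_def)
  define E where "E = (\<lambda>k. snd (cs ! k) ` (fst (cs ! k) - (\<Union>j<k. fst (cs ! j))))"
  have "(LINT x:E k|lborel. \<omega> (cs ! k) (chart_inv (cs ! k) x)) =
      \<kappa> * of_real (LINT x:E k|lborel. \<omega>' (cs ! k) (chart_inv (cs ! k) x))" if "k < length cs" for k
  proof -
    have c: "cs ! k \<in> charts X H A" using cs that by auto
    have "indicat_real (E k) x *\<^sub>R \<omega> (cs ! k) (chart_inv (cs ! k) x) =
        \<kappa> * of_real (indicat_real (E k) x *\<^sub>R \<omega>' (cs ! k) (chart_inv (cs ! k) x))" for x
    proof (cases "x \<in> E k")
      case True
      then have "x \<in> snd (cs ! k) ` fst (cs ! k)" by (auto simp: E_def)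
      then have "chart_inv (cs ! k) x \<in> fst (cs ! k)"
        by (simp add: chart_inv_def inv_into_into)
      then show ?thesis using True by (simp add: eq[OF c])
    qed simp
    then show ?thesis
      unfolding set_lebesgue_integral_def by (simp only: integral_mult_right_zero integral_complex_of_real)
  qed
  then show ?thesis
    unfolding form_integral_def Let_def cs_def[symmetric] E_def
    by (simp add: sum_distrib_left)
qed

text \<open>This is the area of the unit 2-sphere, the same \<open>4 pi\<close> that comes from
  \<open>sphere_integral\<close>.\<close>

lemma Omega3_eq: "Omega3 = 4 * pi"
proof -
  have "Gamma (3 / 2 :: real) = Gamma (1 / 2 + 1)" by simp
  also have "\<dots> = 1 / 2 * Gamma (1 / 2)"
    by (rule Gamma_plus1) auto
  finally have G: "Gamma (3 / 2 :: real) = sqrt pi / 2"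
    by (simp add: Gamma_one_half_real)
  have P: "pi powr (3 / 2) = pi * sqrt pi"
    using powr_add[of pi 1 "1 / 2"] by (simp add: powr_half_sqrt)
  show ?thesis unfolding Omega3_def G P by simp
qed

text \<open>The strip of negative heights added by the extension puts the boundary point into the
  interior of the chart image, and flatness of the chart makes the tangential block a multiple of
  the identity.\<close>

lemma flat_collar_ext_collar_chart:
  assumes collar: "is_collar X A Uc b xn" and "\<epsilon> > 0"
    and f: "f \<in> flat_charts (bdry_top X A) UNIV (bdry_atlas X A) gB" and p: "p \<in> fst f"
    and gH_collar: "\<And>q. q \<in> fst (ext_collar_chart X A \<epsilon> Uc b xn f) \<Longrightarrow>
        gH (ext_collar_chart X A \<epsilon> Uc b xn f) q = collar_metric (1 / hh (xn (fst q) + snd q)) (gB f (b (fst q)))"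
    and hh: "\<And>s. s \<in> {-\<epsilon><..<1} \<Longrightarrow> hh s > 0" "hh 0 = 1" "(hh has_real_derivative d) (at 0)"
  defines "ec \<equiv> ext_collar_chart X A \<epsilon> Uc b xn f"
  shows "flat_collar (snd ec ` fst ec) {y. tang y \<in> snd f ` fst f \<and> -\<epsilon> < y $ 4 \<and> y $ 4 < 1}
     (coord_metric gH ec) hh d (snd f p)" (is "flat_collar ?S ?N _ _ _ _")
proof
  have f': "f \<in> bdry_charts X A" and ch: "is_chart (bdry_top X A) UNIV f"
    and flat: "\<And>q. q \<in> fst f \<Longrightarrow> gB f q = mat 1"
    using f by (auto simp: flat_charts_def charts_def)
  have bd: "fst f \<subseteq> bdry X A"
    using ch openin_subset[of "bdry_top X A" "fst f"] by (auto simp: is_chart_def bdry_top_def)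
  have W: "open (snd f ` fst f)"
    using ch by (simp add: is_chart_def)
  have "open (tang -` (snd f ` fst f) \<inter> ({y. - \<epsilon> < y $ 4} \<inter> {y. y $ 4 < 1}))"
    by (intro open_Int open_vimage W open_halfspace_component_lt_cart open_halfspace_component_gt_cart
        linear_continuous_on bounded_linear_tang)
  moreover have "tang -` (snd f ` fst f) \<inter> ({y. - \<epsilon> < y $ 4} \<inter> {y. y $ 4 < 1}) = ?N"
    by auto
  ultimately show "open ?N" by simp
  have top: "topspace (ext_top X A \<epsilon>) = topspace X \<times> {0} \<union> bdry X A \<times> {-\<epsilon><..0}"
    by (auto simp: ext_top_def bdry_def)
  have Uc: "Uc \<subseteq> topspace X" "bdry X A \<subseteq> Uc"
    using collar openin_subset unfolding is_collar_def by blast+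
  have on_bdry: "b q = q" "xn q = 0" if "q \<in> bdry X A" for q
    using collar that unfolding is_collar_def by blast+
  show "?N \<subseteq> ?S"
  proof
    fix y assume y: "y \<in> ?N"
    show "y \<in> ?S"
    \<comment> \<open>Nonnegative heights are realised by points of \<open>M\<close>, stored with
      second component 0; negative heights lie over the boundary point itself and are stored in the
      second component.\<close>
    proof (cases "0 \<le> y $ 4")
      case True
      then have "y \<in> snd (collar_chart Uc b xn f) ` fst (collar_chart Uc b xn f)"
        unfolding collar_chart_image[OF collar f'] using y by simp
      then obtain q where q: "q \<in> Uc" "b q \<in> fst f" "y = join (snd f (b q)) (xn q)"
        by (auto simp: collar_chart_def)
      have "(q, 0) \<in> fst ec" "snd ec (q, 0) = y"
        using q Uc by (auto simp: ec_def ext_collar_chart_def top)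
      then show ?thesis by (metis imageI)
    next
      case False
      obtain q where q: "q \<in> fst f" "tang y = snd f q"
        using y by auto
      have "(q, y $ 4) \<in> fst ec"
        using q bd Uc y False on_bdry by (auto simp: ec_def ext_collar_chart_def top)
      moreover have "snd ec (q, y $ 4) = y"
        using q bd on_bdry[of q] join_tang[of y] by (auto simp: ec_def ext_collar_chart_def)
      ultimately show ?thesis by (metis imageI)
    qed
  qed
  then have sub: "y \<in> ?S" if "y \<in> ?N" for y using that by blast
  show "join (snd f p) 0 \<in> ?N"
    using p \<open>\<epsilon> > 0\<close> by (simp add: join_nth)
  show "0 < hh (y $ 4)" if "y \<in> ?N" for y
    using that hh(1) by simp
  show "coord_metric gH ec y = collar_metric (1 / hh (y $ 4)) (mat 1)" if "y \<in> ?N" for y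
  proof -
    define r where "r = chart_inv ec y"
    have r: "r \<in> fst ec" "snd ec r = y"
      using sub[OF that] by (simp_all add: r_def chart_inv_def inv_into_into f_inv_into_f)
    then have y: "y $ 4 = xn (fst r) + snd r" and "b (fst r) \<in> fst f"
      by (auto simp: ec_def ext_collar_chart_def join_nth)
    then show ?thesis
      using gH_collar[of r] r(1) flat[of "b (fst r)"] by (simp add: coord_metric_def ec_def flip: r_def[unfolded ec_def])
  qed
qed (use hh in auto)

theorem theorem4p2:
  fixes X :: "'a topology" and A :: "('a, 4) chart set"
    and gM :: "('a, 4) metric_coeffs" and gB :: "('a, 3) metric_coeffs"
    and gH :: "('a \<times> real, 4) metric_coeffs"
    and Uc :: "'a set" and b :: "'a \<Rightarrow> 'a" and xn :: "'a \<Rightarrow> real"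
    and \<epsilon> :: real and h hh :: "real \<Rightarrow> real"
  defines "Y \<equiv> ext_top X A \<epsilon>"
    and "B \<equiv> ext_atlas X A \<epsilon> Uc b xn"
    and "ec \<equiv> ext_collar_chart X A \<epsilon> Uc b xn"
    and "cc \<equiv> collar_chart Uc b xn"
    and "F \<equiv> flat_charts (bdry_top X A) UNIV (bdry_atlas X A) gB"
  assumes M: "compact_space X" "Hausdorff_space X" "oriented_atlas X half_space A"
    and gM: "riemannian_metric X half_space A gM"
    and gB: "riemannian_metric (bdry_top X A) UNIV (bdry_atlas X A) gB"
    and collar: "is_collar X A Uc b xn"
    and eps: "\<epsilon> > 0"
    and hh: "smooth_on {-\<epsilon><..<1} hh" "\<forall>s\<in>{-\<epsilon><..<1}. hh s > 0"
    and h: "\<forall>s\<in>{0..<1}. h s = hh s" "h 0 = 1"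
    and gM_collar: "\<forall>c\<in>bdry_charts X A. \<forall>p\<in>fst (cc c).
                      gM (cc c) p = collar_metric (1 / h (xn p)) (gB c (b p))"
    and gH: "riemannian_metric Y UNIV B gH"
    and gH_ext: "metric_extends (charts X half_space A) (charts Y UNIV B) gM gH"
    and gH_collar: "\<forall>c\<in>bdry_charts X A. \<forall>q\<in>fst (ec c).
                      gH (ec c) q = collar_metric (1 / hh (xn (fst q) + snd q)) (gB c (b (fst q)))"
    and flat: "flat_manifold (bdry_top X A) UNIV (bdry_atlas X A) gB"
  shows "form_integral (bdry_top X A) UNIV (bdry_atlas X A)
           (form_from_charts F (\<lambda>f. res11 (Dinv_symb1 gH (ec f)) (Dinv_symb1 gH (ec f))))
         = of_real (pi / 2 * Omega3 * I_Gr_b X A gM gB Uc b xn) \<and>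
         form_integral (bdry_top X A) UNIV (bdry_atlas X A)
           (form_from_charts F (\<lambda>f. res21 (Dinv_symb2 gH hh (ec f)) (Dinv_symb1 gH (ec f))))
         = of_real (- (3 * pi / 2) * Omega3 * I_Gr_b X A gM gB Uc b xn)"
proof -
  have "hh differentiable (at 0)"
    using hh(1) eps by (intro smooth_on_imp_differentiable[of "{-\<epsilon><..<1}"]) auto
  then obtain d where d: "(hh has_real_derivative d) (at 0)"
    by (auto simp: real_differentiable_def)
  have hh0: "hh 0 = 1"
    using h by (metis atLeastLessThan_iff order_refl zero_less_one)
  have F: "f \<in> bdry_charts X A" if "f \<in> F" for f
    using that by (simp add: F_def flat_charts_def)
  have cover: "\<exists>f\<in>F. p \<in> fst f" if "p \<in> topspace (bdry_top X A)" for p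
    using flat that by (simp add: flat_manifold_def F_def)
  have bd: "fst c \<subseteq> topspace (bdry_top X A)" if "c \<in> bdry_charts X A" for c
    using that openin_subset[of "bdry_top X A" "fst c"] by (auto simp: charts_def is_chart_def)
  have ex: "\<exists>cs. set cs \<subseteq> bdry_charts X A \<and> (\<Union>c\<in>set cs. fst c) = topspace (bdry_top X A)"
  proof -
    have "openin (bdry_top X A) (fst f)" if "f \<in> F" for f
      using F[OF that] by (simp add: charts_def is_chart_def)
    from finite_chart_cover[OF compact_space_bdry_top[OF M(3,1)] this cover]
    show ?thesis using F by (meson subset_iff)
  qed
  let ?K = "\<lambda>c p. extrinsic_K gM gB (collar_chart Uc b xn c) c p * sqrt (det (gB c p))"
  have K: "?K c p = - 3 / 2 * d * sqrt (det (gB c p))" if "c \<in> bdry_charts X A" "p \<in> fst c" for c p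
  proof -
    have "p \<in> bdry X A" using bd[OF that(1)] that(2) by (auto simp: bdry_top_def)
    then show ?thesis
      using extrinsic_K_collar[OF collar that(1) gM gB _ _ hh0 d that(2), of h] gM_collar h(1) that(1)
      by (simp add: cc_def)
  qed
  \<comment> \<open>The local density is the same constant in every flat chart, so the chart picked
    by \<open>SOME\<close> at each point does not matter, and its Jacobian determinant becomes the
    Riemannian density.\<close>
  have dens: "form_from_charts F (\<lambda>f. r f) c p = of_real (\<rho> * d) * of_real (sqrt (det (gB c p)))"
    if "\<And>f p. f \<in> F \<Longrightarrow> p \<in> fst f \<Longrightarrow> r f (snd f p) = of_real (\<rho> * d)"
      "c \<in> bdry_charts X A" "p \<in> fst c" for r \<rho> c p
  proof -
    define f where "f = (SOME f. f \<in> F \<and> p \<in> fst f)"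
    have "\<exists>f. f \<in> F \<and> p \<in> fst f" using cover bd that(2,3) by blast
    then have f: "f \<in> F" "p \<in> fst f"
      using someI_ex[of "\<lambda>f. f \<in> F \<and> p \<in> fst f"] by (auto simp: f_def)
    have "sqrt (det (gB c p)) = det (jacobian c f p)"
      using bdry_sqrt_det_metric[OF M(3) gB that(2) _ that(3) f(2)] f(1) by (simp add: F_def)
    then show ?thesis
      by (simp add: form_from_charts_def that(1)[OF f] mult.commute flip: f_def)
  qed
  have fc: "flat_collar (snd (ec f) ` fst (ec f)) {y. tang y \<in> snd f ` fst f \<and> -\<epsilon> < y $ 4 \<and> y $ 4 < 1}
     (coord_metric gH (ec f)) hh d (snd f p)" if "f \<in> F" "p \<in> fst f" for f p
    unfolding ec_def
    by (rule flat_collar_ext_collar_chart[OF collar eps])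
      (use that gH_collar F hh(2) hh0 d in \<open>auto simp: F_def ec_def\<close>)
  \<comment> \<open>The factor solves \<open>-6 pi^2 d = \<kappa> * (-3 d / 2)\<close>; for the
    second residue \<open>18 pi^2 d\<close> in place of \<open>-6 pi^2 d\<close> gives
    \<open>-12 pi^2\<close>. As multiplicative identities these include
    \<open>d = 0\<close>.\<close>
  have 11: "form_integral (bdry_top X A) UNIV (bdry_atlas X A)
           (form_from_charts F (\<lambda>f. res11 (Dinv_symb1 gH (ec f)) (Dinv_symb1 gH (ec f))))
         = of_real (4 * pi\<^sup>2) * of_real (form_integral (bdry_top X A) UNIV (bdry_atlas X A) ?K)"
  proof (rule form_integral_scaled[OF ex])
    fix c p assume c: "c \<in> bdry_charts X A" "p \<in> fst c"
    have "form_from_charts F (\<lambda>f. res11 (Dinv_symb1 gH (ec f)) (Dinv_symb1 gH (ec f))) c p =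
        of_real (- 6 * pi\<^sup>2 * d) * of_real (sqrt (det (gB c p)))"
      by (rule dens[OF _ c]) (unfold Dinv_symb1_def, rule flat_collar.res11_value[OF fc])
    then show "form_from_charts F (\<lambda>f. res11 (Dinv_symb1 gH (ec f)) (Dinv_symb1 gH (ec f))) c p =
        of_real (4 * pi\<^sup>2) * of_real (?K c p)"
      unfolding K[OF c] by simp
  qed
  have 21: "form_integral (bdry_top X A) UNIV (bdry_atlas X A)
           (form_from_charts F (\<lambda>f. res21 (Dinv_symb2 gH hh (ec f)) (Dinv_symb1 gH (ec f))))
         = of_real (- 12 * pi\<^sup>2) * of_real (form_integral (bdry_top X A) UNIV (bdry_atlas X A) ?K)"
  proof (rule form_integral_scaled[OF ex])
    fix c p assume c: "c \<in> bdry_charts X A" "p \<in> fst c"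
    have "form_from_charts F (\<lambda>f. res21 (Dinv_symb2 gH hh (ec f)) (Dinv_symb1 gH (ec f))) c p =
        of_real (18 * pi\<^sup>2 * d) * of_real (sqrt (det (gB c p)))"
      by (rule dens[OF _ c]) (unfold Dinv_symb1_def Dinv_symb2_def Let_def, rule flat_collar.res21_value[OF fc])
    then show "form_from_charts F (\<lambda>f. res21 (Dinv_symb2 gH hh (ec f)) (Dinv_symb1 gH (ec f))) c p =
        of_real (- 12 * pi\<^sup>2) * of_real (?K c p)"
      unfolding K[OF c] by simp
  qed
  \<comment> \<open>\<open>I_Gr_b\<close> carries a factor 2, so
    \<open>pi / 2 * 4 pi * 2 = 4 pi^2\<close> and
    \<open>- 3 pi / 2 * 4 pi * 2 = - 12 pi^2\<close>.\<close>
  show ?thesis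
    unfolding 11 21 I_Gr_b_def Omega3_eq by (simp add: power2_eq_square)
qed

end
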